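(* A generalized complex, respectively paracomplex, Lie group is a classical complex, respectively paracomplex, Lie group $(G,A)$ endowed with a multiplicative Poisson bivector field $\pi$ such that the pair $(\pi,A)$ is a Poisson-Nijenhuis structure. That is, for a real Lie group $G$, the generalized complex (respectively paracomplex) structures $\Phi$ on $G$ for which $(G,\Phi)$ is a generalized complex (respectively paracomplex) Lie group are exactly the endomorphisms $\Phi(X,\alpha)=(AX+\sharp_\pi\alpha,\,-\alpha\circ A)$ (i.e. with $\sigma=0$) where $(G,A)$ is a classical complex (respectively paracomplex) Lie group, $\pi$ is a multiplicative Poisson bivector field on $G$, and $(\pi,A)$ is a Poisson-Nijenhuis structure.
   Context: All objects are $C^\infty$. $\Gamma$ denotes spaces of sections, $\chi^2(M)$ bivector fields. $T^{big}M=TM\oplus T^*M$ carries the metric $g((X,\alpha),(Y,\beta))=\frac12(\alpha(Y)+\beta(X))$ and the Courant bracket $[(X,\alpha),(Y,\beta)]=([X,Y],\,L_X\beta-L_Y\alpha+\frac12 d(\alpha(Y)-\beta(X)))$. For a bivector field $\pi$, $\sharp_\pi\alpha=i(\alpha)\pi$, i.e. $\beta(\sharp_\pi\alpha)=\pi(\alpha,\beta)$; for a $2$-form $\sigma$, $\flat_\sigma X=i(X)\sigma$. A generalized almost c.p.s. structure on $M$ is $\Phi\in\Gamma(End\,T^{big}M)$ with $g(\mathcal X,\Phi\mathcal Y)+g(\Phi\mathcal X,\mathcal Y)=0$ and $\Phi^2=\epsilon\,Id$, where $\epsilon=-1$ (complex), $\epsilon=1$ (paracomplex) or $\epsilon=0$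 (subtangent). Equivalently, $\Phi(X,\alpha)=(AX+\sharp_\pi\alpha,\ \flat_\sigma X-\alpha\circ A)$ for a $(1,1)$-tensor field $A$, a bivector field $\pi$ and a $2$-form $\sigma$ (the classical tensor fields of $\Phi$) satisfying $A^2=\epsilon Id-\sharp_\pi\circ\flat_\sigma$, $\pi(\alpha\circ A,\beta)=\pi(\alpha,\beta\circ A)$, $\sigma(AX,Y)=\sigma(X,AY)$. $\Phi$ is integrable, and is then called a generalized c.p.s. structure, if $[\Phi\mathcal X,\Phi\mathcal Y]-\Phi[\mathcal X,\Phi\mathcal Y]-\Phi[\Phi\mathcal X,\mathcal Y]+\Phi^2[\mathcal X,\mathcal Y]=0$ for all sections $\mathcal X,\mathcal Y$ of $T^{big}M$ (Courant brackets). A mapping $f:(M_1,\Phi_1)\to(M_2,\Phi_2)$ of generalized c.p.s. manifolds with classical tensor fields $A_j,\pi_j,\sigma_j$ is a generalized c.p.s. mapping if $\pi_2=f_*\pi_1$ ($\pi_1$ and $\pi_2$ are $f$-related), $\sigma_1=f^*\sigma_2$ and $A_2\circ f_*=f_*\circ A_1$. A generalized c.p.s. Lie group (generalized complex if $\epsilon=-1$, generalized paracomplex if $\epsilon=1$) is a real Lie group $G$ with a generalized c.p.s. structure $\Phi$ such that the multiplication $\mu(g_1,g_2)=g_1g_2$ is a generalized c.p.s. mapping $\mu:(G\times G,\Phi\oplus\Phi)\to(G,\Phi)$. A classical complex (paracomplex) structure is $A\in\Gamma(End\,TG)$ with $A^2=-Id$ ($A^2=Id$) and vanishing Nijenhuis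 tensor; $(G,A)$ is a classical complex (paracomplex) Lie group if moreover $A\circ\mu_*=\mu_*\circ(A\oplus A)$. A Poisson bivector field $\pi$ on $G$ is multiplicative if $\mu:(G\times G,\pi\oplus\pi)\to(G,\pi)$ is a Poisson mapping. A pair $(w\in\chi^2(M),A\in\Gamma(End\,TM))$ is a Poisson-Nijenhuis structure if $w(\alpha\circ A,\beta)=w(\alpha,\beta\circ A)$ (compatibility), $[w,w]=0$ (Schouten-Nijenhuis bracket), the Nijenhuis tensor $\mathcal N_A$ vanishes, and the Schouten concomitant $C_{(w,A)}(\alpha,\beta)=\beta\circ L_{\sharp_w\alpha}A-\alpha\circ L_{\sharp_w\beta}A+d(w(\alpha,\beta))\circ A-d(w(\alpha\circ A,\beta))$ vanishes. *)

theory Defs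
  imports "HOL-Analysis.Analysis" "HOL-Library.Function_Algebras"
begin

section \<open>Linear algebra preliminaries\<close>

text \<open>
  Tangent vectors, covectors and tensors are represented by functions; the pointwise vector space
  structure on function types makes the library's notions for real vector spaces available.
\<close>

instantiation "fun" :: (type, real_vector) real_vector
begin

definition scaleR_fun :: "real \<Rightarrow> ('a \<Rightarrow> 'b) \<Rightarrow> 'a \<Rightarrow> 'b"
  where "scaleR_fun c f = (\<lambda>x. c *\<^sub>R f x)"

instance
  by standard (simp_all add: scaleR_fun_def fun_eq_iff scaleR_add_right scaleR_add_left)

end

lemma scaleR_fun_apply [simp]: "(c *\<^sub>R f) x = c *\<^sub>R f x"
  by (simp add: scaleR_fun_def)

text \<open>
  Linear maps between subspaces; they are extended by \<open>0\<close> outside the domain, so that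
  equality of functions is equality of linear maps.
\<close>

definition lin_maps :: "'v::real_vector set \<Rightarrow> 'w::real_vector set \<Rightarrow> ('v \<Rightarrow> 'w) set" where
  "lin_maps V W = {f. f ` V \<subseteq> W \<and> (\<forall>x\<in>V. \<forall>y\<in>V. f (x + y) = f x + f y)
     \<and> (\<forall>c. \<forall>x\<in>V. f (c *\<^sub>R x) = c *\<^sub>R f x) \<and> (\<forall>x. x \<notin> V \<longrightarrow> f x = 0)}"

definition skew_forms :: "'v::real_vector set \<Rightarrow> ('v \<Rightarrow> 'v \<Rightarrow> real) set" where
  "skew_forms V = {b. b \<in> lin_maps V (lin_maps V UNIV) \<and> (\<forall>x\<in>V. \<forall>y\<in>V. b x y = - b y x)}"

text \<open>
  The model spaces of manifolds: the finite-dimensional real inner product spaces, i.e. those with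
  a finite set whose orthogonal complement is \<open>0\<close>. Completeness and the Heine-Borel property
  hold automatically in finite dimension and only serve to make the library theorems of these
  classes applicable. In contrast to class \<open>euclidean_space\<close>, dimension \<open>0\<close> is included (type
  \<open>unit\<close>).
\<close>

class fin_dim_inner = real_inner + banach + heine_borel +
  assumes finite_total_set: "\<exists>B. finite B \<and> (\<forall>x. (\<forall>b\<in>B. inner x b = 0) \<longrightarrow> x = 0)"

instance euclidean_space \<subseteq> fin_dim_inner
proof
  show "\<exists>B :: 'a set. finite B \<and> (\<forall>x. (\<forall>b\<in>B. inner x b = 0) \<longrightarrow> x = 0)"
    using finite_Basis euclidean_all_zero_iff by blast
qed

instance prod :: (fin_dim_inner, fin_dim_inner) fin_dim_inner
proof
  obtain B :: "'a set" where B: "finite B" "\<And>x. (\<forall>b\<in>B. inner x b = 0) \<Longrightarrow> x = 0"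
    using finite_total_set by blast
  obtain C :: "'b set" where C: "finite C" "\<And>x. (\<forall>b\<in>C. inner x b = 0) \<Longrightarrow> x = 0"
    using finite_total_set by blast
  let ?D = "(\<lambda>x. (x, 0)) ` B \<union> (\<lambda>y. (0, y)) ` C :: ('a \<times> 'b) set"
  have "x = 0" if "\<forall>d\<in>?D. inner x d = 0" for x
    using that B(2)[of "fst x"] C(2)[of "snd x"]
    by (simp add: ball_Un inner_prod_def prod_eq_iff)
  moreover have "finite ?D" using B C by simp
  ultimately show "\<exists>D :: ('a \<times> 'b) set. finite D \<and> (\<forall>x. (\<forall>b\<in>D. inner x b = 0) \<longrightarrow> x = 0)"
    by blast
qed

instantiation unit :: real_inner
begin

definition [simp]: "(0::unit) = ()"
definition [simp]: "(x::unit) + y = ()"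
definition [simp]: "c *\<^sub>R (x::unit) = ()"
definition [simp]: "inner (x::unit) y = 0"
definition [simp]: "norm (x::unit) = 0"
definition [simp]: "sgn (x::unit) = ()"
definition [simp]: "dist (x::unit) y = 0"
definition "(uniformity :: (unit \<times> unit) filter)
  = (INF e\<in>{0<..}. principal {(x, y). dist x y < e})"
definition "open (U :: unit set)
  \<longleftrightarrow> (\<forall>x\<in>U. eventually (\<lambda>(x', y). x' = x \<longrightarrow> y \<in> U) uniformity)"

instance
  by standard (auto simp: uniformity_unit_def open_unit_def)

end

lemma LIMSEQ_unit: "(f :: nat \<Rightarrow> unit) \<longlonglongrightarrow> l"
  by (simp add: tendsto_iff)

instance unit :: "{banach, heine_borel}"
proof
  fix f :: "nat \<Rightarrow> unit"
  show "\<exists>l r. strict_mono (r::nat\<Rightarrow>nat) \<and> (f \<circ> r) \<longlonglongrightarrow> l"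
    using LIMSEQ_unit strict_mono_id by blast
  show "convergent f"
    using LIMSEQ_unit convergent_def by blast
qed

instance unit :: fin_dim_inner
  by standard auto

section \<open>Smooth manifolds and Lie groups\<close>

primrec Ck_on :: "nat \<Rightarrow> 'e::real_normed_vector set \<Rightarrow> ('e \<Rightarrow> 'f::real_normed_vector) \<Rightarrow> bool" where
  "Ck_on 0 S f \<longleftrightarrow> continuous_on S f"
| "Ck_on (Suc k) S f \<longleftrightarrow>
     (\<forall>x\<in>S. f differentiable (at x)) \<and> (\<forall>v. Ck_on k S (\<lambda>x. frechet_derivative f (at x) v))"

text \<open>To be used for open sets \<open>S\<close> in finite-dimensional spaces only.\<close>

definition smooth_on :: "'e::real_normed_vector set \<Rightarrow> ('e \<Rightarrow> 'f::real_normed_vector) \<Rightarrow> bool" where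
  "smooth_on S f \<longleftrightarrow> (\<forall>k. Ck_on k S f)"

text \<open>A chart is a pair of its domain and its coordinate map, whose values outside the domain are
  irrelevant.\<close>

type_synonym ('a, 'e) chart = "'a set \<times> ('a \<Rightarrow> 'e)"
type_synonym ('a, 'e) atlas = "('a, 'e) chart set"

definition is_chart :: "('a::topological_space, 'e::fin_dim_inner) chart \<Rightarrow> bool" where
  "is_chart = (\<lambda>(U, \<phi>). open U \<and> open (\<phi> ` U) \<and> (\<exists>\<psi>. homeomorphism U (\<phi> ` U) \<phi> \<psi>))"

text \<open>The underlying topological space of a manifold is a whole type, its smooth structure is given
  by an atlas (not necessarily a maximal one).\<close>

definition smooth_manifold ::
  "('a::{t2_space, second_countable_topology}, 'e::fin_dim_inner) atlas \<Rightarrow> bool" where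
  "smooth_manifold M \<longleftrightarrow> (\<forall>c\<in>M. is_chart c) \<and> (\<Union>(U, \<phi>)\<in>M. U) = UNIV
     \<and> (\<forall>(U, \<phi>)\<in>M. \<forall>(V, \<psi>)\<in>M. smooth_on (\<phi> ` (U \<inter> V)) (\<psi> \<circ> inv_into U \<phi>))"

definition smooth_map ::
  "('a::topological_space, 'e::fin_dim_inner) atlas \<Rightarrow> ('b::topological_space, 'f::fin_dim_inner) atlas
    \<Rightarrow> ('a \<Rightarrow> 'b) \<Rightarrow> bool" where
  "smooth_map M N f \<longleftrightarrow> continuous_on UNIV f
     \<and> (\<forall>(U, \<phi>)\<in>M. \<forall>(V, \<psi>)\<in>N. smooth_on (\<phi> ` (U \<inter> f -` V)) (\<psi> \<circ> f \<circ> inv_into U \<phi>))"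

definition smooth_funs :: "('a, 'e::fin_dim_inner) atlas \<Rightarrow> ('a \<Rightarrow> real) set" where
  "smooth_funs M = {f. \<forall>(U, \<phi>)\<in>M. smooth_on (\<phi> ` U) (f \<circ> inv_into U \<phi>)}"

definition prod_atlas ::
  "('a, 'e) atlas \<Rightarrow> ('b, 'f) atlas \<Rightarrow> ('a \<times> 'b, 'e \<times> 'f) atlas" where
  "prod_atlas M N = (\<lambda>((U, \<phi>), (V, \<psi>)). (U \<times> V, map_prod \<phi> \<psi>)) ` (M \<times> N)"

definition lie_group ::
  "('a::{t2_space, second_countable_topology}, 'e::fin_dim_inner) atlas
    \<Rightarrow> ('a \<Rightarrow> 'a \<Rightarrow> 'a) \<Rightarrow> 'a \<Rightarrow> ('a \<Rightarrow> 'a) \<Rightarrow> bool" where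
  "lie_group M mul e ginv \<longleftrightarrow> smooth_manifold M \<and> group mul e ginv
     \<and> smooth_map (prod_atlas M M) M (\<lambda>(x, y). mul x y) \<and> smooth_map M M ginv"

section \<open>Tangent and cotangent spaces\<close>

text \<open>
  Tangent vectors are derivations at \<open>p\<close> of the algebra of smooth functions, extended by
  \<open>0\<close> to non-smooth functions.
\<close>

type_synonym 'a tvec = "('a \<Rightarrow> real) \<Rightarrow> real"
type_synonym 'a covec = "'a tvec \<Rightarrow> real"
type_synonym 'a bigvec = "'a tvec \<times> 'a covec"

definition tangent :: "('a, 'e::fin_dim_inner) atlas \<Rightarrow> 'a \<Rightarrow> 'a tvec set" where
  "tangent M p = {v. v \<in> lin_maps (smooth_funs M) UNIV
     \<and> (\<forall>f\<in>smooth_funs M. \<forall>h\<in>smooth_funs M. v (f * h) = v f * h p + f p * v h)}"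

definition cotangent :: "('a, 'e::fin_dim_inner) atlas \<Rightarrow> 'a \<Rightarrow> 'a covec set" where
  "cotangent M p = lin_maps (tangent M p) UNIV"

definition big_tangent :: "('a, 'e::fin_dim_inner) atlas \<Rightarrow> 'a \<Rightarrow> 'a bigvec set" where
  "big_tangent M p = tangent M p \<times> cotangent M p"

text \<open>The differential \<open>f\<^sub>*\<close> of \<open>f\<close> and its transpose
  \<open>f\<^sup>*\<close> from covectors at \<open>f p\<close> to covectors at \<open>p\<close>.\<close>

definition push :: "('b, 'f::fin_dim_inner) atlas \<Rightarrow> ('a \<Rightarrow> 'b) \<Rightarrow> 'a tvec \<Rightarrow> 'b tvec" where
  "push N f v = (\<lambda>h. if h \<in> smooth_funs N then v (h \<circ> f) else 0)"

definition pull ::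
  "('a, 'e::fin_dim_inner) atlas \<Rightarrow> ('b, 'f::fin_dim_inner) atlas \<Rightarrow> ('a \<Rightarrow> 'b) \<Rightarrow> 'a
    \<Rightarrow> 'b covec \<Rightarrow> 'a covec" where
  "pull M N f p \<beta> = (\<lambda>v. if v \<in> tangent M p then \<beta> (push N f v) else 0)"

section \<open>Tensor fields\<close>

definition vector_fields :: "('a, 'e::fin_dim_inner) atlas \<Rightarrow> ('a \<Rightarrow> 'a tvec) set" where
  "vector_fields M = {X. (\<forall>p. X p \<in> tangent M p)
     \<and> (\<forall>f\<in>smooth_funs M. (\<lambda>p. X p f) \<in> smooth_funs M)}"

definition one_forms :: "('a, 'e::fin_dim_inner) atlas \<Rightarrow> ('a \<Rightarrow> 'a covec) set" where
  "one_forms M = {\<alpha>. (\<forall>p. \<alpha> p \<in> cotangent M p)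
     \<and> (\<forall>X\<in>vector_fields M. (\<lambda>p. \<alpha> p (X p)) \<in> smooth_funs M)}"

definition big_sections :: "('a, 'e::fin_dim_inner) atlas \<Rightarrow> ('a \<Rightarrow> 'a bigvec) set" where
  "big_sections M = {S. fst \<circ> S \<in> vector_fields M \<and> snd \<circ> S \<in> one_forms M}"

definition endo_fields :: "('a, 'e::fin_dim_inner) atlas \<Rightarrow> ('a \<Rightarrow> 'a tvec \<Rightarrow> 'a tvec) set" where
  "endo_fields M = {A. (\<forall>p. A p \<in> lin_maps (tangent M p) (tangent M p))
     \<and> (\<forall>X\<in>vector_fields M. (\<lambda>p. A p (X p)) \<in> vector_fields M)}"

definition bivector_fields ::
  "('a, 'e::fin_dim_inner) atlas \<Rightarrow> ('a \<Rightarrow> 'a covec \<Rightarrow> 'a covec \<Rightarrow> real) set" where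
  "bivector_fields M = {w. (\<forall>p. w p \<in> skew_forms (cotangent M p))
     \<and> (\<forall>\<alpha>\<in>one_forms M. \<forall>\<beta>\<in>one_forms M. (\<lambda>p. w p (\<alpha> p) (\<beta> p)) \<in> smooth_funs M)}"

definition big_endo_fields :: "('a, 'e::fin_dim_inner) atlas \<Rightarrow> ('a \<Rightarrow> 'a bigvec \<Rightarrow> 'a bigvec) set" where
  "big_endo_fields M = {\<Phi>. (\<forall>p. \<Phi> p \<in> lin_maps (big_tangent M p) (big_tangent M p))
     \<and> (\<forall>S\<in>big_sections M. (\<lambda>p. \<Phi> p (S p)) \<in> big_sections M)}"

definition sharp ::
  "('a, 'e::fin_dim_inner) atlas \<Rightarrow> ('a \<Rightarrow> 'a covec \<Rightarrow> 'a covec \<Rightarrow> real) \<Rightarrow> 'a \<Rightarrow> 'a covec \<Rightarrow> 'a tvec" where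
  "sharp M w p \<alpha> = (THE v. v \<in> tangent M p \<and> (\<forall>\<beta>\<in>cotangent M p. \<beta> v = w p \<alpha> \<beta>))"

text \<open>The endomorphism \<open>(X, \<alpha>) \<mapsto> (A X + sharp \<alpha>, flat X - \<alpha> \<circ> A)\<close>;
  as \<open>flat X = i(X)\<sigma>\<close>, it is the partial application \<open>\<sigma> p X\<close>.\<close>

definition big_endo ::
  "('a, 'e::fin_dim_inner) atlas \<Rightarrow> ('a \<Rightarrow> 'a tvec \<Rightarrow> 'a tvec)
    \<Rightarrow> ('a \<Rightarrow> 'a covec \<Rightarrow> 'a covec \<Rightarrow> real) \<Rightarrow> ('a \<Rightarrow> 'a tvec \<Rightarrow> 'a tvec \<Rightarrow> real)
    \<Rightarrow> 'a \<Rightarrow> 'a bigvec \<Rightarrow> 'a bigvec" where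
  "big_endo M A w \<sigma> p = (\<lambda>(v, \<alpha>). if (v, \<alpha>) \<in> big_tangent M p
     then (A p v + sharp M w p \<alpha>, \<sigma> p v - (\<alpha> \<circ> A p)) else 0)"

section \<open>Differential operators\<close>

definition dif :: "('a, 'e::fin_dim_inner) atlas \<Rightarrow> ('a \<Rightarrow> real) \<Rightarrow> 'a \<Rightarrow> 'a covec" where
  "dif M f p = (\<lambda>v. if v \<in> tangent M p then v f else 0)"

definition lie_bracket :: "('a \<Rightarrow> 'a tvec) \<Rightarrow> ('a \<Rightarrow> 'a tvec) \<Rightarrow> 'a \<Rightarrow> 'a tvec" where
  "lie_bracket X Y p = (\<lambda>f. X p (\<lambda>q. Y q f) - Y p (\<lambda>q. X q f))"

text \<open>
  Lie derivatives of \<open>1\<close>-forms and of \<open>(1,1)\<close>-tensor fields are given by the Leibniz rules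
  \<open>(L\<^sub>X \<beta>)(Y) = X(\<beta>(Y)) - \<beta>([X, Y])\<close> and
  \<open>(L\<^sub>X A)(Y) = [X, A Y] - A [X, Y]\<close>. The right-hand sides at \<open>p\<close> depend on the vector field
  \<open>Y\<close> only through \<open>Y p\<close>, so they determine the value on each tangent vector.
\<close>

definition lie_form ::
  "('a, 'e::fin_dim_inner) atlas \<Rightarrow> ('a \<Rightarrow> 'a tvec) \<Rightarrow> ('a \<Rightarrow> 'a covec) \<Rightarrow> 'a \<Rightarrow> 'a covec" where
  "lie_form M X \<beta> p = (\<lambda>v. if v \<in> tangent M p
     then (THE c. \<forall>Y\<in>vector_fields M. Y p = v \<longrightarrow>
             c = X p (\<lambda>q. \<beta> q (Y q)) - \<beta> p (lie_bracket X Y p))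
     else 0)"

definition lie_endo ::
  "('a, 'e::fin_dim_inner) atlas \<Rightarrow> ('a \<Rightarrow> 'a tvec) \<Rightarrow> ('a \<Rightarrow> 'a tvec \<Rightarrow> 'a tvec)
    \<Rightarrow> 'a \<Rightarrow> 'a tvec \<Rightarrow> 'a tvec" where
  "lie_endo M X A p = (\<lambda>v. if v \<in> tangent M p
     then (THE u. \<forall>Y\<in>vector_fields M. Y p = v \<longrightarrow>
             u = lie_bracket X (\<lambda>q. A q (Y q)) p - A p (lie_bracket X Y p))
     else 0)"

definition courant ::
  "('a, 'e::fin_dim_inner) atlas \<Rightarrow> ('a \<Rightarrow> 'a bigvec) \<Rightarrow> ('a \<Rightarrow> 'a bigvec) \<Rightarrow> 'a \<Rightarrow> 'a bigvec" where
  "courant M S T =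
     (let X = fst \<circ> S; \<alpha> = snd \<circ> S; Y = fst \<circ> T; \<beta> = snd \<circ> T
      in (\<lambda>p. (lie_bracket X Y p,
               lie_form M X \<beta> p - lie_form M Y \<alpha> p
                 + (1/2) *\<^sub>R dif M (\<lambda>q. \<alpha> q (Y q) - \<beta> q (X q)) p)))"

definition nijenhuis ::
  "('a \<Rightarrow> 'a tvec \<Rightarrow> 'a tvec) \<Rightarrow> ('a \<Rightarrow> 'a tvec) \<Rightarrow> ('a \<Rightarrow> 'a tvec) \<Rightarrow> 'a \<Rightarrow> 'a tvec" where
  "nijenhuis A X Y =
     (let AX = (\<lambda>p. A p (X p)); AY = (\<lambda>p. A p (Y p))
      in (\<lambda>p. lie_bracket AX AY p - A p (lie_bracket X AY p) - A p (lie_bracket AX Y p)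
               + A p (A p (lie_bracket X Y p))))"

text \<open>
  The Schouten-Nijenhuis bracket of two bivector fields, a trivector field, as a skew-symmetric
  triderivation of the algebra of smooth functions. For multivector fields \<open>P\<close> and \<open>Q\<close> of degrees
  \<open>p\<close> and \<open>q\<close>, viewed as multiderivations, \<open>[P, Q](f\<^sub>1, \<dots>)\<close> is the sum of
  \<open>sgn \<sigma> P(Q(f\<^sub>\<sigma>\<^sub>1, \<dots>), \<dots>)\<close> over the \<open>(q, p - 1)\<close>-shuffles \<open>\<sigma>\<close> minus \<open>(-1)\<close> to the power
  \<open>(p - 1)(q - 1)\<close> times the same sum with \<open>P\<close> and \<open>Q\<close> interchanged. For \<open>p = q = 2\<close> the signed
  \<open>(2, 1)\<close>-shuffles amount to the cyclic permutations. In particular \<open>[P, P]\<close> is twice the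
  Jacobiator of the bracket of \<open>P\<close>.
\<close>

definition bivector_bracket ::
  "('a, 'e::fin_dim_inner) atlas \<Rightarrow> ('a \<Rightarrow> 'a covec \<Rightarrow> 'a covec \<Rightarrow> real)
    \<Rightarrow> ('a \<Rightarrow> real) \<Rightarrow> ('a \<Rightarrow> real) \<Rightarrow> 'a \<Rightarrow> real" where
  "bivector_bracket M w f h = (\<lambda>p. w p (dif M f p) (dif M h p))"

definition schouten ::
  "('a, 'e::fin_dim_inner) atlas \<Rightarrow> ('a \<Rightarrow> 'a covec \<Rightarrow> 'a covec \<Rightarrow> real)
    \<Rightarrow> ('a \<Rightarrow> 'a covec \<Rightarrow> 'a covec \<Rightarrow> real)
    \<Rightarrow> ('a \<Rightarrow> real) \<Rightarrow> ('a \<Rightarrow> real) \<Rightarrow> ('a \<Rightarrow> real) \<Rightarrow> 'a \<Rightarrow> real" where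
  "schouten M P Q f g h =
     (let comp = (\<lambda>R S. bivector_bracket M R (bivector_bracket M S f g) h
                      + bivector_bracket M R (bivector_bracket M S g h) f
                      + bivector_bracket M R (bivector_bracket M S h f) g)
      in comp P Q + comp Q P)"

definition concomitant ::
  "('a, 'e::fin_dim_inner) atlas \<Rightarrow> ('a \<Rightarrow> 'a covec \<Rightarrow> 'a covec \<Rightarrow> real)
    \<Rightarrow> ('a \<Rightarrow> 'a tvec \<Rightarrow> 'a tvec) \<Rightarrow> ('a \<Rightarrow> 'a covec) \<Rightarrow> ('a \<Rightarrow> 'a covec) \<Rightarrow> 'a \<Rightarrow> 'a covec" where
  "concomitant M w A \<alpha> \<beta> p =
     (\<beta> p \<circ> lie_endo M (\<lambda>q. sharp M w q (\<alpha> q)) A p)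
     - (\<alpha> p \<circ> lie_endo M (\<lambda>q. sharp M w q (\<beta> q)) A p)
     + (dif M (\<lambda>q. w q (\<alpha> q) (\<beta> q)) p \<circ> A p)
     - dif M (\<lambda>q. w q (\<alpha> q \<circ> A q) (\<beta> q)) p"

section \<open>Classical structures\<close>

definition poisson_bivector ::
  "('a, 'e::fin_dim_inner) atlas \<Rightarrow> ('a \<Rightarrow> 'a covec \<Rightarrow> 'a covec \<Rightarrow> real) \<Rightarrow> bool" where
  "poisson_bivector M w \<longleftrightarrow> w \<in> bivector_fields M
     \<and> (\<forall>f\<in>smooth_funs M. \<forall>g\<in>smooth_funs M. \<forall>h\<in>smooth_funs M. schouten M w w f g h = 0)"

definition poisson_nijenhuis ::
  "('a, 'e::fin_dim_inner) atlas \<Rightarrow> ('a \<Rightarrow> 'a covec \<Rightarrow> 'a covec \<Rightarrow> real)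
    \<Rightarrow> ('a \<Rightarrow> 'a tvec \<Rightarrow> 'a tvec) \<Rightarrow> bool" where
  "poisson_nijenhuis M w A \<longleftrightarrow> poisson_bivector M w \<and> A \<in> endo_fields M
     \<and> (\<forall>p. \<forall>\<alpha>\<in>cotangent M p. \<forall>\<beta>\<in>cotangent M p. w p (\<alpha> \<circ> A p) \<beta> = w p \<alpha> (\<beta> \<circ> A p))
     \<and> (\<forall>X\<in>vector_fields M. \<forall>Y\<in>vector_fields M. nijenhuis A X Y = 0)
     \<and> (\<forall>\<alpha>\<in>one_forms M. \<forall>\<beta>\<in>one_forms M. concomitant M w A \<alpha> \<beta> = 0)"

text \<open>Classical complex (\<open>\<epsilon> = -1\<close>) and paracomplex (\<open>\<epsilon> = 1\<close>) structures.\<close>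

definition classical_structure ::
  "('a, 'e::fin_dim_inner) atlas \<Rightarrow> real \<Rightarrow> ('a \<Rightarrow> 'a tvec \<Rightarrow> 'a tvec) \<Rightarrow> bool" where
  "classical_structure M \<epsilon> A \<longleftrightarrow> A \<in> endo_fields M
     \<and> (\<forall>p. \<forall>v\<in>tangent M p. A p (A p v) = \<epsilon> *\<^sub>R v)
     \<and> (\<forall>X\<in>vector_fields M. \<forall>Y\<in>vector_fields M. nijenhuis A X Y = 0)"

abbreviation "complex_structure M \<equiv> classical_structure M (-1)"
abbreviation "paracomplex_structure M \<equiv> classical_structure M 1"

definition endo_related ::
  "('a, 'e::fin_dim_inner) atlas \<Rightarrow> ('b, 'f::fin_dim_inner) atlas \<Rightarrow> ('a \<Rightarrow> 'b)
    \<Rightarrow> ('a \<Rightarrow> 'a tvec \<Rightarrow> 'a tvec) \<Rightarrow> ('b \<Rightarrow> 'b tvec \<Rightarrow> 'b tvec) \<Rightarrow> bool" where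
  "endo_related M N f A B \<longleftrightarrow>
     (\<forall>p. \<forall>v\<in>tangent M p. B (f p) (push N f v) = push N f (A p v))"

definition bivector_related ::
  "('a, 'e::fin_dim_inner) atlas \<Rightarrow> ('b, 'f::fin_dim_inner) atlas \<Rightarrow> ('a \<Rightarrow> 'b)
    \<Rightarrow> ('a \<Rightarrow> 'a covec \<Rightarrow> 'a covec \<Rightarrow> real) \<Rightarrow> ('b \<Rightarrow> 'b covec \<Rightarrow> 'b covec \<Rightarrow> real) \<Rightarrow> bool" where
  "bivector_related M N f w w' \<longleftrightarrow>
     (\<forall>p. \<forall>\<alpha>\<in>cotangent N (f p). \<forall>\<beta>\<in>cotangent N (f p).
        w' (f p) \<alpha> \<beta> = w p (pull M N f p \<alpha>) (pull M N f p \<beta>))"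

definition two_form_related ::
  "('a, 'e::fin_dim_inner) atlas \<Rightarrow> ('b, 'f::fin_dim_inner) atlas \<Rightarrow> ('a \<Rightarrow> 'b)
    \<Rightarrow> ('a \<Rightarrow> 'a tvec \<Rightarrow> 'a tvec \<Rightarrow> real) \<Rightarrow> ('b \<Rightarrow> 'b tvec \<Rightarrow> 'b tvec \<Rightarrow> real) \<Rightarrow> bool" where
  "two_form_related M N f \<sigma> \<sigma>' \<longleftrightarrow>
     (\<forall>p. \<forall>v\<in>tangent M p. \<forall>u\<in>tangent M p. \<sigma> p v u = \<sigma>' (f p) (push N f v) (push N f u))"

text \<open>
  Direct sums on a product manifold. The tangent space at \<open>(p, q)\<close> is the direct sum of those at
  \<open>p\<close> and \<open>q\<close>: the components of \<open>v\<close> are its images under the two projections, and the summands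
  are embedded by the differentials of \<open>\<lambda>x. (x, q)\<close> and \<open>\<lambda>y. (p, y)\<close>; dually for covectors.
\<close>

definition endo_sum ::
  "('a, 'e::fin_dim_inner) atlas \<Rightarrow> ('b, 'f::fin_dim_inner) atlas
    \<Rightarrow> ('a \<Rightarrow> 'a tvec \<Rightarrow> 'a tvec) \<Rightarrow> ('b \<Rightarrow> 'b tvec \<Rightarrow> 'b tvec)
    \<Rightarrow> 'a \<times> 'b \<Rightarrow> ('a \<times> 'b) tvec \<Rightarrow> ('a \<times> 'b) tvec" where
  "endo_sum M N A B = (\<lambda>(p, q) v. if v \<in> tangent (prod_atlas M N) (p, q)
     then push (prod_atlas M N) (\<lambda>x. (x, q)) (A p (push M fst v))
        + push (prod_atlas M N) (\<lambda>y. (p, y)) (B q (push N snd v))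
     else 0)"

definition bivector_sum ::
  "('a, 'e::fin_dim_inner) atlas \<Rightarrow> ('b, 'f::fin_dim_inner) atlas
    \<Rightarrow> ('a \<Rightarrow> 'a covec \<Rightarrow> 'a covec \<Rightarrow> real) \<Rightarrow> ('b \<Rightarrow> 'b covec \<Rightarrow> 'b covec \<Rightarrow> real)
    \<Rightarrow> 'a \<times> 'b \<Rightarrow> ('a \<times> 'b) covec \<Rightarrow> ('a \<times> 'b) covec \<Rightarrow> real" where
  "bivector_sum M N w w' = (\<lambda>(p, q) \<alpha> \<beta>.
     if \<alpha> \<in> cotangent (prod_atlas M N) (p, q) \<and> \<beta> \<in> cotangent (prod_atlas M N) (p, q)
     then w p (pull M (prod_atlas M N) (\<lambda>x. (x, q)) p \<alpha>) (pull M (prod_atlas M N) (\<lambda>x. (x, q)) p \<beta>)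
        + w' q (pull N (prod_atlas M N) (\<lambda>y. (p, y)) q \<alpha>) (pull N (prod_atlas M N) (\<lambda>y. (p, y)) q \<beta>)
     else 0)"

definition big_endo_sum ::
  "('a, 'e::fin_dim_inner) atlas \<Rightarrow> ('b, 'f::fin_dim_inner) atlas
    \<Rightarrow> ('a \<Rightarrow> 'a bigvec \<Rightarrow> 'a bigvec) \<Rightarrow> ('b \<Rightarrow> 'b bigvec \<Rightarrow> 'b bigvec)
    \<Rightarrow> 'a \<times> 'b \<Rightarrow> ('a \<times> 'b) bigvec \<Rightarrow> ('a \<times> 'b) bigvec" where
  "big_endo_sum M N \<Phi> \<Psi> = (\<lambda>(p, q) (v, \<gamma>).
     if (v, \<gamma>) \<in> big_tangent (prod_atlas M N) (p, q)
     then let (u, \<alpha>) = \<Phi> p (push M fst v, pull M (prod_atlas M N) (\<lambda>x. (x, q)) p \<gamma>);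
              (u', \<beta>) = \<Psi> q (push N snd v, pull N (prod_atlas M N) (\<lambda>y. (p, y)) q \<gamma>)
          in (push (prod_atlas M N) (\<lambda>x. (x, q)) u + push (prod_atlas M N) (\<lambda>y. (p, y)) u',
              pull (prod_atlas M N) M fst (p, q) \<alpha> + pull (prod_atlas M N) N snd (p, q) \<beta>)
     else 0)"

definition classical_lie_group ::
  "('a, 'e::fin_dim_inner) atlas \<Rightarrow> ('a \<Rightarrow> 'a \<Rightarrow> 'a) \<Rightarrow> real
    \<Rightarrow> ('a \<Rightarrow> 'a tvec \<Rightarrow> 'a tvec) \<Rightarrow> bool" where
  "classical_lie_group M mul \<epsilon> A \<longleftrightarrow> classical_structure M \<epsilon> A
     \<and> endo_related (prod_atlas M M) M (\<lambda>(x, y). mul x y) (endo_sum M M A A) A"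

abbreviation "complex_lie_group M mul \<equiv> classical_lie_group M mul (-1)"
abbreviation "paracomplex_lie_group M mul \<equiv> classical_lie_group M mul 1"

definition multiplicative_bivector ::
  "('a, 'e::fin_dim_inner) atlas \<Rightarrow> ('a \<Rightarrow> 'a \<Rightarrow> 'a)
    \<Rightarrow> ('a \<Rightarrow> 'a covec \<Rightarrow> 'a covec \<Rightarrow> real) \<Rightarrow> bool" where
  "multiplicative_bivector M mul w \<longleftrightarrow>
     bivector_related (prod_atlas M M) M (\<lambda>(x, y). mul x y) (bivector_sum M M w w) w"

section \<open>Generalized structures\<close>

definition big_metric :: "'a bigvec \<Rightarrow> 'a bigvec \<Rightarrow> real" where
  "big_metric = (\<lambda>(v, \<alpha>) (u, \<beta>). (1/2) * (\<alpha> u + \<beta> v))"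

definition generalized_almost_cps ::
  "('a, 'e::fin_dim_inner) atlas \<Rightarrow> real \<Rightarrow> ('a \<Rightarrow> 'a bigvec \<Rightarrow> 'a bigvec) \<Rightarrow> bool" where
  "generalized_almost_cps M \<epsilon> \<Phi> \<longleftrightarrow> \<epsilon> \<in> {-1, 0, 1} \<and> \<Phi> \<in> big_endo_fields M
     \<and> (\<forall>p. \<forall>x\<in>big_tangent M p. \<forall>y\<in>big_tangent M p.
          big_metric x (\<Phi> p y) + big_metric (\<Phi> p x) y = 0)
     \<and> (\<forall>p. \<forall>x\<in>big_tangent M p. \<Phi> p (\<Phi> p x) = \<epsilon> *\<^sub>R x)"

definition integrable_big_endo ::
  "('a, 'e::fin_dim_inner) atlas \<Rightarrow> ('a \<Rightarrow> 'a bigvec \<Rightarrow> 'a bigvec) \<Rightarrow> bool" where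
  "integrable_big_endo M \<Phi> \<longleftrightarrow>
     (\<forall>S\<in>big_sections M. \<forall>T\<in>big_sections M.
        let \<Phi>S = (\<lambda>p. \<Phi> p (S p)); \<Phi>T = (\<lambda>p. \<Phi> p (T p))
        in \<forall>p. courant M \<Phi>S \<Phi>T p - \<Phi> p (courant M S \<Phi>T p) - \<Phi> p (courant M \<Phi>S T p)
                 + \<Phi> p (\<Phi> p (courant M S T p)) = 0)"

definition generalized_cps ::
  "('a, 'e::fin_dim_inner) atlas \<Rightarrow> real \<Rightarrow> ('a \<Rightarrow> 'a bigvec \<Rightarrow> 'a bigvec) \<Rightarrow> bool" where
  "generalized_cps M \<epsilon> \<Phi> \<longleftrightarrow> generalized_almost_cps M \<epsilon> \<Phi> \<and> integrable_big_endo M \<Phi>"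

text \<open>
  The classical tensor fields \<open>A\<close>, \<open>\<pi>\<close>, \<open>\<sigma>\<close> of \<open>\<Phi>\<close>, read off from
  \<open>\<Phi>(X, \<alpha>) = (A X + sharp \<alpha>, flat X - \<alpha> \<circ> A)\<close> by setting \<open>\<alpha> = 0\<close> or \<open>X = 0\<close> and using
  \<open>\<beta>(sharp \<alpha>) = \<pi>(\<alpha>, \<beta>)\<close>, \<open>(flat X)(Y) = \<sigma>(X, Y)\<close>.
  Only the values of \<open>tensor_\<pi>\<close> on covectors are meaningful.
\<close>

definition tensor_A :: "('a \<Rightarrow> 'a bigvec \<Rightarrow> 'a bigvec) \<Rightarrow> 'a \<Rightarrow> 'a tvec \<Rightarrow> 'a tvec" where
  "tensor_A \<Phi> p v = fst (\<Phi> p (v, 0))"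

definition tensor_\<pi> :: "('a \<Rightarrow> 'a bigvec \<Rightarrow> 'a bigvec) \<Rightarrow> 'a \<Rightarrow> 'a covec \<Rightarrow> 'a covec \<Rightarrow> real" where
  "tensor_\<pi> \<Phi> p \<alpha> \<beta> = \<beta> (fst (\<Phi> p (0, \<alpha>)))"

definition tensor_\<sigma> :: "('a \<Rightarrow> 'a bigvec \<Rightarrow> 'a bigvec) \<Rightarrow> 'a \<Rightarrow> 'a tvec \<Rightarrow> 'a tvec \<Rightarrow> real" where
  "tensor_\<sigma> \<Phi> p v u = snd (\<Phi> p (v, 0)) u"

definition generalized_cps_map ::
  "('a::topological_space, 'e::fin_dim_inner) atlas \<Rightarrow> ('b::topological_space, 'f::fin_dim_inner) atlas
    \<Rightarrow> ('a \<Rightarrow> 'a bigvec \<Rightarrow> 'a bigvec) \<Rightarrow> ('b \<Rightarrow> 'b bigvec \<Rightarrow> 'b bigvec) \<Rightarrow> ('a \<Rightarrow> 'b) \<Rightarrow> bool" where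
  "generalized_cps_map M N \<Phi> \<Psi> f \<longleftrightarrow> smooth_map M N f
     \<and> bivector_related M N f (tensor_\<pi> \<Phi>) (tensor_\<pi> \<Psi>)
     \<and> two_form_related M N f (tensor_\<sigma> \<Phi>) (tensor_\<sigma> \<Psi>)
     \<and> endo_related M N f (tensor_A \<Phi>) (tensor_A \<Psi>)"

text \<open>\<open>big_endo_sum M M \<Phi> \<Phi>\<close> inherits the generalized structure from \<open>\<Phi>\<close>, so this need not be
  required.\<close>

definition generalized_cps_lie_group ::
  "('a::{t2_space, second_countable_topology}, 'e::fin_dim_inner) atlas \<Rightarrow> ('a \<Rightarrow> 'a \<Rightarrow> 'a) \<Rightarrow> real
    \<Rightarrow> ('a \<Rightarrow> 'a bigvec \<Rightarrow> 'a bigvec) \<Rightarrow> bool" where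
  "generalized_cps_lie_group M mul \<epsilon> \<Phi> \<longleftrightarrow> generalized_cps M \<epsilon> \<Phi>
     \<and> generalized_cps_map (prod_atlas M M) M (big_endo_sum M M \<Phi> \<Phi>) \<Phi> (\<lambda>(x, y). mul x y)"

abbreviation "generalized_complex_lie_group M mul \<equiv> generalized_cps_lie_group M mul (-1)"
abbreviation "generalized_paracomplex_lie_group M mul \<equiv> generalized_cps_lie_group M mul 1"

end

theory Submission
  imports Defs
begin

text \<open>
  The 2-form of a generalized structure on a Lie group vanishes: evaluating
  \<open>\<mu>\<^sup>*\<sigma> = \<sigma> \<oplus> \<sigma>\<close> at \<open>(g, e)\<close> on the vectors \<open>(u, 0)\<close> and
  \<open>(0, v)\<close> gives \<open>\<sigma>(u, g v) = 0\<close>, and left translation by \<open>g\<close> is onto the tangent space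
  at \<open>g\<close>. For \<open>\<sigma> = 0\<close> the torsion of \<open>\<Phi>\<close>, which is bilinear over the reals and
  skew-symmetric, has to be computed only on pairs of vector fields, of 1-forms, and on mixed pairs.
  With \<open>Z = sharp(dh)\<close> it is given by \<open>N\<^sub>A(X, Y)\<close> on the first, by the concomitant and by
  \<open>\<alpha>[sharp \<beta>, Z] - \<beta>[sharp \<alpha>, Z] - Z(\<pi>(\<alpha>, \<beta>))\<close> on the second, and by the
  concomitant and \<open>N\<^sub>A\<close> on the third. The expression with \<open>Z\<close> is tensorial in \<open>\<alpha>\<close> and
  \<open>\<beta>\<close> and minus the Jacobiator of \<open>\<pi>\<close> on exact forms.

  Tensoriality, reflexivity of the tangent spaces and the extension of tangent vectors to vector fields
  all follow from one local statement: near any point there are finitely many smooth functions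
  \<open>x\<^sub>i\<close> and vector fields \<open>E\<^sub>i\<close> such that every tangent vector \<open>v\<close> is
  \<open>\<Sum> v(x\<^sub>i) E\<^sub>i\<close>. It is obtained from Hadamard's lemma in a chart.
\<close>

section \<open>Differentiability of finite order\<close>


text \<open>Derivations act on globally defined functions, so coordinates enter only after
  multiplication by a bump function. This is why the local statement carries a factor \<kappa>,
  equal to 1 at the chosen point, and speaks of a spanning family rather than a basis. Covectors
  given by Lie derivatives are accessible through their values on vector fields only. A vector
  \<open>sharp \<gamma>\<close> is therefore tested on a function h, where skew-symmetry of \<pi>
  turns it into -\<gamma>(Z); this is the origin of Z. Splitting sections into vector part and form
  part takes additivity alone. Within the torsion, linearity over functions enters at one place: the
  Poisson condition is stated for functions, so 1-forms have to be exchanged for exact ones with the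
  same value at a point. For \<sigma> = 0 the identity \<Phi>^2 = \<epsilon> Id amounts to A^2 =
  \<epsilon> Id together with the compatibility of \<pi> and A; integrability then supplies the
  differential conditions and the multiplication map the two multiplicativity conditions.\<close>

lemma Ck_on_imp_continuous_on: "Ck_on k S f \<Longrightarrow> continuous_on S f"
  by (cases k)
    (auto intro!: differentiable_imp_continuous_on simp: differentiable_on_def differentiable_at_withinI)

lemma Ck_on_Suc_imp: "Ck_on (Suc k) S f \<Longrightarrow> Ck_on k S f"
proof (induction k arbitrary: f)
  case 0
  then show ?case using Ck_on_imp_continuous_on Ck_on.simps(1) by blast
next
  case (Suc k)
  then show ?case by (metis Ck_on.simps(2))
qed

lemma Ck_on_subset: "Ck_on k S f \<Longrightarrow> T \<subseteq> S \<Longrightarrow> Ck_on k T f"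
  by (induction k arbitrary: f) (auto intro: continuous_on_subset)

lemma Ck_on_cong:
  assumes S: "open S" and "Ck_on k S f" "\<And>x. x \<in> S \<Longrightarrow> f x = g x"
  shows "Ck_on k S g"
  using assms(2,3)
proof (induction k arbitrary: f g)
  case 0
  then show ?case using continuous_on_cong by force
next
  case (Suc k)
  have D: "(g has_derivative frechet_derivative f (at x)) (at x)" if "x \<in> S" for x
    using Suc.prems that S has_derivative_transform_within_open[of f _ x UNIV S g]
    by (simp add: frechet_derivative_works[symmetric])
  then have "frechet_derivative f (at x) = frechet_derivative g (at x)" if "x \<in> S" for x
    using that frechet_derivative_at by blast
  then have "Ck_on k S (\<lambda>x. frechet_derivative g (at x) v)" for v
    using Suc.IH[of "\<lambda>x. frechet_derivative f (at x) v"] Suc.prems(1) by simp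
  then show ?case
    using D by (auto simp: differentiable_def)
qed

text \<open>\<open>frechet_derivative\<close> is a choice without a formula. Uniqueness of
  derivatives on an open set identifies it with any explicitly given \<open>f'\<close>, which is how
  the closure properties below are derived.\<close>

lemma Ck_on_SucI:
  assumes S: "open S"
    and D: "\<And>x. x \<in> S \<Longrightarrow> (f has_derivative f' x) (at x)" and C: "\<And>v. Ck_on k S (\<lambda>x. f' x v)"
  shows "Ck_on (Suc k) S f"
proof -
  have "f' x = frechet_derivative f (at x)" if "x \<in> S" for x
    using D[OF that] frechet_derivative_at by blast
  then have "Ck_on k S (\<lambda>x. frechet_derivative f (at x) v)" for v
    using Ck_on_cong[OF S C[of v]] by simp
  then show ?thesis
    using D by (auto simp: differentiable_def)
qed

text \<open>Derivatives are taken with respect to full neighbourhoods (\<open>at x\<close>), so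
  everything is decided near each point. On a manifold this permits a different chart at each
  point.\<close>

lemma Ck_on_local:
  assumes "\<And>x. x \<in> S \<Longrightarrow> \<exists>T. open T \<and> x \<in> T \<and> Ck_on k T f"
  shows "Ck_on k S f"
  using assms
proof (induction k arbitrary: f)
  case 0
  have "isCont f x" if "x \<in> S" for x
    using 0[OF that] by (auto simp: continuous_on_eq_continuous_at)
  then show ?case by (simp add: continuous_at_imp_continuous_on)
next
  case (Suc k)
  have "f differentiable (at x)" if "x \<in> S" for x
    using Suc.prems[OF that] by auto
  moreover have "Ck_on k S (\<lambda>x. frechet_derivative f (at x) v)" for v
  proof (rule Suc.IH)
    fix x assume "x \<in> S"
    then show "\<exists>T. open T \<and> x \<in> T \<and> Ck_on k T (\<lambda>x. frechet_derivative f (at x) v)"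
      using Suc.prems[of x] by auto
  qed
  ultimately show ?case by simp
qed

lemma Ck_on_const: "Ck_on k S (\<lambda>x. c)"
  by (induction k arbitrary: c) (auto simp: frechet_derivative_const)

lemma Ck_on_bounded_linear_compose:
  assumes S: "open S" and L: "bounded_linear L" and "Ck_on k S f"
  shows "Ck_on k S (\<lambda>x. L (f x))"
  using assms(3)
proof (induction k arbitrary: f)
  case 0
  then show ?case using L by (simp add: bounded_linear.continuous_on)
next
  case (Suc k)
  show ?case
    by (rule Ck_on_SucI[OF S, where f'="\<lambda>x v. L (frechet_derivative f (at x) v)"])
       (use Suc in \<open>auto intro!: bounded_linear.has_derivative[OF L] simp: frechet_derivative_works[symmetric]\<close>)
qed

lemma Ck_on_id: assumes "open S" shows "Ck_on k S (\<lambda>x. x)"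
  by (cases k) (auto simp: Ck_on_const frechet_derivative_ident)

lemma Ck_on_bounded_linear: "open S \<Longrightarrow> bounded_linear L \<Longrightarrow> Ck_on k S L"
  using Ck_on_bounded_linear_compose[OF _ _ Ck_on_id] by blast

lemma Ck_on_add:
  assumes S: "open S" and "Ck_on k S f" "Ck_on k S g"
  shows "Ck_on k S (\<lambda>x. f x + g x)"
  using assms(2,3)
proof (induction k arbitrary: f g)
  case 0
  then show ?case by (simp add: continuous_on_add)
next
  case (Suc k)
  show ?case
    by (rule Ck_on_SucI[OF S, where
        f'="\<lambda>x v. frechet_derivative f (at x) v + frechet_derivative g (at x) v"])
       (use Suc in \<open>auto intro!: has_derivative_add simp: frechet_derivative_works[symmetric]\<close>)
qed

lemma Ck_on_sum:
  assumes "open S" and "\<And>i. i \<in> I \<Longrightarrow> Ck_on k S (f i)"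
  shows "Ck_on k S (\<lambda>x. \<Sum>i\<in>I. f i x)"
  using assms(2) by (induction I rule: infinite_finite_induct) (auto simp: Ck_on_const Ck_on_add[OF assms(1)])

lemma Ck_on_scaleR:
  assumes S: "open S" and "Ck_on k S f" "Ck_on k S g"
  shows "Ck_on k S (\<lambda>x. f x *\<^sub>R g x)"
  using assms(2,3)
proof (induction k arbitrary: f g)
  case 0
  then show ?case by (simp add: continuous_on_scaleR)
next
  case (Suc k)
  show ?case
  proof (rule Ck_on_SucI[OF S, where
        f'="\<lambda>x v. f x *\<^sub>R frechet_derivative g (at x) v + frechet_derivative f (at x) v *\<^sub>R g x"])
    show "((\<lambda>x. f x *\<^sub>R g x) has_derivative
       (\<lambda>v. f x *\<^sub>R frechet_derivative g (at x) v + frechet_derivative f (at x) v *\<^sub>R g x)) (at x)"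
      if "x \<in> S" for x
      using Suc.prems that by (intro has_derivative_scaleR) (auto simp: frechet_derivative_works[symmetric])
  next
    \<comment> \<open>The Leibniz rule contains \<open>f\<close> and \<open>g\<close>
      undifferentiated; their order is lowered from k+1 to k so that the induction hypothesis covers
      these factors too.\<close>
    have "Ck_on k S f" "Ck_on k S g" using Suc.prems Ck_on_Suc_imp by blast+
    then show "Ck_on k S (\<lambda>x. f x *\<^sub>R frechet_derivative g (at x) v
        + frechet_derivative f (at x) v *\<^sub>R g x)" for v
      using Suc.prems by (intro Ck_on_add[OF S] Suc.IH) auto
  qed
qed

lemma Ck_on_mult:
  fixes f g :: "'a::real_normed_vector \<Rightarrow> real"
  shows "open S \<Longrightarrow> Ck_on k S f \<Longrightarrow> Ck_on k S g \<Longrightarrow> Ck_on k S (\<lambda>x. f x * g x)"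
  using Ck_on_scaleR[of S k f g] by simp

section \<open>Orthonormal bases and the chain rule\<close>

text \<open>Gram-Schmidt on a finite total set \<open>B\<close>: what remains of \<open>x\<close>
  after subtracting its projections is orthogonal to the span of \<open>B\<close>, hence 0. In
  dimension 0 the basis is empty.\<close>

lemma orthonormal_basis:
  "\<exists>C :: 'e::fin_dim_inner set. finite C \<and> (\<forall>x. x = (\<Sum>c\<in>C. inner x c *\<^sub>R c))"
proof -
  obtain B :: "'e set" where B: "finite B" "\<And>x. (\<forall>b\<in>B. inner x b = 0) \<Longrightarrow> x = 0"
    using finite_total_set by blast
  obtain D where D: "finite D" "span D = span B" "pairwise orthogonal D"
    using basis_orthogonal[OF B(1)] by blast
  let ?n = "\<lambda>d::'e. d /\<^sub>R norm d"
  have ex: "x = (\<Sum>d\<in>D - {0}. inner x (?n d) *\<^sub>R ?n d)" for x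
  proof -
    let ?y = "x - (\<Sum>d\<in>D - {0}. inner x (?n d) *\<^sub>R ?n d)"
    have "orthogonal ?y d'" if "d' \<in> D" for d'
    proof (cases "d' = 0")
      case False
      have "inner (\<Sum>d\<in>D - {0}. inner x (?n d) *\<^sub>R ?n d) d'
          = (\<Sum>d\<in>D - {0}. if d = d' then inner x d' else 0)"
        unfolding inner_sum_left
      proof (rule sum.cong[OF refl])
        fix d assume d: "d \<in> D - {0}"
        show "inner (inner x (?n d) *\<^sub>R ?n d) d' = (if d = d' then inner x d' else 0)"
        proof (cases "d = d'")
          case True
          then show ?thesis using False
            by (simp add: dot_square_norm power2_eq_square divide_simps)
        next
          case False
          then have "inner d d' = 0"
            using D(3) d that by (auto simp: pairwise_def orthogonal_def)
          then show ?thesis using False by simp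
        qed
      qed
      also have "\<dots> = inner x d'"
        using D(1) that False by simp
      finally show ?thesis by (simp add: orthogonal_def inner_diff_left)
    qed (simp add: orthogonal_def)
    note * = this
    have "orthogonal ?y b" if "b \<in> B" for b
    proof -
      have "b \<in> span D" using that D(2) span_base[of b B] by simp
      then show ?thesis using orthogonal_to_span[of b D ?y] * by blast
    qed
    then have "?y = 0" using B(2)[of ?y] unfolding orthogonal_def by blast
    then show ?thesis by (simp only: right_minus_eq)
  qed
  \<comment> \<open>Two different orthogonal vectors cannot normalise to the same vector, as that
    vector would be orthogonal to itself. Hence the sum over \<open>D\<close> is a sum over the set
    of normalised vectors.\<close>
  have "inj_on ?n (D - {0})"
  proof (rule inj_onI, rule ccontr)
    fix d d' assume d: "d \<in> D - {0}" "d' \<in> D - {0}" "?n d = ?n d'" "d \<noteq> d'"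
    then have "inner d d' = 0"
      using D(3) by (auto simp: pairwise_def orthogonal_def)
    then have "inner (?n d) (?n d') = 0" by simp
    then have "?n d = 0" using d(3) by (metis inner_eq_zero_iff)
    then show False using d by simp
  qed
  then have "(\<Sum>c\<in>?n ` (D - {0}). inner x c *\<^sub>R c)
      = (\<Sum>d\<in>D - {0}. inner x (?n d) *\<^sub>R ?n d)" for x
    by (simp add: sum.reindex)
  then have "x = (\<Sum>c\<in>?n ` (D - {0}). inner x c *\<^sub>R c)" for x
    by (rule trans[OF ex sym])
  moreover have "finite (?n ` (D - {0}))" using D(1) by simp
  ultimately show ?thesis by (intro exI[of _ "?n ` (D - {0})"] conjI allI)
qed

text \<open>Fixed once for each type, so that all coordinate sums and the index sets of the local
  frames come from the same finite set.\<close>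

definition onb :: "'e::fin_dim_inner set" where
  "onb = (SOME C. finite C \<and> (\<forall>x. x = (\<Sum>c\<in>C. inner x c *\<^sub>R c)))"

lemma onb: "finite (onb :: 'e::fin_dim_inner set) \<and> (\<forall>x :: 'e. x = (\<Sum>c\<in>onb. inner x c *\<^sub>R c))"
  unfolding onb_def by (rule someI_ex[OF orthonormal_basis])

lemmas finite_onb = onb[THEN conjunct1]
lemmas onb_expansion = onb[THEN conjunct2, rule_format]

lemma linear_onb_expansion:
  assumes "linear L"
  shows "L x = (\<Sum>c\<in>onb. inner x c *\<^sub>R L c)"
proof -
  have "L x = L (\<Sum>c\<in>onb. inner x c *\<^sub>R c)" by (rule arg_cong[OF onb_expansion])
  then show ?thesis using assms by (simp add: linear_sum linear_scale)
qed

text \<open>In the chain rule \<open>f'(g x)(g'(x) v)\<close> point and direction both vary with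
  \<open>x\<close>, whereas the induction hypothesis treats \<open>f'\<close> in a fixed direction.
  Expanding \<open>g'(x) v\<close> in the finite basis separates the two.\<close>

lemma Ck_on_compose:
  fixes f :: "'f::fin_dim_inner \<Rightarrow> 'b::real_normed_vector" and g :: "'a::real_normed_vector \<Rightarrow> 'f"
  assumes S: "open S" and T: "open T" and "Ck_on k T f" "Ck_on k S g" and gST: "g ` S \<subseteq> T"
  shows "Ck_on k S (\<lambda>x. f (g x))"
  using assms(3,4)
proof (induction k arbitrary: f)
  case 0
  then show ?case using gST by (auto intro: continuous_on_compose2)
next
  case (Suc k)
  have Df: "(f has_derivative frechet_derivative f (at (g x))) (at (g x))"
    and Dg: "(g has_derivative frechet_derivative g (at x)) (at x)" if "x \<in> S" for x
    using Suc.prems that gST by (auto simp: frechet_derivative_works[symmetric])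
  show ?case
  proof (rule Ck_on_SucI[OF S, where
        f'="\<lambda>x v. \<Sum>c\<in>onb. inner (frechet_derivative g (at x) v) c *\<^sub>R frechet_derivative f (at (g x)) c"])
    fix x assume x: "x \<in> S"
    have eq: "(\<Sum>c\<in>onb. inner w c *\<^sub>R frechet_derivative f (at (g x)) c)
        = frechet_derivative f (at (g x)) w" for w
      using Df[OF x] by (intro linear_onb_expansion[symmetric] has_derivative_linear)
    show "((\<lambda>x. f (g x)) has_derivative
      (\<lambda>v. \<Sum>c\<in>onb. inner (frechet_derivative g (at x) v) c *\<^sub>R frechet_derivative f (at (g x)) c)) (at x)"
      using has_derivative_compose[OF Dg[OF x] Df[OF x]] by (simp only: eq)
  next
    fix v
    have "Ck_on k S g" using Suc.prems Ck_on_Suc_imp by blast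
    then have "Ck_on k S (\<lambda>x. frechet_derivative f (at (g x)) c)" for c
      using Suc.prems by (intro Suc.IH[of "\<lambda>y. frechet_derivative f (at y) c"]) auto
    moreover have "Ck_on k S (\<lambda>x. inner (frechet_derivative g (at x) v) c)" for c
      using Suc.prems by (intro Ck_on_bounded_linear_compose[OF S bounded_linear_inner_left]) auto
    ultimately show "Ck_on k S (\<lambda>x. \<Sum>c\<in>onb. inner (frechet_derivative g (at x) v) c
        *\<^sub>R frechet_derivative f (at (g x)) c)"
      by (intro Ck_on_sum[OF S] Ck_on_scaleR[OF S]) auto
  qed
qed

section \<open>Smooth functions and Hadamard's lemma\<close>


lemma smooth_on_cong: "open S \<Longrightarrow> smooth_on S f \<Longrightarrow> (\<And>x. x \<in> S \<Longrightarrow> f x = g x) \<Longrightarrow> smooth_on S g"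
  unfolding smooth_on_def using Ck_on_cong by blast

lemma smooth_on_subset: "smooth_on S f \<Longrightarrow> T \<subseteq> S \<Longrightarrow> smooth_on T f"
  unfolding smooth_on_def using Ck_on_subset by blast

lemma smooth_on_local:
  "(\<And>x. x \<in> S \<Longrightarrow> \<exists>T. open T \<and> x \<in> T \<and> smooth_on T f) \<Longrightarrow> smooth_on S f"
  unfolding smooth_on_def by (meson Ck_on_local)

lemma smooth_on_const: "smooth_on S (\<lambda>x. c)"
  by (simp add: smooth_on_def Ck_on_const)

lemma smooth_on_bounded_linear: "open S \<Longrightarrow> bounded_linear L \<Longrightarrow> smooth_on S L"
  by (simp add: smooth_on_def Ck_on_bounded_linear)

lemma smooth_on_add: "open S \<Longrightarrow> smooth_on S f \<Longrightarrow> smooth_on S g \<Longrightarrow> smooth_on S (\<lambda>x. f x + g x)"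
  by (simp add: smooth_on_def Ck_on_add)

lemma smooth_on_mult:
  fixes f g :: "'a::real_normed_vector \<Rightarrow> real"
  shows "open S \<Longrightarrow> smooth_on S f \<Longrightarrow> smooth_on S g \<Longrightarrow> smooth_on S (\<lambda>x. f x * g x)"
  by (simp add: smooth_on_def Ck_on_mult)

lemma smooth_on_compose:
  fixes f :: "'f::fin_dim_inner \<Rightarrow> 'b::real_normed_vector" and g :: "'a::real_normed_vector \<Rightarrow> 'f"
  shows "open S \<Longrightarrow> open T \<Longrightarrow> smooth_on T f \<Longrightarrow> smooth_on S g \<Longrightarrow> g ` S \<subseteq> T \<Longrightarrow> smooth_on S (\<lambda>x. f (g x))"
  by (simp add: smooth_on_def Ck_on_compose)

lemma smooth_on_frechet_derivative:
  "smooth_on S f \<Longrightarrow> smooth_on S (\<lambda>x. frechet_derivative f (at x) v)"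
  by (simp add: smooth_on_def) (metis Ck_on.simps(2))

lemma smooth_on_has_derivative:
  "smooth_on S f \<Longrightarrow> x \<in> S \<Longrightarrow> (f has_derivative frechet_derivative f (at x)) (at x)"
  unfolding smooth_on_def by (metis Ck_on.simps(2) frechet_derivative_works)

section \<open>Bump functions\<close>

text \<open>The classical flat function exp(-1/t) is the case n = 0. The powers of 1/t make the
  family closed under differentiation up to linear combinations, so one induction on the order
  handles all derivatives.\<close>

definition flat_exp :: "nat \<Rightarrow> real \<Rightarrow> real" where
  "flat_exp n t = (if t > 0 then exp (- inverse t) * inverse t ^ n else 0)"

text \<open>This is the difference quotient at 0, where the value is 0. From the right the
  exponential of 1/t beats every power of 1/t.\<close>

lemma flat_exp_div_tendsto: "((\<lambda>t. flat_exp n t / t) \<longlongrightarrow> 0) (at 0)"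
proof (rule filterlim_split_at)
  have "eventually (\<lambda>t. flat_exp n t / t = 0) (at_left (0::real))"
    unfolding eventually_at_filter by (rule always_eventually) (simp add: flat_exp_def)
  then show "((\<lambda>t. flat_exp n t / t) \<longlongrightarrow> 0) (at_left 0)"
    by (rule tendsto_eventually)
  have "((\<lambda>t. inverse t ^ Suc n / exp (inverse t)) \<longlongrightarrow> 0) (at_right (0::real))"
    by (rule filterlim_compose[OF tendsto_power_div_exp_0 filterlim_inverse_at_top_right])
  moreover have "eventually (\<lambda>t. inverse t ^ Suc n / exp (inverse t) = flat_exp n t / t) (at_right (0::real))"
    unfolding eventually_at_filter
    by (rule always_eventually) (simp add: flat_exp_def exp_minus divide_inverse mult_ac)
  ultimately show "((\<lambda>t. flat_exp n t / t) \<longlongrightarrow> 0) (at_right 0)"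
    by (rule Lim_transform_eventually)
qed

lemma flat_exp_has_derivative:
  "(flat_exp n has_real_derivative flat_exp (n + 2) t - real n * flat_exp (n + 1) t) (at t)"
proof -
  consider "t > 0" | "t < 0" | "t = 0" by linarith
  then show ?thesis
  proof cases
    case 1
    have inv: "(inverse has_real_derivative - (inverse t ^ 2)) (at t)"
      using DERIV_inverse[of t UNIV] 1 by (simp add: power2_eq_square)
    have "((\<lambda>u. exp (- u) * u ^ n) has_real_derivative
        - exp (- u) * u ^ n + exp (- u) * (real n * u ^ (n - 1))) (at u)" for u :: real
      by (auto intro!: derivative_eq_intros)
    from DERIV_chain2[OF this inv]
    have "((\<lambda>t. exp (- inverse t) * inverse t ^ n) has_real_derivative
       flat_exp (n + 2) t - real n * flat_exp (n + 1) t) (at t)"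
      using 1 by (cases n) (simp_all add: flat_exp_def algebra_simps power2_eq_square)
    then show ?thesis
      by (rule has_field_derivative_transform_within_open[of _ _ _ "{0<..}"])
         (use 1 in \<open>auto simp: flat_exp_def\<close>)
  next
    case 2
    have "((\<lambda>t. 0) has_real_derivative flat_exp (n + 2) t - real n * flat_exp (n + 1) t) (at t)"
      using 2 by (simp add: flat_exp_def)
    then show ?thesis
      by (rule has_field_derivative_transform_within_open[of _ _ _ "{..<0}"])
         (use 2 in \<open>auto simp: flat_exp_def\<close>)
  next
    case 3
    then show ?thesis
      using flat_exp_div_tendsto[of n] by (simp add: has_field_derivative_iff flat_exp_def)
  qed
qed

lemma Ck_on_flat_exp: "Ck_on k UNIV (flat_exp n)"
proof (induction k arbitrary: n)
  case 0
  then show ?case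
    using flat_exp_has_derivative by (auto intro!: DERIV_continuous_on)
next
  case (Suc k)
  show ?case
  proof (rule Ck_on_SucI[OF open_UNIV])
    show "(flat_exp n has_derivative (\<lambda>v. v *\<^sub>R (flat_exp (n + 2) t + (- real n) *\<^sub>R flat_exp (n + 1) t))) (at t)" for t
      using flat_exp_has_derivative[of n t]
      by (simp add: has_field_derivative_def mult_commute_abs)
    show "Ck_on k UNIV (\<lambda>t. v *\<^sub>R (flat_exp (n + 2) t + (- real n) *\<^sub>R flat_exp (n + 1) t))" for v
      by (intro Ck_on_scaleR Ck_on_add Ck_on_const Suc open_UNIV)
  qed
qed

lemma Ck_on_inner_self: "Ck_on k UNIV (\<lambda>x::'e::real_inner. inner x x)"
proof (cases k)
  case 0
  then show ?thesis by (simp add: continuous_on_inner)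
next
  case (Suc k')
  have "Ck_on k' UNIV (\<lambda>x::'e. inner x v + inner v x)" for v
    by (intro Ck_on_bounded_linear bounded_linear_add bounded_linear_inner_left
        bounded_linear_inner_right open_UNIV)
  then show ?thesis unfolding Suc
    by (intro Ck_on_SucI[OF open_UNIV, where f'="\<lambda>x v. inner x v + inner v x"])
       (auto intro!: derivative_eq_intros)
qed

text \<open>\<open>h\<close> is r^2 - |x - a|^2, positive exactly on the ball; composition with
  \<open>flat_exp 0\<close> vanishes elsewhere, and division by the value at \<open>a\<close>
  normalises it.\<close>

lemma smooth_bump:
  fixes a :: "'e::fin_dim_inner"
  assumes "r > 0"
  shows "\<exists>b :: 'e \<Rightarrow> real. smooth_on UNIV b \<and> b a = 1 \<and> (\<forall>x. b x \<noteq> 0 \<longleftrightarrow> x \<in> ball a r)"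
proof -
  define g where "g = (\<lambda>x. x + - a)"
  define h where "h = (\<lambda>x. r\<^sup>2 + (- 1) * inner (g x) (g x))"
  have "smooth_on UNIV g"
    unfolding g_def
    by (rule smooth_on_add[OF open_UNIV smooth_on_bounded_linear[OF open_UNIV bounded_linear_ident]
          smooth_on_const])
  moreover have "smooth_on UNIV (\<lambda>x::'e. inner x x)"
    by (simp add: smooth_on_def Ck_on_inner_self)
  ultimately have "smooth_on UNIV (\<lambda>x. inner (g x) (g x))"
    using smooth_on_compose[OF open_UNIV open_UNIV, of "\<lambda>x. inner x x" g] by simp
  then have "smooth_on UNIV h"
    unfolding h_def
    by (rule smooth_on_add[OF open_UNIV smooth_on_const
          smooth_on_mult[OF open_UNIV smooth_on_const]])
  moreover have "smooth_on UNIV (flat_exp 0)"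
    by (simp add: smooth_on_def Ck_on_flat_exp)
  ultimately have "smooth_on UNIV (\<lambda>x. flat_exp 0 (h x))"
    using smooth_on_compose[OF open_UNIV open_UNIV, of "flat_exp 0" h] by simp
  then have "smooth_on UNIV (\<lambda>x. inverse (flat_exp 0 (h a)) * flat_exp 0 (h x))"
    by (rule smooth_on_mult[OF open_UNIV smooth_on_const])
  moreover have nz: "flat_exp 0 (h x) \<noteq> 0 \<longleftrightarrow> x \<in> ball a r" for x
  proof -
    have "inner (g x) (g x) = (dist a x)\<^sup>2"
      by (simp add: g_def dist_norm norm_minus_commute[of a x] power2_norm_eq_inner)
    then have "flat_exp 0 (h x) \<noteq> 0 \<longleftrightarrow> (dist a x)\<^sup>2 < r\<^sup>2"
      by (simp add: h_def flat_exp_def)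
    also have "\<dots> \<longleftrightarrow> dist a x < r"
      using assms by (metis abs_le_square_iff abs_of_nonneg abs_of_pos linorder_not_less zero_le_dist)
    finally show ?thesis by simp
  qed
  ultimately show ?thesis
    using assms nz[of a] by (intro exI[of _ "\<lambda>x. inverse (flat_exp 0 (h a)) * flat_exp 0 (h x)"]) simp
qed

section \<open>Integrals along segments\<close>

lemma segment_in_ball:
  fixes a :: "'e::real_normed_vector"
  assumes "q \<in> ball a r" "x \<in> ball a r" "0 \<le> t" "t \<le> 1"
  shows "q + t *\<^sub>R (x - q) \<in> ball a r"
proof -
  have "(1 - t) *\<^sub>R q + t *\<^sub>R x \<in> ball a r"
    using assms by (intro convexD[OF convex_ball]) auto
  then show ?thesis by (simp add: algebra_simps)
qed

text \<open>Differentiation under the integral sign. Each derivative of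
  \<open>q + t *\<^sub>R (x - q)\<close> with respect to \<open>x\<close> brings out a factor t; the
  general weight \<open>t ^ n\<close> keeps the statement stable under the induction.\<close>

lemma Ck_on_segment_integral:
  fixes F :: "'e::fin_dim_inner \<Rightarrow> real"
  assumes q: "q \<in> ball a r"
  shows "Ck_on (Suc k) (ball a r) F
    \<Longrightarrow> Ck_on k (ball a r) (\<lambda>x. integral {0..1} (\<lambda>t. t ^ n * F (q + t *\<^sub>R (x - q))))"
proof -
  let ?B = "ball a r"
  have D: "((\<lambda>x. integral {0..1} (\<lambda>t. t ^ n * F (q + t *\<^sub>R (x - q)))) has_derivative
     (\<lambda>v. integral {0..1} (\<lambda>t. t ^ Suc n * frechet_derivative F (at (q + t *\<^sub>R (x - q))) v))) (at x)"
    if F: "Ck_on (Suc k) ?B F" and x: "x \<in> ?B" for F :: "'e \<Rightarrow> real" and n k x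
  proof -
    \<comment> \<open>\<open>leibniz_rule\<close> expects a continuous family of bounded linear
      maps. Written in the basis, its continuity reduces to that of finitely many partial
      derivatives.\<close>
    let ?fx = "\<lambda>x t. (\<Sum>c\<in>onb. (t ^ Suc n * frechet_derivative F (at (q + t *\<^sub>R (x - q))) c)
      *\<^sub>R blinfun_inner_left c)"
    have cont: "continuous_on (?B \<times> cbox 0 1) (\<lambda>z. G (q + snd z *\<^sub>R (fst z - q)))"
      if "continuous_on ?B G" for G :: "'e \<Rightarrow> real"
      by (rule continuous_on_compose2[OF that])
         (use segment_in_ball[OF q] in \<open>auto intro!: continuous_intros simp: cbox_interval\<close>)
    have Fder: "(F has_derivative frechet_derivative F (at y)) (at y)" if "y \<in> ?B" for y
      using F that by (simp add: frechet_derivative_works[symmetric])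
    have fx: "blinfun_apply (?fx x t)
        = (\<lambda>v. t ^ Suc n * frechet_derivative F (at (q + t *\<^sub>R (x - q))) v)"
      if "x \<in> ?B" "t \<in> cbox 0 1" for x t
    proof
      fix v
      have "linear (frechet_derivative F (at (q + t *\<^sub>R (x - q))))"
        using that Fder segment_in_ball[OF q] by (intro has_derivative_linear) (auto simp: cbox_interval)
      from linear_onb_expansion[OF this, of v]
      show "blinfun_apply (?fx x t) v = t ^ Suc n * frechet_derivative F (at (q + t *\<^sub>R (x - q))) v"
        by (simp add: blinfun.bilinear_simps blinfun.sum_left sum_distrib_left mult_ac)
    qed
    have contfx: "continuous_on (?B \<times> cbox 0 1) (\<lambda>(x, t). ?fx x t)"
    proof -
      have "continuous_on ?B (\<lambda>y. frechet_derivative F (at y) c)" for c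
        using F Ck_on_imp_continuous_on by fastforce
      then show ?thesis unfolding split_beta by (intro continuous_intros cont)
    qed
    have "((\<lambda>x. integral (cbox 0 1) (\<lambda>t. t ^ n * F (q + t *\<^sub>R (x - q))))
       has_derivative integral (cbox 0 1) (?fx x)) (at x within ?B)"
    proof (rule leibniz_rule)
      show "((\<lambda>x. t ^ n * F (q + t *\<^sub>R (x - q))) has_derivative blinfun_apply (?fx x t)) (at x within ?B)"
        if "x \<in> ?B" "t \<in> cbox 0 1" for x t
      proof -
        have y: "q + t *\<^sub>R (x - q) \<in> ?B" using segment_in_ball[OF q] that by (auto simp: cbox_interval)
        have "((\<lambda>x. q + t *\<^sub>R (x - q)) has_derivative (\<lambda>v. t *\<^sub>R v)) (at x)"
          by (auto intro!: derivative_eq_intros)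
        from has_derivative_compose[OF this Fder[OF y]]
        have "((\<lambda>x. t ^ n * F (q + t *\<^sub>R (x - q))) has_derivative
          (\<lambda>v. t ^ n * frechet_derivative F (at (q + t *\<^sub>R (x - q))) (t *\<^sub>R v))) (at x)"
          by (auto intro!: derivative_eq_intros)
        moreover have "frechet_derivative F (at (q + t *\<^sub>R (x - q))) (t *\<^sub>R v)
          = t * frechet_derivative F (at (q + t *\<^sub>R (x - q))) v" for v
          using has_derivative_linear[OF Fder[OF y]] by (simp add: linear_scale)
        ultimately show ?thesis
          unfolding fx[OF that] by (simp add: mult_ac has_derivative_at_withinI)
      qed
      show "(\<lambda>t. t ^ n * F (q + t *\<^sub>R (x - q))) integrable_on cbox 0 1" if "x \<in> ?B" for x
      proof (rule integrable_continuous)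
        have "continuous_on (cbox 0 1) (\<lambda>t. F (q + t *\<^sub>R (x - q)))"
          by (rule continuous_on_compose2[OF Ck_on_imp_continuous_on[OF F]])
             (use segment_in_ball[OF q that] in \<open>auto intro!: continuous_intros simp: cbox_interval\<close>)
        then show "continuous_on (cbox 0 1) (\<lambda>t. t ^ n * F (q + t *\<^sub>R (x - q)))"
          by (intro continuous_intros)
      qed
    qed (use contfx x in auto)
    moreover have "blinfun_apply (integral (cbox 0 1) (?fx x))
      = (\<lambda>v. integral (cbox 0 1) (\<lambda>t. t ^ Suc n * frechet_derivative F (at (q + t *\<^sub>R (x - q))) v))"
    proof
      fix v
      have "continuous_on (cbox 0 1) (\<lambda>t. (\<lambda>(x, t). ?fx x t) (x, t))"
        by (rule continuous_on_compose2[OF contfx continuous_on_Pair[OF continuous_on_const continuous_on_id]])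
           (use x in auto)
      then have "continuous_on (cbox 0 1) (?fx x)" by simp
      then have "blinfun_apply (integral (cbox 0 1) (?fx x)) v = integral (cbox 0 1) (\<lambda>t. blinfun_apply (?fx x t) v)"
        by (intro blinfun_apply_integral integrable_continuous)
      also have "\<dots> = integral (cbox 0 1) (\<lambda>t. t ^ Suc n * frechet_derivative F (at (q + t *\<^sub>R (x - q))) v)"
        by (intro integral_cong) (simp only: fx[OF x])
      finally show "blinfun_apply (integral (cbox 0 1) (?fx x)) v = \<dots>" .
    qed
    ultimately show ?thesis
      unfolding at_within_open[OF x open_ball] by (simp only: cbox_interval)
  qed
  show "Ck_on (Suc k) ?B F \<Longrightarrow> ?thesis"
  proof (induction k arbitrary: F n)
    case 0
    show ?case
      unfolding Ck_on.simps
      by (intro differentiable_imp_continuous_on differentiable_at_imp_differentiable_on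
          differentiableI[OF D[OF 0]])
  next
    case (Suc k)
    show ?case
    proof (rule Ck_on_SucI[OF open_ball D[OF Suc.prems]])
      have "Ck_on (Suc k) ?B (\<lambda>y. frechet_derivative F (at y) v)" for v
        using Suc.prems unfolding Ck_on.simps(2)[of "Suc k"] by blast
      then show "Ck_on k ?B (\<lambda>x. integral {0..1}
          (\<lambda>t. t ^ Suc n * frechet_derivative F (at (q + t *\<^sub>R (x - q))) v))" for v
        by (rule Suc.IH)
    qed
  qed
qed

text \<open>Integrate the derivative of \<open>f\<close> along the segment from \<open>q\<close> to
  \<open>x\<close>; \<open>g c\<close> is the mean of the partial derivative in direction
  \<open>c\<close>. The base point \<open>q\<close> is any point of the ball, because one fixed bump
  function later serves all nearby points.\<close>

lemma Hadamard:
  fixes f :: "'e::fin_dim_inner \<Rightarrow> real"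
  assumes q: "q \<in> ball a r" and f: "smooth_on (ball a r) f"
  shows "\<exists>g. (\<forall>c. smooth_on (ball a r) (g c) \<and> g c q = frechet_derivative f (at q) c)
    \<and> (\<forall>x\<in>ball a r. f x = f q + (\<Sum>c\<in>onb. inner (x - q) c * g c x))"
proof (intro exI conjI allI ballI)
  let ?g = "\<lambda>c x. integral {0..1} (\<lambda>t. frechet_derivative f (at (q + t *\<^sub>R (x - q))) c)"
  show "smooth_on (ball a r) (?g c)" for c
    using Ck_on_segment_integral[OF q, of _ "\<lambda>x. frechet_derivative f (at x) c" 0]
      smooth_on_frechet_derivative[OF f, of c] by (simp add: smooth_on_def del: Ck_on.simps)
  show "?g c q = frechet_derivative f (at q) c" for c
    by simp
  fix x assume x: "x \<in> ball a r"
  have D: "(f has_derivative frechet_derivative f (at (q + t *\<^sub>R (x - q)))) (at (q + t *\<^sub>R (x - q)))"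
    if "t \<in> {0..1}" for t
    using segment_in_ball[OF q x] that by (intro smooth_on_has_derivative[OF f]) auto
  have int: "((\<lambda>t. frechet_derivative f (at (q + t *\<^sub>R (x - q))) (x - q)) has_integral
      f (q + 1 *\<^sub>R (x - q)) - f (q + 0 *\<^sub>R (x - q))) {0..1}"
  proof (rule fundamental_theorem_of_calculus)
    fix t :: real assume t: "t \<in> {0..1}"
    have "((\<lambda>t. q + t *\<^sub>R (x - q)) has_derivative (\<lambda>s. s *\<^sub>R (x - q))) (at t within {0..1})"
      by (auto intro!: derivative_eq_intros)
    from has_derivative_compose[OF this D[OF t]] has_derivative_linear[OF D[OF t]]
    show "((\<lambda>t. f (q + t *\<^sub>R (x - q))) has_vector_derivative
        frechet_derivative f (at (q + t *\<^sub>R (x - q))) (x - q)) (at t within {0..1})"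
      by (simp add: has_vector_derivative_def linear_scale)
  qed auto
  have "f x - f q = integral {0..1} (\<lambda>t. frechet_derivative f (at (q + t *\<^sub>R (x - q))) (x - q))"
    using integral_unique[OF int] by simp
  also have "\<dots> = integral {0..1}
      (\<lambda>t. \<Sum>c\<in>onb. inner (x - q) c * frechet_derivative f (at (q + t *\<^sub>R (x - q))) c)"
    using linear_onb_expansion[OF has_derivative_linear[OF D], of _ "x - q"]
    by (intro integral_cong) auto
  also have "\<dots> = (\<Sum>c\<in>onb. integral {0..1}
      (\<lambda>t. inner (x - q) c * frechet_derivative f (at (q + t *\<^sub>R (x - q))) c))"
  proof (rule integral_sum[OF finite_onb])
    fix c
    have "continuous_on (ball a r) (\<lambda>y. frechet_derivative f (at y) c)"
      using smooth_on_frechet_derivative[OF f, of c] Ck_on_imp_continuous_on smooth_on_def by blast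
    then have "continuous_on {0..1} (\<lambda>t. frechet_derivative f (at (q + t *\<^sub>R (x - q))) c)"
      by (rule continuous_on_compose2)
         (use segment_in_ball[OF q x] in \<open>auto intro!: continuous_intros\<close>)
    then show "(\<lambda>t. inner (x - q) c * frechet_derivative f (at (q + t *\<^sub>R (x - q))) c)
        integrable_on {0..1}"
      by (intro integrable_continuous_real continuous_intros)
  qed
  finally show "f x = f q + (\<Sum>c\<in>onb. inner (x - q) c * ?g c x)"
    by simp
qed

section \<open>Manifolds and local frames\<close>


text \<open>The inverse homeomorphism is merely known to exist; on the image it agrees with
  \<open>inv_into U \<phi>\<close>, the inverse in which smoothness is expressed.\<close>

lemma is_chartD:
  assumes "is_chart (U, \<phi>)"
  shows "open U" "open (\<phi> ` U)" "inj_on \<phi> U" "continuous_on U \<phi>"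
    "continuous_on (\<phi> ` U) (inv_into U \<phi>)"
proof -
  obtain \<psi> where h: "homeomorphism U (\<phi> ` U) \<phi> \<psi>"
    using assms by (auto simp: is_chart_def)
  show "open U" "open (\<phi> ` U)" using assms by (auto simp: is_chart_def)
  show inj: "inj_on \<phi> U" using h by (metis homeomorphism_def inj_on_inverseI)
  show "continuous_on U \<phi>" using h by (simp add: homeomorphism_def)
  have \<psi>: "continuous_on (\<phi> ` U) \<psi>" "\<And>x. x \<in> U \<Longrightarrow> \<psi> (\<phi> x) = x"
    using h by (auto simp: homeomorphism_def)
  have "inv_into U \<phi> y = \<psi> y" if "y \<in> \<phi> ` U" for y
    using that \<psi>(2) inj by (auto simp: inv_into_f_f)
  then show "continuous_on (\<phi> ` U) (inv_into U \<phi>)"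
    using \<psi>(1) by (simp cong: continuous_on_cong)
qed

lemma chart_open_image:
  assumes c: "is_chart (U, \<phi>)" and W: "open W" "W \<subseteq> U"
  shows "open (\<phi> ` W)"
proof -
  have "\<phi> ` W = inv_into U \<phi> -` W \<inter> \<phi> ` U"
    using W(2) is_chartD(3)[OF c] by (auto simp: f_inv_into_f image_iff subset_iff)
  then show ?thesis
    using is_chartD(2,5)[OF c] W(1) by (simp add: continuous_on_open_vimage)
qed

lemma chart_open_vimage:
  assumes c: "is_chart (U, \<phi>)" and W: "open W"
  shows "open (U \<inter> \<phi> -` W)"
  using is_chartD(1,4)[OF c] W continuous_on_open_vimage[of U \<phi>] by (simp add: Int_commute)

text \<open>Near a point the chart expression of the composition is the one of \<open>h\<close>
  after the one of \<open>f\<close>. Of the source only an atlas of charts is asked, so that a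
  product atlas fits directly.\<close>

lemma smooth_funs_compose:
  assumes N: "\<And>c. c \<in> N \<Longrightarrow> is_chart c" and M: "\<And>c. c \<in> M \<Longrightarrow> is_chart c"
    and cover: "(\<Union>(V, \<psi>)\<in>M. V) = UNIV"
    and f: "smooth_map N M f" and h: "h \<in> smooth_funs M"
  shows "(\<lambda>x. h (f x)) \<in> smooth_funs N"
proof -
  have "smooth_on (\<phi> ` U) ((\<lambda>x. h (f x)) \<circ> inv_into U \<phi>)" if U: "(U, \<phi>) \<in> N" for U \<phi>
  proof (rule smooth_on_local)
    fix y assume "y \<in> \<phi> ` U"
    then obtain x where x: "x \<in> U" "y = \<phi> x" by blast
    obtain V \<psi> where V: "(V, \<psi>) \<in> M" "f x \<in> V"
    proof -
      have "f x \<in> (\<Union>(V, \<psi>)\<in>M. V)" by (simp only: cover UNIV_I)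
      then show ?thesis using that by auto
    qed
    let ?T = "\<phi> ` (U \<inter> f -` V)"
    note cU = is_chartD[OF N[OF U]] and cV = is_chartD[OF M[OF V(1)]]
    have oT: "open ?T"
    proof (rule chart_open_image[OF N[OF U]])
      show "open (U \<inter> f -` V)"
        using f cU(1) cV(1) by (simp add: smooth_map_def continuous_on_open_vimage open_Int open_vimage)
    qed auto
    have s1: "smooth_on ?T (\<psi> \<circ> f \<circ> inv_into U \<phi>)"
      using f U V(1) by (auto simp: smooth_map_def)
    have s2: "smooth_on (\<psi> ` V) (h \<circ> inv_into V \<psi>)"
      using h V(1) by (auto simp: smooth_funs_def)
    have "smooth_on ?T (\<lambda>y. (h \<circ> inv_into V \<psi>) ((\<psi> \<circ> f \<circ> inv_into U \<phi>) y))"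
      by (rule smooth_on_compose[OF oT cV(2) s2 s1]) (auto simp: inv_into_f_f[OF cU(3)])
    then have "smooth_on ?T ((\<lambda>x. h (f x)) \<circ> inv_into U \<phi>)"
      by (rule smooth_on_cong[OF oT])
         (auto simp: inv_into_f_f[OF cU(3)] inv_into_f_f[OF cV(3)])
    then show "\<exists>T. open T \<and> y \<in> T \<and> smooth_on T ((\<lambda>x. h (f x)) \<circ> inv_into U \<phi>)"
      using oT x V(2) by blast
  qed
  then show ?thesis by (auto simp: smooth_funs_def)
qed

section \<open>Smooth functions and derivations at a point\<close>

text \<open>The fragment of the theory that rests on open chart images alone: algebra of smooth
  functions, tangent and cotangent spaces. The product atlas is used through this locale.\<close>

locale charted =
  fixes M :: "('a::topological_space, 'e::fin_dim_inner) atlas"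
  assumes is_chart: "c \<in> M \<Longrightarrow> is_chart c"
begin

lemma smooth_funs_const: "(\<lambda>x. c) \<in> smooth_funs M"
  by (auto simp: smooth_funs_def o_def smooth_on_const)

lemma smooth_funs_add:
  assumes "f \<in> smooth_funs M" "g \<in> smooth_funs M" shows "(\<lambda>x. f x + g x) \<in> smooth_funs M"
  using assms is_chartD(2)[OF is_chart] by (auto simp: smooth_funs_def o_def intro!: smooth_on_add)

lemma smooth_funs_mult:
  assumes "f \<in> smooth_funs M" "g \<in> smooth_funs M" shows "(\<lambda>x. f x * g x) \<in> smooth_funs M"
  using assms is_chartD(2)[OF is_chart] by (auto simp: smooth_funs_def o_def intro!: smooth_on_mult)

lemma smooth_funs_uminus:
  assumes "f \<in> smooth_funs M" shows "(\<lambda>x. - f x) \<in> smooth_funs M"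
  using smooth_funs_mult[OF smooth_funs_const[of "-1"] assms] by simp

lemma smooth_funs_diff:
  assumes "f \<in> smooth_funs M" "g \<in> smooth_funs M" shows "(\<lambda>x. f x - g x) \<in> smooth_funs M"
  using smooth_funs_add[OF assms(1) smooth_funs_uminus[OF assms(2)]] by simp

lemma smooth_funs_sum:
  "(\<And>i. i \<in> I \<Longrightarrow> f i \<in> smooth_funs M) \<Longrightarrow> (\<lambda>x. \<Sum>i\<in>I. f i x) \<in> smooth_funs M"
  by (induction I rule: infinite_finite_induct) (auto intro: smooth_funs_const smooth_funs_add)

lemmas smooth_funs_intros = smooth_funs_const smooth_funs_add smooth_funs_mult smooth_funs_uminus
  smooth_funs_diff smooth_funs_sum

context
  fixes p v assumes v: "v \<in> tangent M p"
begin

lemma tangent_outside: "f \<notin> smooth_funs M \<Longrightarrow> v f = 0"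
  using v by (simp add: tangent_def lin_maps_def)

lemma tangent_add: "f \<in> smooth_funs M \<Longrightarrow> g \<in> smooth_funs M \<Longrightarrow> v (\<lambda>x. f x + g x) = v f + v g"
  using v by (simp add: tangent_def lin_maps_def plus_fun_def)

lemma tangent_cmult: "f \<in> smooth_funs M \<Longrightarrow> v (\<lambda>x. c * f x) = c * v f"
  using v by (simp add: tangent_def lin_maps_def scaleR_fun_def)

lemma tangent_mult:
  "f \<in> smooth_funs M \<Longrightarrow> g \<in> smooth_funs M \<Longrightarrow> v (\<lambda>x. f x * g x) = v f * g p + f p * v g"
  using v by (simp add: tangent_def times_fun_def)

lemma tangent_const: "v (\<lambda>x. c) = 0"
proof -
  have "v (\<lambda>x. 1) = 0"
    using tangent_mult[OF smooth_funs_const smooth_funs_const, of 1 1] by simp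
  then show ?thesis using tangent_cmult[OF smooth_funs_const, of c 1] by simp
qed

lemma tangent_uminus: "f \<in> smooth_funs M \<Longrightarrow> v (\<lambda>x. - f x) = - v f"
  using tangent_cmult[of f "-1"] by simp

lemma tangent_diff:
  assumes "f \<in> smooth_funs M" "g \<in> smooth_funs M" shows "v (\<lambda>x. f x - g x) = v f - v g"
  using tangent_add[OF assms(1) smooth_funs_uminus[OF assms(2)]] tangent_uminus[OF assms(2)] by simp

lemma tangent_sum:
  assumes "\<And>i. i \<in> I \<Longrightarrow> f i \<in> smooth_funs M"
  shows "v (\<lambda>x. \<Sum>i\<in>I. f i x) = (\<Sum>i\<in>I. v (f i))"
  using assms
  by (induction I rule: infinite_finite_induct)
     (simp_all add: tangent_const tangent_add smooth_funs_sum)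

end

lemma tangentI:
  assumes "\<And>f. f \<notin> smooth_funs M \<Longrightarrow> v f = 0"
    and "\<And>f g. f \<in> smooth_funs M \<Longrightarrow> g \<in> smooth_funs M \<Longrightarrow> v (\<lambda>x. f x + g x) = v f + v g"
    and "\<And>f c. f \<in> smooth_funs M \<Longrightarrow> v (\<lambda>x. c * f x) = c * v f"
    and "\<And>f g. f \<in> smooth_funs M \<Longrightarrow> g \<in> smooth_funs M \<Longrightarrow> v (\<lambda>x. f x * g x) = v f * g p + f p * v g"
  shows "v \<in> tangent M p"
  using assms by (simp add: tangent_def lin_maps_def plus_fun_def times_fun_def scaleR_fun_def)

lemma tangent_eqI:
  assumes "u \<in> tangent M p" "v \<in> tangent M p" "\<And>f. f \<in> smooth_funs M \<Longrightarrow> u f = v f"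
  shows "u = v"
  using assms tangent_outside by (metis ext)

lemma tangent_zero: "0 \<in> tangent M p"
  by (rule tangentI) auto

lemma tangent_plus: "u \<in> tangent M p \<Longrightarrow> v \<in> tangent M p \<Longrightarrow> u + v \<in> tangent M p"
  by (rule tangentI)
     (simp_all add: tangent_outside tangent_add tangent_cmult tangent_mult algebra_simps)

lemma tangent_scaleR: "v \<in> tangent M p \<Longrightarrow> c *\<^sub>R v \<in> tangent M p"
  by (rule tangentI)
     (simp_all add: tangent_outside tangent_add tangent_cmult tangent_mult algebra_simps)

lemma tangent_minus: "v \<in> tangent M p \<Longrightarrow> - v \<in> tangent M p"
  using tangent_scaleR[of v p "-1"] by simp

lemma tangent_subtract: "u \<in> tangent M p \<Longrightarrow> v \<in> tangent M p \<Longrightarrow> u - v \<in> tangent M p"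
  using tangent_plus[OF _ tangent_minus, of u p v] by simp

lemma tangent_sum_closed: "(\<And>i. i \<in> I \<Longrightarrow> v i \<in> tangent M p) \<Longrightarrow> (\<Sum>i\<in>I. v i) \<in> tangent M p"
  by (induction I rule: infinite_finite_induct) (auto intro: tangent_zero tangent_plus)

lemmas tangent_intros = tangent_zero tangent_plus tangent_scaleR tangent_minus tangent_subtract tangent_sum_closed

end

lemma sum_fun_apply: "(\<Sum>i\<in>I. f i) x = (\<Sum>i\<in>I. f i x)"
  by (induction I rule: infinite_finite_induct) auto

section \<open>Vector fields and local frames\<close>

locale smooth_mfd =
  fixes M :: "('a::{t2_space, second_countable_topology}, 'e::fin_dim_inner) atlas"
  assumes smooth_manifold: "smooth_manifold M"

sublocale smooth_mfd \<subseteq> charted M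
  using smooth_manifold by unfold_locales (auto simp: smooth_manifold_def)

context smooth_mfd begin

lemma charts_cover: "(\<Union>(V, \<psi>)\<in>M. V) = UNIV"
  using smooth_manifold by (auto simp: smooth_manifold_def)

lemma ex_chart: "\<exists>U \<phi>. (U, \<phi>) \<in> M \<and> p \<in> U"
proof -
  have "p \<in> (\<Union>(V, \<psi>)\<in>M. V)" by (simp only: charts_cover UNIV_I)
  then show ?thesis by auto
qed

lemma smooth_transition:
  "(U, \<phi>) \<in> M \<Longrightarrow> (V, \<psi>) \<in> M \<Longrightarrow> smooth_on (\<phi> ` (U \<inter> V)) (\<psi> \<circ> inv_into U \<phi>)"
  using smooth_manifold by (auto simp: smooth_manifold_def)

lemma vf_tangent: "X \<in> vector_fields M \<Longrightarrow> X p \<in> tangent M p"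
  by (simp add: vector_fields_def)

lemma vf_smooth: "X \<in> vector_fields M \<Longrightarrow> f \<in> smooth_funs M \<Longrightarrow> (\<lambda>p. X p f) \<in> smooth_funs M"
  by (simp add: vector_fields_def)

lemma vfI:
  "(\<And>p. X p \<in> tangent M p) \<Longrightarrow> (\<And>f. f \<in> smooth_funs M \<Longrightarrow> (\<lambda>p. X p f) \<in> smooth_funs M)
    \<Longrightarrow> X \<in> vector_fields M"
  by (simp add: vector_fields_def)

lemma vf_add: "X \<in> vector_fields M \<Longrightarrow> Y \<in> vector_fields M \<Longrightarrow> (\<lambda>p. X p + Y p) \<in> vector_fields M"
  by (rule vfI) (auto intro: tangent_intros vf_tangent smooth_funs_intros vf_smooth)

lemma vf_zero: "(\<lambda>p. 0) \<in> vector_fields M"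
  by (rule vfI) (auto intro: tangent_intros smooth_funs_intros)

lemma vf_mult: "f \<in> smooth_funs M \<Longrightarrow> X \<in> vector_fields M \<Longrightarrow> (\<lambda>p. f p *\<^sub>R X p) \<in> vector_fields M"
  by (rule vfI) (auto intro: tangent_intros vf_tangent smooth_funs_intros vf_smooth)

lemma vf_sum: "(\<And>i. i \<in> I \<Longrightarrow> X i \<in> vector_fields M) \<Longrightarrow> (\<lambda>p. \<Sum>i\<in>I. X i p) \<in> vector_fields M"
  by (induction I rule: infinite_finite_induct) (auto intro: vf_zero vf_add)

text \<open>Two open sets cover the manifold: the part of \<open>U\<close> over \<open>W\<close>,
  where transition maps transport smoothness, and the complement of the preimage \<open>?K\<close>
  of the closed ball, where the function is 0.\<close>

lemma smooth_funs_extend: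
  assumes U: "(U, \<phi>) \<in> M" and W: "open W" "W \<subseteq> \<phi> ` U" "cball a r \<subseteq> W"
    and b: "smooth_on UNIV b" "\<And>y. b y \<noteq> 0 \<Longrightarrow> y \<in> cball a r" and g: "smooth_on W g"
  shows "(\<lambda>q. if q \<in> U then b (\<phi> q) * g (\<phi> q) else 0) \<in> smooth_funs M" (is "?F \<in> _")
proof -
  note cU = is_chartD[OF is_chart[OF U]]
  let ?K = "inv_into U \<phi> ` cball a r"
  have "compact ?K"
    using W cU(5) by (intro compact_continuous_image compact_cball) (meson continuous_on_subset order_trans)
  \<comment> \<open>The Hausdorff property enters here: the compact set is closed, so its complement
    is open.\<close>
  then have K: "closed ?K" by (rule compact_imp_closed)
  let ?U = "U \<inter> \<phi> -` W"
  have oU: "open ?U" by (rule chart_open_vimage[OF is_chart[OF U] W(1)])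
  have KU: "?K \<subseteq> ?U"
    using W by (auto simp: f_inv_into_f inv_into_into subset_iff)
  have bg: "smooth_on W (\<lambda>y. b y * g y)"
    using b(1) g by (intro smooth_on_mult W(1)) (auto intro: smooth_on_subset)
  have "smooth_on (\<psi> ` V) (?F \<circ> inv_into V \<psi>)" if V: "(V, \<psi>) \<in> M" for V \<psi>
  proof (rule smooth_on_local)
    note cV = is_chartD[OF is_chart[OF V]]
    fix y assume "y \<in> \<psi> ` V"
    then obtain x where x: "x \<in> V" "y = \<psi> x" by blast
    show "\<exists>T. open T \<and> y \<in> T \<and> smooth_on T (?F \<circ> inv_into V \<psi>)"
    proof (cases "x \<in> ?U")
      case True
      let ?T = "\<psi> ` (V \<inter> ?U)"
      have oT: "open ?T"
        by (rule chart_open_image[OF is_chart[OF V]]) (use cV(1) oU in auto)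
      have "smooth_on ?T (\<phi> \<circ> inv_into V \<psi>)"
        by (rule smooth_on_subset[OF smooth_transition[OF V U]]) auto
      then have "smooth_on ?T (\<lambda>z. (\<lambda>y. b y * g y) ((\<phi> \<circ> inv_into V \<psi>) z))"
        by (rule smooth_on_compose[OF oT W(1) bg]) (auto simp: inv_into_f_f[OF cV(3)])
      then have "smooth_on ?T (?F \<circ> inv_into V \<psi>)"
        by (rule smooth_on_cong[OF oT]) (auto simp: inv_into_f_f[OF cV(3)])
      then show ?thesis using oT True x by blast
    next
      case False
      let ?T = "\<psi> ` (V - ?K)"
      have oT: "open ?T"
        by (rule chart_open_image[OF is_chart[OF V]]) (use cV(1) K in \<open>auto intro: open_Diff\<close>)
      have z: "?F x' = 0" if "x' \<in> V - ?K" for x'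
      proof -
        have "b (\<phi> x') = 0" if "x' \<in> U"
        proof (rule ccontr)
          assume "b (\<phi> x') \<noteq> 0"
          then have "inv_into U \<phi> (\<phi> x') \<in> ?K" using b(2) by blast
          then show False using \<open>x' \<in> V - ?K\<close> that by (simp add: inv_into_f_f[OF cU(3)])
        qed
        then show ?thesis by simp
      qed
      have "smooth_on ?T (?F \<circ> inv_into V \<psi>)"
      proof (rule smooth_on_cong[OF oT smooth_on_const[of _ 0]])
        fix w assume "w \<in> ?T"
        then obtain x' where x': "x' \<in> V - ?K" "w = \<psi> x'" by blast
        then have "inv_into V \<psi> w = x'" by (simp add: inv_into_f_f[OF cV(3)])
        then show "0 = (?F \<circ> inv_into V \<psi>) w" using z[OF x'(1)] by (simp only: o_apply)
      qed
      then show ?thesis using oT False KU x by blast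
    qed
  qed
  then show ?thesis by (auto simp: smooth_funs_def)
qed

text \<open>
  With a bump function \<open>b\<close> and coordinates \<open>\<phi>\<^sub>c\<close> the functions are \<open>b\<close> and
  \<open>b \<phi>\<^sub>c\<close>, the vector fields \<open>- \<Sum> b \<phi>\<^sub>c D\<^sub>c\<close> and \<open>b D\<^sub>c\<close> for
  \<open>D\<^sub>c = b \<partial>\<^sub>c\<close>, and \<open>\<kappa> = b\<^sup>3\<close>. As the factors of \<open>b\<close> are accounted for,
  \<open>b\<close> need not be constant near \<open>p\<close>.
\<close>

lemma local_frame:
  "\<exists>(I :: 'e option set) x E \<kappa>. finite I \<and> \<kappa> \<in> smooth_funs M \<and> \<kappa> p = 1
    \<and> (\<forall>i. x i \<in> smooth_funs M) \<and> (\<forall>i. E i \<in> vector_fields M)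
    \<and> (\<forall>q. \<forall>v\<in>tangent M q. \<kappa> q *\<^sub>R v = (\<Sum>i\<in>I. v (x i) *\<^sub>R E i q))"
proof -
  obtain U \<phi> where U: "(U, \<phi>) \<in> M" "p \<in> U" using ex_chart by blast
  note cU = is_chartD[OF is_chart[OF U(1)]]
  let ?a = "\<phi> p"
  obtain R where R: "R > 0" "ball ?a R \<subseteq> \<phi> ` U"
    using cU(2) U(2) open_contains_ball by (metis imageI)
  let ?W = "ball ?a R"
  have Wr: "cball ?a (R/2) \<subseteq> ?W" using R(1) by auto
  \<comment> \<open>Half the radius keeps the closed support inside the open ball on which the chart
    expressions are smooth.\<close>
  obtain b :: "'e \<Rightarrow> real" where b: "smooth_on UNIV b" "b ?a = 1"
      "\<And>y. b y \<noteq> 0 \<longleftrightarrow> y \<in> ball ?a (R/2)"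
    using smooth_bump[of "R/2" ?a] R(1) by auto
  have bW: "b y \<noteq> 0 \<Longrightarrow> y \<in> ?W" for y using b(3) R(1) by auto
  define ext where "ext = (\<lambda>g q. if q \<in> U then b (\<phi> q) * g (\<phi> q) else 0)"
  have ext: "ext g \<in> smooth_funs M" if "smooth_on ?W g" for g
    unfolding ext_def
    by (rule smooth_funs_extend[OF U(1) open_ball R(2) Wr b(1) _ that]) (use b(3) in auto)
  have fW: "smooth_on ?W (f \<circ> inv_into U \<phi>)" if "f \<in> smooth_funs M" for f
    using that U(1) by (auto simp: smooth_funs_def intro: smooth_on_subset[OF _ R(2)])
  define u0 where "u0 = ext (\<lambda>y. 1)"
  define u where "u = (\<lambda>c. ext (\<lambda>y. inner y c))"
  define D where "D = (\<lambda>c q f. if f \<in> smooth_funs M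
      then ext (\<lambda>y. frechet_derivative (f \<circ> inv_into U \<phi>) (at y) c) q else 0)"
  have u0: "u0 \<in> smooth_funs M" unfolding u0_def by (rule ext[OF smooth_on_const])
  have u: "u c \<in> smooth_funs M" for c
    unfolding u_def by (rule ext[OF smooth_on_bounded_linear[OF open_ball bounded_linear_inner_left]])
  have D: "D c \<in> vector_fields M" for c
  proof (rule vfI)
    show "(\<lambda>q. D c q f) \<in> smooth_funs M" if "f \<in> smooth_funs M" for f
      using ext[OF smooth_on_frechet_derivative[OF fW[OF that]]] that by (simp add: D_def)
    show "D c q \<in> tangent M q" for q
    proof (cases "q \<in> U \<and> b (\<phi> q) \<noteq> 0")
      case False
      then have "D c q = 0" by (auto simp: D_def ext_def fun_eq_iff)
      then show ?thesis using tangent_zero by simp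
    next
      case True
      let ?y = "\<phi> q"
      have inv: "inv_into U \<phi> ?y = q" using True by (simp add: inv_into_f_f[OF cU(3)])
      have d: "((f \<circ> inv_into U \<phi>) has_derivative frechet_derivative (f \<circ> inv_into U \<phi>) (at ?y)) (at ?y)"
        if "f \<in> smooth_funs M" for f
        using smooth_on_has_derivative[OF fW[OF that]] bW True by blast
      have Dq: "D c q f = b ?y * d' c" if "f \<in> smooth_funs M" "((f \<circ> inv_into U \<phi>) has_derivative d') (at ?y)"
        for f d'
        using that True frechet_derivative_at by (fastforce simp: D_def ext_def)
      show ?thesis
      proof (rule tangentI)
        fix f g assume f: "f \<in> smooth_funs M" and g: "g \<in> smooth_funs M"
        show "D c q (\<lambda>x. f x + g x) = D c q f + D c q g"
          using Dq[OF smooth_funs_add[OF f g]] has_derivative_add[OF d[OF f] d[OF g]]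
            Dq[OF f d[OF f]] Dq[OF g d[OF g]] by (simp add: o_def algebra_simps)
        show "D c q (\<lambda>x. f x * g x) = D c q f * g q + f q * D c q g"
          using Dq[OF smooth_funs_mult[OF f g]] has_derivative_mult[OF d[OF f] d[OF g]]
            Dq[OF f d[OF f]] Dq[OF g d[OF g]] inv by (simp add: o_def algebra_simps)
      next
        fix f k assume f: "f \<in> smooth_funs M"
        have "((\<lambda>x. k * f x) \<circ> inv_into U \<phi> has_derivative
            (\<lambda>w. k * frechet_derivative (f \<circ> inv_into U \<phi>) (at ?y) w)) (at ?y)"
          using has_derivative_mult_right[OF d[OF f], of k] by (simp add: o_def)
        from Dq[OF smooth_funs_mult[OF smooth_funs_const f] this]
        show "D c q (\<lambda>x. k * f x) = k * D c q f"
          using Dq[OF f d[OF f]] by simp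
      qed (simp add: D_def)
    qed
  qed
  have key: "u0 q ^ 3 * v f = (\<Sum>c\<in>onb. v (u c) * (u0 q * D c q f)) - v u0 * (\<Sum>c\<in>onb. u c q * D c q f)"
    if v: "v \<in> tangent M q" and f: "f \<in> smooth_funs M" for q v f
  proof (cases "q \<in> U \<and> b (\<phi> q) \<noteq> 0")
    case False
    then have "u0 q = 0" "\<And>c. D c q f = 0" by (auto simp: u0_def ext_def D_def)
    then show ?thesis by simp
  next
    case True
    let ?y = "\<phi> q"
    obtain g where g: "\<And>c. smooth_on ?W (g c)"
        "\<And>c. g c ?y = frechet_derivative (f \<circ> inv_into U \<phi>) (at ?y) c"
        "\<And>x. x \<in> ?W \<Longrightarrow> (f \<circ> inv_into U \<phi>) x
            = (f \<circ> inv_into U \<phi>) ?y + (\<Sum>c\<in>onb. inner (x - ?y) c * g c x)"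
      using Hadamard[OF _ fW[OF f], of ?y] bW True by blast
    \<comment> \<open>Hadamard's formula times b^2: one factor extends the coordinate differences to
      the whole manifold, the other the coefficients \<open>g c\<close>. Applying \<open>v\<close>
      by the Leibniz rule leaves u0(q)^2 v(f) on the left, since f - f(q) vanishes at q, and on the
      right the terms with \<open>g c\<close> undifferentiated, since the coordinate differences
      vanish at q.\<close>
    have "u0 x * (u0 x * (f x - f q)) = (\<Sum>c\<in>onb. (u c x - inner ?y c * u0 x) * ext (g c) x)" for x
    proof (cases "x \<in> U \<and> b (\<phi> x) \<noteq> 0")
      case False
      then show ?thesis by (auto simp: u0_def ext_def)
    next
      case x: True
      then have "f x - f q = (\<Sum>c\<in>onb. inner (\<phi> x - ?y) c * g c (\<phi> x))"
        using g(3)[of "\<phi> x"] bW True by (simp add: inv_into_f_f[OF cU(3)])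
      then show ?thesis
        using x by (simp add: u0_def u_def ext_def sum_distrib_left inner_diff_left algebra_simps)
    qed
    then have "v (\<lambda>x. u0 x * (u0 x * (f x - f q)))
        = v (\<lambda>x. \<Sum>c\<in>onb. (u c x - inner ?y c * u0 x) * ext (g c) x)"
      by presburger
    moreover have "v (\<lambda>x. u0 x * (u0 x * (f x - f q))) = u0 q * (u0 q * v f)"
      using u0 f by (simp add: tangent_mult[OF v] tangent_diff[OF v] tangent_const[OF v]
          smooth_funs_intros)
    moreover have "v (\<lambda>x. \<Sum>c\<in>onb. (u c x - inner ?y c * u0 x) * ext (g c) x)
        = (\<Sum>c\<in>onb. (v (u c) - inner ?y c * v u0) * D c q f)"
    proof -
      have "u c q - inner ?y c * u0 q = 0" "ext (g c) q = D c q f" for c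
        using True f by (simp_all add: u_def u0_def ext_def D_def g(2))
      then show ?thesis
        using u u0 ext[OF g(1)]
        by (simp add: tangent_sum[OF v] tangent_mult[OF v] tangent_diff[OF v] tangent_const[OF v]
          smooth_funs_intros)
    qed
    ultimately have "u0 q * (u0 q * v f) = (\<Sum>c\<in>onb. (v (u c) - inner ?y c * v u0) * D c q f)"
      by simp
    \<comment> \<open>The third factor u0(q) turns the coordinates of the varying point q, defined
      in the chart only, into the global smooth functions \<open>u c\<close>; hence the
      cube.\<close>
    then have "u0 q * (u0 q * (u0 q * v f)) = u0 q * (\<Sum>c\<in>onb. (v (u c) - inner ?y c * v u0) * D c q f)"
      by simp
    also have "\<dots> = (\<Sum>c\<in>onb. v (u c) * (u0 q * D c q f)) - v u0 * (\<Sum>c\<in>onb. (u0 q * inner ?y c) * D c q f)"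
      by (simp add: sum_distrib_left sum_subtractf[symmetric] algebra_simps)
    also have "(\<Sum>c\<in>onb. (u0 q * inner ?y c) * D c q f) = (\<Sum>c\<in>onb. u c q * D c q f)"
      using True by (simp add: u0_def u_def ext_def)
    finally show ?thesis by (simp add: power3_eq_cube mult.assoc)
  qed
  \<comment> \<open>The additional index \<open>None\<close> carries the terms with
    \<open>v u0\<close>, which arise because \<open>v\<close> differentiates the cut-off factor of
    the coordinates as well.\<close>
  let ?I = "insert None (Some ` onb) :: 'e option set"
  let ?x = "\<lambda>i. case i of None \<Rightarrow> u0 | Some c \<Rightarrow> u c"
  let ?E = "\<lambda>i. case i of None \<Rightarrow> (\<lambda>q. \<Sum>c\<in>onb. (- u c q) *\<^sub>R D c q) | Some c \<Rightarrow> (\<lambda>q. u0 q *\<^sub>R D c q)"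
  have x: "?x i \<in> smooth_funs M" for i using u u0 by (cases i) auto
  have E: "?E i \<in> vector_fields M" for i
    by (cases i; simp only: option.case) (intro vf_sum vf_mult smooth_funs_uminus u u0 D)+
  have \<kappa>: "(\<lambda>q. u0 q ^ 3) \<in> smooth_funs M"
    unfolding power3_eq_cube by (intro smooth_funs_mult u0)
  have \<kappa>p: "u0 p ^ 3 = 1"
    using U(2) b(2) by (simp add: u0_def ext_def)
  have fr: "u0 q ^ 3 *\<^sub>R v = (\<Sum>i\<in>?I. v (?x i) *\<^sub>R ?E i q)" if v: "v \<in> tangent M q" for q v
  proof (rule tangent_eqI[where p=q])
    show "u0 q ^ 3 *\<^sub>R v \<in> tangent M q" using v by (rule tangent_scaleR)
    show "(\<Sum>i\<in>?I. v (?x i) *\<^sub>R ?E i q) \<in> tangent M q"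
      using E by (intro tangent_sum_closed tangent_scaleR vf_tangent)
    fix f assume f: "f \<in> smooth_funs M"
    show "(u0 q ^ 3 *\<^sub>R v) f = (\<Sum>i\<in>?I. v (?x i) *\<^sub>R ?E i q) f"
      using key[OF v f]
      by (simp add: finite_onb sum_fun_apply sum.reindex sum_negf sum_distrib_left mult.assoc)
  qed
  show ?thesis
    by (rule exI[of _ ?I], rule exI[of _ ?x], rule exI[of _ ?E], rule exI[of _ "\<lambda>q. u0 q ^ 3"],
        intro conjI allI ballI)
       (simp add: finite_onb, fact \<kappa>, fact \<kappa>p, fact x, fact E, erule fr)
qed

end

section \<open>Tensor calculus\<close>


context charted begin

context
  fixes p \<alpha> assumes \<alpha>: "\<alpha> \<in> cotangent M p"
begin

lemma cot_add: "u \<in> tangent M p \<Longrightarrow> v \<in> tangent M p \<Longrightarrow> \<alpha> (u + v) = \<alpha> u + \<alpha> v"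
  using \<alpha> by (simp add: cotangent_def lin_maps_def)

lemma cot_scaleR: "v \<in> tangent M p \<Longrightarrow> \<alpha> (c *\<^sub>R v) = c * \<alpha> v"
  using \<alpha> by (simp add: cotangent_def lin_maps_def)

lemma cot_outside: "v \<notin> tangent M p \<Longrightarrow> \<alpha> v = 0"
  using \<alpha> by (simp add: cotangent_def lin_maps_def)

lemma cot_zero: "\<alpha> 0 = 0"
  using cot_scaleR[OF tangent_zero, of 0] by simp

lemma cot_minus: "v \<in> tangent M p \<Longrightarrow> \<alpha> (- v) = - \<alpha> v"
  using cot_scaleR[of v "-1"] by simp

lemma cot_diff: "u \<in> tangent M p \<Longrightarrow> v \<in> tangent M p \<Longrightarrow> \<alpha> (u - v) = \<alpha> u - \<alpha> v"
  using cot_add[OF _ tangent_minus, of u v] cot_minus[of v] by simp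

lemma cot_sum: "(\<And>i. i \<in> I \<Longrightarrow> v i \<in> tangent M p) \<Longrightarrow> \<alpha> (\<Sum>i\<in>I. v i) = (\<Sum>i\<in>I. \<alpha> (v i))"
  by (induction I rule: infinite_finite_induct) (simp_all add: cot_zero cot_add tangent_sum_closed)

end

lemmas cot_simps = cot_add cot_scaleR cot_zero cot_minus cot_diff cot_sum

lemma cotI:
  assumes "\<And>v. v \<notin> tangent M p \<Longrightarrow> \<alpha> v = 0"
    and "\<And>u v. u \<in> tangent M p \<Longrightarrow> v \<in> tangent M p \<Longrightarrow> \<alpha> (u + v) = \<alpha> u + \<alpha> v"
    and "\<And>c v. v \<in> tangent M p \<Longrightarrow> \<alpha> (c *\<^sub>R v) = c * \<alpha> v"
  shows "\<alpha> \<in> cotangent M p"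
  using assms by (simp add: cotangent_def lin_maps_def)

lemma cot_eqI:
  assumes "\<alpha> \<in> cotangent M p" "\<beta> \<in> cotangent M p" "\<And>v. v \<in> tangent M p \<Longrightarrow> \<alpha> v = \<beta> v"
  shows "\<alpha> = \<beta>"
  using assms cot_outside by (metis ext)

lemma cotangent_zero: "0 \<in> cotangent M p"
  by (rule cotI) auto

lemma cotangent_plus: "\<alpha> \<in> cotangent M p \<Longrightarrow> \<beta> \<in> cotangent M p \<Longrightarrow> \<alpha> + \<beta> \<in> cotangent M p"
  by (rule cotI) (simp_all add: cot_simps cot_outside algebra_simps)

lemma cotangent_scaleR: "\<alpha> \<in> cotangent M p \<Longrightarrow> c *\<^sub>R \<alpha> \<in> cotangent M p"
  by (rule cotI) (simp_all add: cot_simps cot_outside algebra_simps)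

lemma cotangent_minus: "\<alpha> \<in> cotangent M p \<Longrightarrow> - \<alpha> \<in> cotangent M p"
  using cotangent_scaleR[of \<alpha> p "-1"] by simp

lemma cotangent_diff: "\<alpha> \<in> cotangent M p \<Longrightarrow> \<beta> \<in> cotangent M p \<Longrightarrow> \<alpha> - \<beta> \<in> cotangent M p"
  using cotangent_plus[OF _ cotangent_minus, of \<alpha> p \<beta>] by simp

lemma cotangent_sum_closed: "(\<And>i. i \<in> I \<Longrightarrow> \<alpha> i \<in> cotangent M p) \<Longrightarrow> (\<Sum>i\<in>I. \<alpha> i) \<in> cotangent M p"
  by (induction I rule: infinite_finite_induct) (auto intro: cotangent_zero cotangent_plus)

lemma dif_cotangent: "dif M f p \<in> cotangent M p"
  by (rule cotI) (simp_all add: dif_def tangent_plus tangent_scaleR)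

lemmas cotangent_intros = cotangent_zero cotangent_plus cotangent_scaleR cotangent_minus
  cotangent_diff cotangent_sum_closed dif_cotangent

end

context smooth_mfd begin

lemma dif_apply: "v \<in> tangent M p \<Longrightarrow> dif M f p v = v f"
  by (simp add: dif_def)

lemma of_cotangent: "\<alpha> \<in> one_forms M \<Longrightarrow> \<alpha> p \<in> cotangent M p"
  by (simp add: one_forms_def)

lemma of_smooth: "\<alpha> \<in> one_forms M \<Longrightarrow> X \<in> vector_fields M \<Longrightarrow> (\<lambda>p. \<alpha> p (X p)) \<in> smooth_funs M"
  unfolding one_forms_def by blast

lemma ofI:
  "(\<And>p. \<alpha> p \<in> cotangent M p) \<Longrightarrow> (\<And>X. X \<in> vector_fields M \<Longrightarrow> (\<lambda>p. \<alpha> p (X p)) \<in> smooth_funs M)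
    \<Longrightarrow> \<alpha> \<in> one_forms M"
  by (simp add: one_forms_def)

lemma of_zero: "(\<lambda>p. 0) \<in> one_forms M"
  by (rule ofI) (auto intro: cotangent_intros smooth_funs_intros)

lemma of_add: "\<alpha> \<in> one_forms M \<Longrightarrow> \<beta> \<in> one_forms M \<Longrightarrow> (\<lambda>p. \<alpha> p + \<beta> p) \<in> one_forms M"
  by (rule ofI) (simp_all add: cotangent_plus of_cotangent smooth_funs_add of_smooth[of \<alpha>] of_smooth[of \<beta>])

lemma of_minus: "\<alpha> \<in> one_forms M \<Longrightarrow> (\<lambda>p. - \<alpha> p) \<in> one_forms M"
  by (rule ofI) (simp_all add: cotangent_minus of_cotangent smooth_funs_uminus of_smooth[of \<alpha>])

lemma of_mult: "f \<in> smooth_funs M \<Longrightarrow> \<alpha> \<in> one_forms M \<Longrightarrow> (\<lambda>p. f p *\<^sub>R \<alpha> p) \<in> one_forms M"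
  by (rule ofI) (simp_all add: cotangent_scaleR of_cotangent smooth_funs_mult of_smooth[of \<alpha>])

lemma of_sum: "(\<And>i. i \<in> I \<Longrightarrow> \<alpha> i \<in> one_forms M) \<Longrightarrow> (\<lambda>p. \<Sum>i\<in>I. \<alpha> i p) \<in> one_forms M"
  by (induction I rule: infinite_finite_induct) (auto intro: of_zero of_add)

lemma of_dif: "f \<in> smooth_funs M \<Longrightarrow> dif M f \<in> one_forms M"
  by (rule ofI) (simp_all add: dif_cotangent dif_apply vf_tangent vf_smooth)

section \<open>Extension of tangent vectors and covectors, and tensoriality\<close>

text \<open>The frame expansion of \<open>v\<close> with its coefficients kept constant is a vector
  field, and \<kappa> = 1 at \<open>p\<close> makes its value there equal to
  \<open>v\<close>.\<close>

lemma vf_extend: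
  assumes "v \<in> tangent M p" shows "\<exists>Y\<in>vector_fields M. Y p = v"
proof -
  obtain I :: "'e option set" and x E \<kappa> where F: "\<kappa> p = 1" "\<And>i. E i \<in> vector_fields M"
    "\<And>q v. v \<in> tangent M q \<Longrightarrow> \<kappa> q *\<^sub>R v = (\<Sum>i\<in>I. v (x i) *\<^sub>R E i q)"
    using local_frame[of p] by blast
  have "(\<lambda>q. \<Sum>i\<in>I. v (x i) *\<^sub>R E i q) \<in> vector_fields M"
    by (intro vf_sum vf_mult smooth_funs_const F)
  then show ?thesis using F(1) F(3)[OF assms] by (intro bexI) auto
qed

text \<open>At \<open>p\<close> one has \<alpha> = \<Sum> \<alpha>(E i) d(x i), which is the
  differential of the function with the same constant coefficients.\<close>

lemma cot_exact:
  assumes "\<alpha> \<in> cotangent M p" shows "\<exists>f\<in>smooth_funs M. dif M f p = \<alpha>"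
proof -
  obtain I :: "'e option set" and x E \<kappa> where F: "\<kappa> p = 1" "\<And>i. x i \<in> smooth_funs M"
    "\<And>i. E i \<in> vector_fields M"
    "\<And>q v. v \<in> tangent M q \<Longrightarrow> \<kappa> q *\<^sub>R v = (\<Sum>i\<in>I. v (x i) *\<^sub>R E i q)"
    using local_frame[of p] by blast
  let ?f = "\<lambda>y. \<Sum>i\<in>I. \<alpha> (E i p) * x i y"
  have f: "?f \<in> smooth_funs M" by (intro smooth_funs_intros F)
  have "dif M ?f p = \<alpha>"
  proof (rule cot_eqI[OF dif_cotangent assms])
    fix v assume v: "v \<in> tangent M p"
    have "\<alpha> v = \<alpha> (\<Sum>i\<in>I. v (x i) *\<^sub>R E i p)" using F(4)[OF v] F(1) by simp
    also have "\<dots> = (\<Sum>i\<in>I. v (x i) * \<alpha> (E i p))"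
      using assms F(3) by (simp add: cot_simps vf_tangent tangent_scaleR)
    also have "\<dots> = v ?f"
      using F(2) by (simp add: tangent_sum[OF v] tangent_cmult[OF v] smooth_funs_intros) (simp add: mult.commute)
    finally show "dif M ?f p v = \<alpha> v" by (simp add: dif_apply v)
  qed
  then show ?thesis using f by blast
qed

text \<open>Since \<kappa> = 1 at \<open>p\<close>, \<open>F X\<close> equals \<open>F\<close> of
  \<kappa> X. The frame expansion of \<kappa> X has smooth global coefficients, so
  \<open>F X\<close> becomes \<Sum> X(x i)(p) F(E i), in which only the value \<open>X p\<close>
  occurs.\<close>

lemma vf_tensorial:
  fixes F :: "('a \<Rightarrow> 'a tvec) \<Rightarrow> real"
  assumes add: "\<And>X Y. X \<in> vector_fields M \<Longrightarrow> Y \<in> vector_fields M \<Longrightarrow> F (\<lambda>q. X q + Y q) = F X + F Y"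
    and mult: "\<And>f X. f \<in> smooth_funs M \<Longrightarrow> X \<in> vector_fields M \<Longrightarrow> F (\<lambda>q. f q *\<^sub>R X q) = f p * F X"
    and X: "X \<in> vector_fields M" and Y: "Y \<in> vector_fields M" and XY: "X p = Y p"
  shows "F X = F Y"
proof -
  obtain I :: "'e option set" and x E \<kappa> where F: "finite I" "\<kappa> \<in> smooth_funs M" "\<kappa> p = 1"
    "\<And>i. x i \<in> smooth_funs M" "\<And>i. E i \<in> vector_fields M"
    "\<And>q v. v \<in> tangent M q \<Longrightarrow> \<kappa> q *\<^sub>R v = (\<Sum>i\<in>I. v (x i) *\<^sub>R E i q)"
    using local_frame[of p] by blast
  have zero: "F (\<lambda>q. 0) = 0"
    using mult[OF smooth_funs_const vf_zero, of 0] by simp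
  have "F X = (\<Sum>i\<in>I. X p (x i) * F (E i))" if X: "X \<in> vector_fields M" for X
  proof -
    have "F X = F (\<lambda>q. \<kappa> q *\<^sub>R X q)" using mult[OF F(2) X] F(3) by simp
    also have "\<dots> = F (\<lambda>q. \<Sum>i\<in>I. X q (x i) *\<^sub>R E i q)" using F(6) vf_tangent[OF X] by simp
    also have "\<dots> = (\<Sum>i\<in>I. F (\<lambda>q. X q (x i) *\<^sub>R E i q))"
      using F(1)
    proof (induction I)
      case (insert i I)
      have "F (\<lambda>q. X q (x i) *\<^sub>R E i q + (\<Sum>i\<in>I. X q (x i) *\<^sub>R E i q))
          = F (\<lambda>q. X q (x i) *\<^sub>R E i q) + F (\<lambda>q. \<Sum>i\<in>I. X q (x i) *\<^sub>R E i q)"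
        by (rule add) (intro vf_sum vf_mult vf_smooth[OF X] F)+
      then show ?case by (simp only: sum.insert[OF insert.hyps] insert.IH)
    qed (simp only: sum.empty zero)
    also have "\<dots> = (\<Sum>i\<in>I. X p (x i) * F (E i))"
      by (simp add: mult[OF vf_smooth[OF X F(4)] F(5)])
    finally show ?thesis .
  qed
  from this[OF X] this[OF Y] show ?thesis by (simp add: XY)
qed

text \<open>The same argument with the dual expansion \<kappa> \<alpha> = \<Sum> \<alpha>(E i) d(x
  i).\<close>

lemma of_tensorial:
  fixes F :: "('a \<Rightarrow> 'a covec) \<Rightarrow> real"
  assumes add: "\<And>\<alpha> \<beta>. \<alpha> \<in> one_forms M \<Longrightarrow> \<beta> \<in> one_forms M \<Longrightarrow> F (\<lambda>q. \<alpha> q + \<beta> q) = F \<alpha> + F \<beta>"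
    and mult: "\<And>f \<alpha>. f \<in> smooth_funs M \<Longrightarrow> \<alpha> \<in> one_forms M \<Longrightarrow> F (\<lambda>q. f q *\<^sub>R \<alpha> q) = f p * F \<alpha>"
    and \<alpha>: "\<alpha> \<in> one_forms M" and \<beta>: "\<beta> \<in> one_forms M" and \<alpha>\<beta>: "\<alpha> p = \<beta> p"
  shows "F \<alpha> = F \<beta>"
proof -
  obtain I :: "'e option set" and x E \<kappa> where F: "finite I" "\<kappa> \<in> smooth_funs M" "\<kappa> p = 1"
    "\<And>i. x i \<in> smooth_funs M" "\<And>i. E i \<in> vector_fields M"
    "\<And>q v. v \<in> tangent M q \<Longrightarrow> \<kappa> q *\<^sub>R v = (\<Sum>i\<in>I. v (x i) *\<^sub>R E i q)"
    using local_frame[of p] by blast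
  have zero: "F (\<lambda>q. 0) = 0"
    using mult[OF smooth_funs_const of_zero, of 0] by simp
  have "F \<alpha> = (\<Sum>i\<in>I. \<alpha> p (E i p) * F (dif M (x i)))" if \<alpha>: "\<alpha> \<in> one_forms M" for \<alpha>
  proof -
    have "\<kappa> q *\<^sub>R \<alpha> q = (\<Sum>i\<in>I. \<alpha> q (E i q) *\<^sub>R dif M (x i) q)" for q
    proof (rule cot_eqI[where p=q])
      show "\<kappa> q *\<^sub>R \<alpha> q \<in> cotangent M q" "(\<Sum>i\<in>I. \<alpha> q (E i q) *\<^sub>R dif M (x i) q) \<in> cotangent M q"
        by (intro cotangent_intros of_cotangent \<alpha>)+
      fix v assume v: "v \<in> tangent M q"
      have "\<kappa> q * \<alpha> q v = \<alpha> q (\<kappa> q *\<^sub>R v)"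
        by (simp add: cot_simps[OF of_cotangent[OF \<alpha>]] v)
      also have "\<dots> = (\<Sum>i\<in>I. v (x i) * \<alpha> q (E i q))"
        unfolding F(6)[OF v]
        by (simp add: cot_simps[OF of_cotangent[OF \<alpha>]] vf_tangent F(5) tangent_scaleR)
      finally show "(\<kappa> q *\<^sub>R \<alpha> q) v = (\<Sum>i\<in>I. \<alpha> q (E i q) *\<^sub>R dif M (x i) q) v"
        by (simp add: sum_fun_apply dif_apply v mult.commute)
    qed
    then have "F \<alpha> = F (\<lambda>q. \<Sum>i\<in>I. \<alpha> q (E i q) *\<^sub>R dif M (x i) q)"
      using mult[OF F(2) \<alpha>] F(3) by simp
    also have "\<dots> = (\<Sum>i\<in>I. F (\<lambda>q. \<alpha> q (E i q) *\<^sub>R dif M (x i) q))"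
      using F(1)
    proof (induction I)
      case (insert i I)
      have "F (\<lambda>q. \<alpha> q (E i q) *\<^sub>R dif M (x i) q + (\<Sum>i\<in>I. \<alpha> q (E i q) *\<^sub>R dif M (x i) q))
          = F (\<lambda>q. \<alpha> q (E i q) *\<^sub>R dif M (x i) q) + F (\<lambda>q. \<Sum>i\<in>I. \<alpha> q (E i q) *\<^sub>R dif M (x i) q)"
        by (rule add) (intro of_sum of_mult of_smooth[OF \<alpha>] of_dif F)+
      then show ?case by (simp only: sum.insert[OF insert.hyps] insert.IH)
    qed (simp only: sum.empty zero)
    also have "\<dots> = (\<Sum>i\<in>I. \<alpha> p (E i p) * F (dif M (x i)))"
      by (simp add: mult[OF of_smooth[OF \<alpha> F(5)] of_dif[OF F(4)]])
    finally show ?thesis .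
  qed
  from this[OF \<alpha>] this[OF \<beta>] show ?thesis by (simp add: \<alpha>\<beta>)
qed

section \<open>Lie brackets and Lie derivatives\<close>

lemma lb_apply: "lie_bracket X Y p f = X p (\<lambda>q. Y q f) - Y p (\<lambda>q. X q f)"
  by (simp add: lie_bracket_def)

text \<open>In the Leibniz rule for a product of functions the mixed terms, with one derivative on
  each factor, are symmetric in \<open>X\<close> and \<open>Y\<close> and cancel.\<close>

lemma lb_vf:
  assumes X: "X \<in> vector_fields M" and Y: "Y \<in> vector_fields M"
  shows "lie_bracket X Y \<in> vector_fields M"
proof (rule vfI)
  note t = vf_tangent[OF X] vf_tangent[OF Y] and s = vf_smooth[OF X] vf_smooth[OF Y]
  show "(\<lambda>p. lie_bracket X Y p f) \<in> smooth_funs M" if "f \<in> smooth_funs M" for f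
    using that by (simp add: lb_apply smooth_funs_intros s)
  show "lie_bracket X Y p \<in> tangent M p" for p
    by (rule tangentI)
       (simp_all add: lb_apply tangent_outside[OF t(1)] tangent_outside[OF t(2)]
        tangent_add[OF t(1)] tangent_add[OF t(2)] tangent_cmult[OF t(1)] tangent_cmult[OF t(2)]
        tangent_mult[OF t(1)] tangent_mult[OF t(2)] tangent_const[OF t(1)] tangent_const[OF t(2)]
        s smooth_funs_intros algebra_simps)
qed

lemmas lb_tangent = vf_tangent[OF lb_vf]

lemma lb_skew: "lie_bracket Y X p = - lie_bracket X Y p"
  by (simp add: fun_eq_iff lb_apply)

lemma lb_add_right:
  assumes "X \<in> vector_fields M" "Y \<in> vector_fields M" "Z \<in> vector_fields M"
  shows "lie_bracket X (\<lambda>q. Y q + Z q) p = lie_bracket X Y p + lie_bracket X Z p"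
  by (rule tangent_eqI[where p=p])
     (use assms in \<open>simp_all add: lb_tangent vf_add tangent_plus lb_apply
        tangent_add[OF vf_tangent[OF assms(1)]] vf_smooth\<close>)

lemma lb_add_left:
  assumes "X \<in> vector_fields M" "Y \<in> vector_fields M" "Z \<in> vector_fields M"
  shows "lie_bracket (\<lambda>q. Y q + Z q) X p = lie_bracket Y X p + lie_bracket Z X p"
  using lb_add_right[OF assms, of p] lb_skew[of _ X p] by simp

lemma lb_mult_right:
  assumes "X \<in> vector_fields M" "Y \<in> vector_fields M" "f \<in> smooth_funs M"
  shows "lie_bracket X (\<lambda>q. f q *\<^sub>R Y q) p = (X p f) *\<^sub>R Y p + f p *\<^sub>R lie_bracket X Y p"
proof (rule tangent_eqI[where p=p])
  show "lie_bracket X (\<lambda>q. f q *\<^sub>R Y q) p \<in> tangent M p"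
    by (intro lb_tangent vf_mult assms)
  show "(X p f) *\<^sub>R Y p + f p *\<^sub>R lie_bracket X Y p \<in> tangent M p"
    by (intro tangent_plus tangent_scaleR lb_tangent vf_tangent[OF assms(2)] assms)
qed (use assms in \<open>simp add: lb_apply tangent_mult[OF vf_tangent[OF assms(1)]] vf_smooth algebra_simps\<close>)

lemma lb_zero: "X \<in> vector_fields M \<Longrightarrow> lie_bracket X (\<lambda>q. 0) p = 0"
  by (simp add: fun_eq_iff lb_apply tangent_const[OF vf_tangent])

lemma lb_zero': "X \<in> vector_fields M \<Longrightarrow> lie_bracket (\<lambda>q. 0) X p = 0"
  by (simp add: lb_skew[of _ X] lb_zero)

lemma lb_mult_left:
  assumes "X \<in> vector_fields M" "Y \<in> vector_fields M" "f \<in> smooth_funs M"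
  shows "lie_bracket (\<lambda>q. f q *\<^sub>R Y q) X p = - (X p f) *\<^sub>R Y p + f p *\<^sub>R lie_bracket Y X p"
  using lb_mult_right[OF assms, of p] by (simp add: lb_skew[of _ X])

text \<open>If \<open>Y\<close> is multiplied by f, both terms of the formula acquire (X f)
  \<beta>(Y), and the difference does not. So the formula depends on \<open>Y p\<close> only, and
  the definite description in \<open>lie_form\<close> has exactly this value.\<close>

lemma lie_form_apply:
  assumes X: "X \<in> vector_fields M" and \<beta>: "\<beta> \<in> one_forms M" and Y: "Y \<in> vector_fields M"
  shows "lie_form M X \<beta> p (Y p) = X p (\<lambda>q. \<beta> q (Y q)) - \<beta> p (lie_bracket X Y p)"
proof -
  let ?F = "\<lambda>Y. X p (\<lambda>q. \<beta> q (Y q)) - \<beta> p (lie_bracket X Y p)"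
  note cs = cot_simps[OF of_cotangent[OF \<beta>]] and Xp = vf_tangent[OF X, of p]
  have eq: "?F Y = ?F Z" if Z: "Z \<in> vector_fields M" "Z p = Y p" for Z
  proof (rule vf_tensorial[where F="?F" and p=p])
    fix Y Z assume Y: "Y \<in> vector_fields M" and Z: "Z \<in> vector_fields M"
    show "?F (\<lambda>q. Y q + Z q) = ?F Y + ?F Z"
      by (simp add: cs vf_tangent[OF Y] vf_tangent[OF Z] lb_tangent X Y Z lb_add_right tangent_add[OF Xp]
          of_smooth[OF \<beta> Y] of_smooth[OF \<beta> Z])
  next
    fix f Y assume f: "f \<in> smooth_funs M" and Y: "Y \<in> vector_fields M"
    show "?F (\<lambda>q. f q *\<^sub>R Y q) = f p * ?F Y"
      by (simp add: cs vf_tangent[OF Y] lb_tangent X Y f lb_mult_right tangent_mult[OF Xp]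
          of_smooth[OF \<beta> Y] tangent_scaleR algebra_simps)
  qed (use Y Z in simp_all)
  have "(THE c. \<forall>Z\<in>vector_fields M. Z p = Y p \<longrightarrow> c = ?F Z) = ?F Y"
  proof (rule the_equality)
    show "\<forall>Z\<in>vector_fields M. Z p = Y p \<longrightarrow> ?F Y = ?F Z"
      by (intro ballI impI eq)
  qed (erule bspec[OF _ Y, THEN mp, OF _ refl])
  then show ?thesis unfolding lie_form_def if_P[OF vf_tangent[OF Y]] .
qed

text \<open>Values on tangent vectors are known through vector fields only; linearity at a point is
  therefore checked after extending the vectors.\<close>

lemma lie_form_of:
  assumes X: "X \<in> vector_fields M" and \<beta>: "\<beta> \<in> one_forms M"
  shows "lie_form M X \<beta> \<in> one_forms M"
proof (rule ofI)
  note cs = cot_simps[OF of_cotangent[OF \<beta>]] 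
  show "(\<lambda>p. lie_form M X \<beta> p (Y p)) \<in> smooth_funs M" if "Y \<in> vector_fields M" for Y
    using that X \<beta> by (simp add: lie_form_apply smooth_funs_intros of_smooth[OF \<beta>] vf_smooth lb_vf)
  fix p
  note Xp = vf_tangent[OF X, of p]
  show "lie_form M X \<beta> p \<in> cotangent M p"
  proof (rule cotI)
    show "lie_form M X \<beta> p v = 0" if "v \<notin> tangent M p" for v
      using that by (simp add: lie_form_def)
  next
    fix u v assume "u \<in> tangent M p" "v \<in> tangent M p"
    then obtain Y Z where "Y \<in> vector_fields M" "Y p = u" "Z \<in> vector_fields M" "Z p = v"
      using vf_extend by blast
    then show "lie_form M X \<beta> p (u + v) = lie_form M X \<beta> p u + lie_form M X \<beta> p v"
      using lie_form_apply[OF X \<beta> vf_add[of Y Z], of p] lie_form_apply[OF X \<beta>, of _ p] X \<beta>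
      by (auto simp: cs vf_tangent lb_tangent lb_add_right tangent_add[OF Xp] of_smooth[OF \<beta>])
  next
    fix c v assume "v \<in> tangent M p"
    then obtain Y where Y: "Y \<in> vector_fields M" "Y p = v"
      using vf_extend by blast
    have "lie_form M X \<beta> p (c *\<^sub>R Y p) = c * (X p (\<lambda>q. \<beta> q (Y q)) - \<beta> p (lie_bracket X Y p))"
      using lie_form_apply[OF X \<beta> vf_mult[OF smooth_funs_const Y(1), of c], of p] X \<beta> Y
      by (simp add: cs vf_tangent lb_tangent lb_mult_right smooth_funs_const tangent_cmult[OF Xp]
          of_smooth[OF \<beta>] tangent_const[OF Xp] algebra_simps)
    then show "lie_form M X \<beta> p (c *\<^sub>R v) = c * lie_form M X \<beta> p v"
      using lie_form_apply[OF X \<beta> Y(1), of p] Y(2) by simp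
  qed
qed

lemma endo_tangent: "A \<in> endo_fields M \<Longrightarrow> v \<in> tangent M p \<Longrightarrow> A p v \<in> tangent M p"
  unfolding endo_fields_def lin_maps_def by blast

lemma endo_add:
  "A \<in> endo_fields M \<Longrightarrow> u \<in> tangent M p \<Longrightarrow> v \<in> tangent M p \<Longrightarrow> A p (u + v) = A p u + A p v"
  by (auto simp: endo_fields_def lin_maps_def)

lemma endo_scaleR: "A \<in> endo_fields M \<Longrightarrow> v \<in> tangent M p \<Longrightarrow> A p (c *\<^sub>R v) = c *\<^sub>R A p v"
  by (auto simp: endo_fields_def lin_maps_def)

lemma endo_outside: "A \<in> endo_fields M \<Longrightarrow> v \<notin> tangent M p \<Longrightarrow> A p v = 0"
  by (auto simp: endo_fields_def lin_maps_def)

lemma endo_zero: "A \<in> endo_fields M \<Longrightarrow> A p 0 = 0"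
  using endo_scaleR[OF _ tangent_zero, of A p 0] by simp

lemma endo_minus: "A \<in> endo_fields M \<Longrightarrow> v \<in> tangent M p \<Longrightarrow> A p (- v) = - A p v"
  using endo_scaleR[of A v p "-1"] by simp

lemma endo_vf: "A \<in> endo_fields M \<Longrightarrow> X \<in> vector_fields M \<Longrightarrow> (\<lambda>q. A q (X q)) \<in> vector_fields M"
  by (auto simp: endo_fields_def)

lemmas endo_simps = endo_add endo_scaleR endo_zero endo_minus

lemma cot_endo: "A \<in> endo_fields M \<Longrightarrow> \<alpha> \<in> cotangent M p \<Longrightarrow> \<alpha> \<circ> A p \<in> cotangent M p"
  by (rule cotI) (simp_all add: endo_simps[of A] cot_simps[of \<alpha>] endo_outside[of A] endo_tangent[of A])

lemma of_endo: "A \<in> endo_fields M \<Longrightarrow> \<alpha> \<in> one_forms M \<Longrightarrow> (\<lambda>p. \<alpha> p \<circ> A p) \<in> one_forms M"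
  by (rule ofI) (simp_all add: cot_endo of_cotangent of_smooth[of \<alpha>] endo_vf[of A])

text \<open>The terms (X k) A Y cancel between the two brackets. The formula is vector-valued, so
  tensoriality is applied to its value on each smooth function.\<close>

lemma lie_endo_apply:
  assumes X: "X \<in> vector_fields M" and A: "A \<in> endo_fields M" and Y: "Y \<in> vector_fields M"
  shows "lie_endo M X A p (Y p) = lie_bracket X (\<lambda>q. A q (Y q)) p - A p (lie_bracket X Y p)"
proof -
  let ?G = "\<lambda>Y. lie_bracket X (\<lambda>q. A q (Y q)) p - A p (lie_bracket X Y p)"
  have G: "?G Y \<in> tangent M p" if "Y \<in> vector_fields M" for Y
    by (intro tangent_subtract lb_tangent endo_tangent[OF A] endo_vf[OF A] X that)
  have eq: "?G Y = ?G Z" if Z: "Z \<in> vector_fields M" "Z p = Y p" for Z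
  proof (rule tangent_eqI[OF G[OF Y] G[OF Z(1)]])
    fix f assume f: "f \<in> smooth_funs M"
    show "?G Y f = ?G Z f"
    proof (rule vf_tensorial[where F="\<lambda>Y. ?G Y f" and p=p])
      fix Y Z assume Y: "Y \<in> vector_fields M" and Z: "Z \<in> vector_fields M"
      note AY = endo_vf[OF A Y] and AZ = endo_vf[OF A Z]
      show "?G (\<lambda>q. Y q + Z q) f = ?G Y f + ?G Z f"
        by (simp add: endo_add[OF A] vf_tangent[OF Y] vf_tangent[OF Z] lb_add_right[OF X AY AZ]
            lb_add_right[OF X Y Z] lb_tangent[OF X Y] lb_tangent[OF X Z])
    next
      fix k Y assume k: "k \<in> smooth_funs M" and Y: "Y \<in> vector_fields M"
      note AY = endo_vf[OF A Y]
      show "?G (\<lambda>q. k q *\<^sub>R Y q) f = k p * ?G Y f"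
        by (simp add: endo_add[OF A] endo_scaleR[OF A] vf_tangent[OF Y] lb_mult_right[OF X AY k]
            lb_mult_right[OF X Y k] lb_tangent[OF X Y] tangent_scaleR algebra_simps)
    qed (use Y Z in simp_all)
  qed
  have "(THE u. \<forall>Z\<in>vector_fields M. Z p = Y p \<longrightarrow> u = ?G Z) = ?G Y"
  proof (rule the_equality)
    show "\<forall>Z\<in>vector_fields M. Z p = Y p \<longrightarrow> ?G Y = ?G Z"
      by (intro ballI impI eq)
  qed (erule bspec[OF _ Y, THEN mp, OF _ refl])
  then show ?thesis unfolding lie_endo_def if_P[OF vf_tangent[OF Y]] .
qed

section \<open>Bivector fields and the map sharp\<close>

lemma bivector_skew_form: "w \<in> bivector_fields M \<Longrightarrow> w p \<in> skew_forms (cotangent M p)"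
  unfolding bivector_fields_def by blast

lemma bivector_cot: "w \<in> bivector_fields M \<Longrightarrow> \<alpha> \<in> cotangent M p \<Longrightarrow> w p \<alpha> \<in> lin_maps (cotangent M p) UNIV"
  using bivector_skew_form[of w p] unfolding skew_forms_def lin_maps_def[of _ "lin_maps _ _"] by blast

lemma bivector_skew:
  "w \<in> bivector_fields M \<Longrightarrow> \<alpha> \<in> cotangent M p \<Longrightarrow> \<beta> \<in> cotangent M p \<Longrightarrow> w p \<beta> \<alpha> = - w p \<alpha> \<beta>"
  using bivector_skew_form[of w p] unfolding skew_forms_def by blast

lemma bivector_add_left:
  "w \<in> bivector_fields M \<Longrightarrow> \<alpha> \<in> cotangent M p \<Longrightarrow> \<alpha>' \<in> cotangent M p \<Longrightarrow> w p (\<alpha> + \<alpha>') \<beta> = w p \<alpha> \<beta> + w p \<alpha>' \<beta>"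
  by (auto simp: bivector_fields_def skew_forms_def lin_maps_def)

lemma bivector_scaleR_left:
  "w \<in> bivector_fields M \<Longrightarrow> \<alpha> \<in> cotangent M p \<Longrightarrow> w p (c *\<^sub>R \<alpha>) \<beta> = c * w p \<alpha> \<beta>"
  by (auto simp: bivector_fields_def skew_forms_def lin_maps_def)

lemma bivector_add_right:
  "w \<in> bivector_fields M \<Longrightarrow> \<alpha> \<in> cotangent M p \<Longrightarrow> \<beta> \<in> cotangent M p \<Longrightarrow> \<beta>' \<in> cotangent M p
    \<Longrightarrow> w p \<alpha> (\<beta> + \<beta>') = w p \<alpha> \<beta> + w p \<alpha> \<beta>'"
  using bivector_cot by (fastforce simp: lin_maps_def)

lemma bivector_scaleR_right:
  "w \<in> bivector_fields M \<Longrightarrow> \<alpha> \<in> cotangent M p \<Longrightarrow> \<beta> \<in> cotangent M p \<Longrightarrow> w p \<alpha> (c *\<^sub>R \<beta>) = c * w p \<alpha> \<beta>"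
  using bivector_cot by (fastforce simp: lin_maps_def)

lemma bivector_sum_right:
  assumes w: "w \<in> bivector_fields M" and \<alpha>: "\<alpha> \<in> cotangent M p"
    and \<beta>: "\<And>i. \<beta> i \<in> cotangent M p"
  shows "w p \<alpha> (\<Sum>i\<in>I. c i *\<^sub>R \<beta> i) = (\<Sum>i\<in>I. c i * w p \<alpha> (\<beta> i))"
proof -
  have zero: "w p \<alpha> 0 = 0" using bivector_scaleR_right[OF w \<alpha> cotangent_zero, of 0] by simp
  show ?thesis
  proof (induction I rule: infinite_finite_induct)
    case (insert i I)
    have "w p \<alpha> (c i *\<^sub>R \<beta> i + (\<Sum>i\<in>I. c i *\<^sub>R \<beta> i))
        = w p \<alpha> (c i *\<^sub>R \<beta> i) + w p \<alpha> (\<Sum>i\<in>I. c i *\<^sub>R \<beta> i)"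
      by (intro bivector_add_right[OF w \<alpha>] cotangent_sum_closed cotangent_scaleR \<beta>)
    then show ?case
      by (simp only: sum.insert[OF insert.hyps] insert.IH bivector_scaleR_right[OF w \<alpha> \<beta>])
  qed (simp_all only: sum.infinite sum.empty zero not_False_eq_True)
qed

lemma bivector_smooth:
  "w \<in> bivector_fields M \<Longrightarrow> \<alpha> \<in> one_forms M \<Longrightarrow> \<beta> \<in> one_forms M \<Longrightarrow> (\<lambda>p. w p (\<alpha> p) (\<beta> p)) \<in> smooth_funs M"
  by (simp add: bivector_fields_def)

lemma tangent_separate:
  assumes "u \<in> tangent M p" "v \<in> tangent M p" "\<And>\<beta>. \<beta> \<in> cotangent M p \<Longrightarrow> \<beta> u = \<beta> v"
  shows "u = v"
  using assms(1,2) assms(3)[OF dif_cotangent] by (intro tangent_eqI[where p=p]) (simp_all add: dif_apply)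

context
  fixes w assumes w: "w \<in> bivector_fields M"
begin

text \<open>Reflexivity of the tangent space made explicit: the vector \<Sum> w(\<alpha>, d(x i)) E
  i represents the functional w(\<alpha>, -), because every covector \<beta> is \<Sum> \<beta>(E i)
  d(x i).\<close>

lemma sharp_ex:
  assumes \<alpha>: "\<alpha> \<in> cotangent M p"
  shows "\<exists>v\<in>tangent M p. \<forall>\<beta>\<in>cotangent M p. \<beta> v = w p \<alpha> \<beta>"
proof -
  obtain I :: "'e option set" and x E \<kappa> where F: "\<kappa> p = 1" "\<And>i. E i \<in> vector_fields M"
    "\<And>q v. v \<in> tangent M q \<Longrightarrow> \<kappa> q *\<^sub>R v = (\<Sum>i\<in>I. v (x i) *\<^sub>R E i q)"
    using local_frame[of p] by blast
  let ?v = "\<Sum>i\<in>I. w p \<alpha> (dif M (x i) p) *\<^sub>R E i p"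
  have "\<beta> ?v = w p \<alpha> \<beta>" if \<beta>: "\<beta> \<in> cotangent M p" for \<beta>
  proof -
    have "\<beta> = (\<Sum>i\<in>I. \<beta> (E i p) *\<^sub>R dif M (x i) p)"
    proof (rule cot_eqI[OF \<beta>])
      fix u assume u: "u \<in> tangent M p"
      then have "\<beta> u = \<beta> (\<Sum>i\<in>I. u (x i) *\<^sub>R E i p)" using F(1) F(3)[OF u] by simp
      then show "\<beta> u = (\<Sum>i\<in>I. \<beta> (E i p) *\<^sub>R dif M (x i) p) u"
        using F(2) by (simp add: cot_simps[OF \<beta>] vf_tangent tangent_scaleR sum_fun_apply dif_apply u mult.commute)
    qed (intro cotangent_intros)
    then have "w p \<alpha> \<beta> = w p \<alpha> (\<Sum>i\<in>I. \<beta> (E i p) *\<^sub>R dif M (x i) p)" by simp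
    also have "\<dots> = (\<Sum>i\<in>I. \<beta> (E i p) * w p \<alpha> (dif M (x i) p))"
      by (rule bivector_sum_right[OF w \<alpha> dif_cotangent])
    finally show ?thesis
      using F(2) by (simp add: cot_simps[OF \<beta>] vf_tangent tangent_scaleR mult.commute)
  qed
  moreover have "?v \<in> tangent M p" using F(2) by (intro tangent_intros vf_tangent)
  ultimately show ?thesis by blast
qed

lemma sharp_eqI:
  assumes "v \<in> tangent M p" "\<And>\<beta>. \<beta> \<in> cotangent M p \<Longrightarrow> \<beta> v = w p \<alpha> \<beta>"
  shows "sharp M w p \<alpha> = v"
  unfolding sharp_def using assms tangent_separate by (intro the_equality) (simp, metis)

lemma sharp:
  assumes "\<alpha> \<in> cotangent M p"
  shows sharp_tangent: "sharp M w p \<alpha> \<in> tangent M p"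
    and sharp_apply: "\<beta> \<in> cotangent M p \<Longrightarrow> \<beta> (sharp M w p \<alpha>) = w p \<alpha> \<beta>"
  using sharp_ex[OF assms] sharp_eqI by metis+

lemma sharp_fun: "\<alpha> \<in> cotangent M p \<Longrightarrow> sharp M w p \<alpha> f = w p \<alpha> (dif M f p)"
  using sharp_apply[OF _ dif_cotangent] sharp_tangent dif_apply by metis

lemma sharp_add:
  "\<alpha> \<in> cotangent M p \<Longrightarrow> \<beta> \<in> cotangent M p \<Longrightarrow> sharp M w p (\<alpha> + \<beta>) = sharp M w p \<alpha> + sharp M w p \<beta>"
  by (rule sharp_eqI)
     (simp_all add: tangent_plus sharp_tangent cot_simps sharp_apply bivector_add_left[OF w])

lemma sharp_scaleR: "\<alpha> \<in> cotangent M p \<Longrightarrow> sharp M w p (c *\<^sub>R \<alpha>) = c *\<^sub>R sharp M w p \<alpha>"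
  by (rule sharp_eqI)
     (simp_all add: tangent_scaleR sharp_tangent cot_simps sharp_apply bivector_scaleR_left[OF w])

lemma sharp_zero: "sharp M w p 0 = 0"
  using sharp_scaleR[OF cotangent_zero, of p 0] by simp

lemma sharp_vf: "\<alpha> \<in> one_forms M \<Longrightarrow> (\<lambda>q. sharp M w q (\<alpha> q)) \<in> vector_fields M"
  by (rule vfI) (simp_all add: sharp_tangent of_cotangent sharp_fun bivector_smooth[OF w] of_dif)

end

end

section \<open>The torsion of a generalized structure without 2-form\<close>


definition sec :: "('a \<Rightarrow> 'a tvec) \<Rightarrow> ('a \<Rightarrow> 'a covec) \<Rightarrow> 'a \<Rightarrow> 'a bigvec" where
  "sec X \<alpha> = (\<lambda>p. (X p, \<alpha> p))"

definition courant_form ::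
  "('a, 'e::fin_dim_inner) atlas \<Rightarrow> ('a \<Rightarrow> 'a tvec) \<Rightarrow> ('a \<Rightarrow> 'a covec) \<Rightarrow> ('a \<Rightarrow> 'a tvec) \<Rightarrow> ('a \<Rightarrow> 'a covec)
    \<Rightarrow> 'a \<Rightarrow> 'a covec" where
  "courant_form M X \<alpha> Y \<beta> p = lie_form M X \<beta> p - lie_form M Y \<alpha> p
     + (1/2) *\<^sub>R dif M (\<lambda>q. \<alpha> q (Y q) - \<beta> q (X q)) p"

lemma courant_sec:
  "courant M (sec X \<alpha>) (sec Y \<beta>) p = (lie_bracket X Y p, courant_form M X \<alpha> Y \<beta> p)"
  by (simp add: courant_def sec_def courant_form_def o_def)

lemma sec_fst_snd: "sec (fst \<circ> S) (snd \<circ> S) = S"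
  by (simp add: sec_def fun_eq_iff)

context smooth_mfd begin

lemma sec_big_sections:
  "X \<in> vector_fields M \<Longrightarrow> \<alpha> \<in> one_forms M \<Longrightarrow> sec X \<alpha> \<in> big_sections M"
  by (simp add: big_sections_def sec_def o_def)

lemma big_sectionsE:
  assumes "S \<in> big_sections M"
  obtains X \<alpha> where "X \<in> vector_fields M" "\<alpha> \<in> one_forms M" "S = sec X \<alpha>"
proof (rule that)
  show "fst \<circ> S \<in> vector_fields M" "snd \<circ> S \<in> one_forms M"
    using assms unfolding big_sections_def by blast+
  show "S = sec (fst \<circ> S) (snd \<circ> S)" by (rule sec_fst_snd[symmetric])
qed

text \<open>Every tangent vector is the value of a vector field, and on vector fields the Lie
  derivatives have explicit formulas.\<close>

lemma covector_eqI:
  assumes "\<alpha> \<in> cotangent M p" "\<beta> \<in> cotangent M p"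
    and eq: "\<And>Z. Z \<in> vector_fields M \<Longrightarrow> \<alpha> (Z p) = \<beta> (Z p)"
  shows "\<alpha> = \<beta>"
proof (rule cot_eqI[OF assms(1,2)])
  fix v assume "v \<in> tangent M p"
  then obtain Z where "Z \<in> vector_fields M" "Z p = v" using vf_extend by blast
  then show "\<alpha> v = \<beta> v" using eq by blast
qed

context
  fixes X Y :: "'a \<Rightarrow> 'a tvec" and \<alpha> \<beta> :: "'a \<Rightarrow> 'a covec"
  assumes X: "X \<in> vector_fields M" and Y: "Y \<in> vector_fields M"
    and \<alpha>: "\<alpha> \<in> one_forms M" and \<beta>: "\<beta> \<in> one_forms M"
begin

lemma courant_form_cot: "courant_form M X \<alpha> Y \<beta> p \<in> cotangent M p"
  unfolding courant_form_def
  by (intro cotangent_plus cotangent_diff cotangent_scaleR dif_cotangent of_cotangent[OF lie_form_of] X Y \<alpha> \<beta>)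

lemma courant_form_apply:
  assumes Z: "Z \<in> vector_fields M"
  shows "courant_form M X \<alpha> Y \<beta> p (Z p) = X p (\<lambda>q. \<beta> q (Z q)) - \<beta> p (lie_bracket X Z p)
    - Y p (\<lambda>q. \<alpha> q (Z q)) + \<alpha> p (lie_bracket Y Z p)
    + 1/2 * (Z p (\<lambda>q. \<alpha> q (Y q)) - Z p (\<lambda>q. \<beta> q (X q)))"
  unfolding courant_form_def
  by (simp add: lie_form_apply[OF X \<beta> Z] lie_form_apply[OF Y \<alpha> Z] dif_apply[OF vf_tangent[OF Z]]
      tangent_diff[OF vf_tangent[OF Z] of_smooth[OF \<alpha> Y] of_smooth[OF \<beta> X]])

end

lemma courant_form_skew:
  assumes "X \<in> vector_fields M" "\<alpha> \<in> one_forms M" "Y \<in> vector_fields M" "\<beta> \<in> one_forms M"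
  shows "courant_form M Y \<beta> X \<alpha> p = - courant_form M X \<alpha> Y \<beta> p"
proof (rule covector_eqI[where p=p])
  fix Z assume "Z \<in> vector_fields M"
  then show "courant_form M Y \<beta> X \<alpha> p (Z p) = (- courant_form M X \<alpha> Y \<beta> p) (Z p)"
    using assms by (simp add: courant_form_apply) (simp add: field_simps)
qed (intro cotangent_minus courant_form_cot assms)+

lemma courant_form_add:
  assumes X: "X \<in> vector_fields M" and X': "X' \<in> vector_fields M" and Y: "Y \<in> vector_fields M"
    and \<alpha>: "\<alpha> \<in> one_forms M" and \<alpha>': "\<alpha>' \<in> one_forms M" and \<beta>: "\<beta> \<in> one_forms M"
  shows "courant_form M (\<lambda>q. X q + X' q) (\<lambda>q. \<alpha> q + \<alpha>' q) Y \<beta> p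
    = courant_form M X \<alpha> Y \<beta> p + courant_form M X' \<alpha>' Y \<beta> p"
proof (rule covector_eqI[where p=p])
  note XX = vf_add[OF X X'] and aa = of_add[OF \<alpha> \<alpha>']
  show "courant_form M (\<lambda>q. X q + X' q) (\<lambda>q. \<alpha> q + \<alpha>' q) Y \<beta> p \<in> cotangent M p"
    by (rule courant_form_cot[OF XX Y aa \<beta>])
  show "courant_form M X \<alpha> Y \<beta> p + courant_form M X' \<alpha>' Y \<beta> p \<in> cotangent M p"
    by (intro cotangent_plus courant_form_cot X X' Y \<alpha> \<alpha>' \<beta>)
  fix Z assume Z: "Z \<in> vector_fields M"
  have "Z p (\<lambda>q. \<beta> q (X q + X' q)) = Z p (\<lambda>q. \<beta> q (X q)) + Z p (\<lambda>q. \<beta> q (X' q))"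
    by (simp add: cot_add[OF of_cotangent[OF \<beta>]] vf_tangent[OF X] vf_tangent[OF X']
        tangent_add[OF vf_tangent[OF Z] of_smooth[OF \<beta> X] of_smooth[OF \<beta> X']])
  then show "courant_form M (\<lambda>q. X q + X' q) (\<lambda>q. \<alpha> q + \<alpha>' q) Y \<beta> p (Z p)
      = (courant_form M X \<alpha> Y \<beta> p + courant_form M X' \<alpha>' Y \<beta> p) (Z p)"
    by (simp add: courant_form_apply[OF XX Y aa \<beta> Z] courant_form_apply[OF X Y \<alpha> \<beta> Z]
        courant_form_apply[OF X' Y \<alpha>' \<beta> Z] lb_add_left[OF Z X X']
        cot_add[OF of_cotangent[OF \<beta>] lb_tangent[OF X Z] lb_tangent[OF X' Z]]
        tangent_add[OF vf_tangent[OF Z] of_smooth[OF \<alpha> Y] of_smooth[OF \<alpha>' Y]]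
        tangent_add[OF vf_tangent[OF Y] of_smooth[OF \<alpha> Z] of_smooth[OF \<alpha>' Z]] field_simps)
qed

end

section \<open>Pointwise algebra of \<Phi> for vanishing 2-form\<close>

text \<open>The algebraic conditions on the classical tensor fields when \<sigma> = 0; the term with
  sharp and flat in the formula for A^2 then disappears. The differential conditions are kept out,
  so that integrability can be compared with them.\<close>

locale cps_pair = smooth_mfd M
  for M :: "('a::{t2_space, second_countable_topology}, 'e::fin_dim_inner) atlas" +
  fixes A w and \<epsilon> :: real
  assumes A: "A \<in> endo_fields M" and w: "w \<in> bivector_fields M"
    and compatible: "\<alpha> \<in> cotangent M p \<Longrightarrow> \<beta> \<in> cotangent M p \<Longrightarrow> w p (\<alpha> \<circ> A p) \<beta> = w p \<alpha> (\<beta> \<circ> A p)"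
    and A_square: "v \<in> tangent M p \<Longrightarrow> A p (A p v) = \<epsilon> *\<^sub>R v"
begin

definition \<Phi> where "\<Phi> = big_endo M A w 0"

lemma \<Phi>_apply:
  assumes "v \<in> tangent M p" "\<alpha> \<in> cotangent M p"
  shows "\<Phi> p (v, \<alpha>) = (A p v + sharp M w p \<alpha>, - (\<alpha> \<circ> A p))"
  using assms by (simp add: \<Phi>_def big_endo_def big_tangent_def)

lemma \<Phi>_big:
  assumes "x \<in> big_tangent M p" shows "\<Phi> p x \<in> big_tangent M p"
proof -
  obtain v \<alpha> where x: "x = (v, \<alpha>)" "v \<in> tangent M p" "\<alpha> \<in> cotangent M p"
    using assms by (auto simp: big_tangent_def)
  have "A p v + sharp M w p \<alpha> \<in> tangent M p"
    by (intro tangent_plus endo_tangent[OF A] sharp_tangent[OF w] x)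
  moreover have "- (\<alpha> \<circ> A p) \<in> cotangent M p"
    by (intro cotangent_minus cot_endo[OF A] x)
  ultimately show ?thesis using x by (simp add: \<Phi>_apply big_tangent_def)
qed

lemma \<Phi>_add:
  assumes "x \<in> big_tangent M p" "y \<in> big_tangent M p" shows "\<Phi> p (x + y) = \<Phi> p x + \<Phi> p y"
proof -
  obtain v \<alpha> where x: "x = (v, \<alpha>)" "v \<in> tangent M p" "\<alpha> \<in> cotangent M p"
    using assms by (auto simp: big_tangent_def)
  obtain u \<beta> where y: "y = (u, \<beta>)" "u \<in> tangent M p" "\<beta> \<in> cotangent M p"
    using assms by (auto simp: big_tangent_def)
  have "(\<alpha> + \<beta>) \<circ> A p = (\<alpha> \<circ> A p) + (\<beta> \<circ> A p)" by (simp add: fun_eq_iff)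
  then show ?thesis
    by (simp add: x y \<Phi>_apply tangent_plus cotangent_plus endo_add[OF A x(2) y(2)] sharp_add[OF w x(3) y(3)])
qed

lemma \<Phi>_scaleR:
  assumes "x \<in> big_tangent M p" shows "\<Phi> p (c *\<^sub>R x) = c *\<^sub>R \<Phi> p x"
proof -
  obtain v \<alpha> where x: "x = (v, \<alpha>)" "v \<in> tangent M p" "\<alpha> \<in> cotangent M p"
    using assms by (auto simp: big_tangent_def)
  have "(c *\<^sub>R \<alpha>) \<circ> A p = c *\<^sub>R (\<alpha> \<circ> A p)" by (simp add: fun_eq_iff)
  then show ?thesis
    by (simp add: x \<Phi>_apply tangent_scaleR cotangent_scaleR endo_scaleR[OF A x(2)]
        sharp_scaleR[OF w x(3)] scaleR_add_right)
qed

lemma \<Phi>_minus: "x \<in> big_tangent M p \<Longrightarrow> \<Phi> p (- x) = - \<Phi> p x"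
  using \<Phi>_scaleR[of x p "-1"] by simp

text \<open>Compatibility restated as commutation of \<open>A\<close> with sharp; it cancels the
  off-diagonal part of \<Phi>^2.\<close>

lemma A_sharp:
  assumes \<alpha>: "\<alpha> \<in> cotangent M p" shows "A p (sharp M w p \<alpha>) = sharp M w p (\<alpha> \<circ> A p)"
proof (rule sym, rule sharp_eqI[OF w])
  show "A p (sharp M w p \<alpha>) \<in> tangent M p"
    by (intro endo_tangent[OF A] sharp_tangent[OF w] \<alpha>)
  fix \<beta> assume \<beta>: "\<beta> \<in> cotangent M p"
  show "\<beta> (A p (sharp M w p \<alpha>)) = w p (\<alpha> \<circ> A p) \<beta>"
    using sharp_apply[OF w \<alpha> cot_endo[OF A \<beta>]] compatible[OF \<alpha> \<beta>] by simp
qed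

lemma \<Phi>_square:
  assumes "x \<in> big_tangent M p" shows "\<Phi> p (\<Phi> p x) = \<epsilon> *\<^sub>R x"
proof -
  obtain v \<alpha> where x: "x = (v, \<alpha>)" "v \<in> tangent M p" "\<alpha> \<in> cotangent M p"
    using assms by (auto simp: big_tangent_def)
  note aA = cot_endo[OF A x(3)] and s = sharp_tangent[OF w x(3)] and Av = endo_tangent[OF A x(2)]
  have "- (- (\<alpha> \<circ> A p) \<circ> A p) = \<epsilon> *\<^sub>R \<alpha>"
  proof (rule cot_eqI[where p=p])
    show "- (- (\<alpha> \<circ> A p) \<circ> A p) \<in> cotangent M p" "\<epsilon> *\<^sub>R \<alpha> \<in> cotangent M p"
      by (intro cotangent_minus cot_endo[OF A] cotangent_scaleR x)+
    show "(- (- (\<alpha> \<circ> A p) \<circ> A p)) u = (\<epsilon> *\<^sub>R \<alpha>) u" if "u \<in> tangent M p" for u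
      using that by (simp add: A_square cot_scaleR[OF x(3)])
  qed
  moreover have "A p (A p v + sharp M w p \<alpha>) + sharp M w p (- (\<alpha> \<circ> A p)) = \<epsilon> *\<^sub>R v"
    using sharp_scaleR[OF w aA, of "-1"]
    by (simp add: endo_add[OF A Av s] A_square[OF x(2)] A_sharp[OF x(3)])
  ultimately show ?thesis
    by (simp add: x \<Phi>_apply tangent_plus[OF Av s] cotangent_minus[OF aA])
qed

section \<open>Additivity and skew-symmetry of the torsion\<close>

definition \<Phi>1 where "\<Phi>1 X \<alpha> = (\<lambda>q. A q (X q) + sharp M w q (\<alpha> q))"
definition \<Phi>2 :: "('a \<Rightarrow> 'a covec) \<Rightarrow> 'a \<Rightarrow> 'a covec" where "\<Phi>2 \<alpha> = (\<lambda>q. - (\<alpha> q \<circ> A q))"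

lemma \<Phi>1_vf: "X \<in> vector_fields M \<Longrightarrow> \<alpha> \<in> one_forms M \<Longrightarrow> \<Phi>1 X \<alpha> \<in> vector_fields M"
  unfolding \<Phi>1_def by (rule vf_add[OF endo_vf[OF A] sharp_vf[OF w]])

lemma \<Phi>2_of: "\<alpha> \<in> one_forms M \<Longrightarrow> \<Phi>2 \<alpha> \<in> one_forms M"
  unfolding \<Phi>2_def by (rule of_minus[OF of_endo[OF A]])

lemma \<Phi>_sec:
  assumes "X \<in> vector_fields M" "\<alpha> \<in> one_forms M"
  shows "(\<lambda>p. \<Phi> p (sec X \<alpha> p)) = sec (\<Phi>1 X \<alpha>) (\<Phi>2 \<alpha>)"
  by (simp add: sec_def fun_eq_iff \<Phi>_apply vf_tangent[OF assms(1)] of_cotangent[OF assms(2)] \<Phi>1_def \<Phi>2_def)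

text \<open>The left side of the integrability condition. Vector and form parts are separate
  arguments, so that either can be set to 0.\<close>

definition torsion where
  "torsion X \<alpha> Y \<beta> p = courant M (sec (\<Phi>1 X \<alpha>) (\<Phi>2 \<alpha>)) (sec (\<Phi>1 Y \<beta>) (\<Phi>2 \<beta>)) p
     - \<Phi> p (courant M (sec X \<alpha>) (sec (\<Phi>1 Y \<beta>) (\<Phi>2 \<beta>)) p)
     - \<Phi> p (courant M (sec (\<Phi>1 X \<alpha>) (\<Phi>2 \<alpha>)) (sec Y \<beta>) p)
     + \<Phi> p (\<Phi> p (courant M (sec X \<alpha>) (sec Y \<beta>) p))"

lemma integrable_iff:
  "integrable_big_endo M \<Phi> \<longleftrightarrow> (\<forall>X\<in>vector_fields M. \<forall>\<alpha>\<in>one_forms M.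
     \<forall>Y\<in>vector_fields M. \<forall>\<beta>\<in>one_forms M. \<forall>p. torsion X \<alpha> Y \<beta> p = 0)"
proof -
  have "(\<forall>S\<in>big_sections M. P S) \<longleftrightarrow> (\<forall>X\<in>vector_fields M. \<forall>\<alpha>\<in>one_forms M. P (sec X \<alpha>))" for P
  proof (intro iffI ballI)
    fix S assume "\<forall>X\<in>vector_fields M. \<forall>\<alpha>\<in>one_forms M. P (sec X \<alpha>)" "S \<in> big_sections M"
    then show "P S" by (elim big_sectionsE) simp
  qed (simp add: sec_big_sections)
  then show ?thesis
    by (simp add: integrable_big_endo_def Let_def torsion_def \<Phi>_sec)
qed

lemma courant_big:
  assumes "X \<in> vector_fields M" "\<alpha> \<in> one_forms M" "Y \<in> vector_fields M" "\<beta> \<in> one_forms M"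
  shows "courant M (sec X \<alpha>) (sec Y \<beta>) p \<in> big_tangent M p"
  using assms by (simp add: courant_sec big_tangent_def lb_tangent courant_form_cot)

lemma courant_skew:
  assumes "X \<in> vector_fields M" "\<alpha> \<in> one_forms M" "Y \<in> vector_fields M" "\<beta> \<in> one_forms M"
  shows "courant M (sec Y \<beta>) (sec X \<alpha>) p = - courant M (sec X \<alpha>) (sec Y \<beta>) p"
  using lb_skew[of Y X p] courant_form_skew[OF assms, of p] by (simp add: courant_sec)

lemma courant_add:
  assumes "X \<in> vector_fields M" "X' \<in> vector_fields M" "Y \<in> vector_fields M"
    "\<alpha> \<in> one_forms M" "\<alpha>' \<in> one_forms M" "\<beta> \<in> one_forms M"
  shows "courant M (sec (\<lambda>q. X q + X' q) (\<lambda>q. \<alpha> q + \<alpha>' q)) (sec Y \<beta>) p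
    = courant M (sec X \<alpha>) (sec Y \<beta>) p + courant M (sec X' \<alpha>') (sec Y \<beta>) p"
  using courant_form_add[OF assms, of p] lb_add_left[OF assms(3,1,2), of p] by (simp add: courant_sec)

text \<open>Inherited from the Courant bracket, whose exact term is antisymmetric. It carries
  additivity over from the first slot to the second.\<close>

lemma torsion_skew:
  assumes S: "X \<in> vector_fields M" "\<alpha> \<in> one_forms M" and T: "Y \<in> vector_fields M" "\<beta> \<in> one_forms M"
  shows "torsion Y \<beta> X \<alpha> p = - torsion X \<alpha> Y \<beta> p"
proof -
  note S' = \<Phi>1_vf[OF S] \<Phi>2_of[OF S(2)] and T' = \<Phi>1_vf[OF T] \<Phi>2_of[OF T(2)]
  note b = courant_big[OF S T] courant_big[OF S T'] courant_big[OF S' T] courant_big[OF S' T']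
  show ?thesis
    unfolding torsion_def courant_skew[OF S T] courant_skew[OF S T'] courant_skew[OF S' T] courant_skew[OF S' T']
      \<Phi>_minus[OF b(1)] \<Phi>_minus[OF b(2)] \<Phi>_minus[OF b(3)] \<Phi>_minus[OF \<Phi>_big[OF b(1)]]
    by simp
qed

lemma torsion_add:
  assumes S: "X \<in> vector_fields M" "\<alpha> \<in> one_forms M" and R: "X' \<in> vector_fields M" "\<alpha>' \<in> one_forms M"
    and T: "Y \<in> vector_fields M" "\<beta> \<in> one_forms M"
  shows "torsion (\<lambda>q. X q + X' q) (\<lambda>q. \<alpha> q + \<alpha>' q) Y \<beta> p = torsion X \<alpha> Y \<beta> p + torsion X' \<alpha>' Y \<beta> p"
proof -
  note S' = \<Phi>1_vf[OF S] \<Phi>2_of[OF S(2)] and T' = \<Phi>1_vf[OF T] \<Phi>2_of[OF T(2)]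
    and R' = \<Phi>1_vf[OF R] \<Phi>2_of[OF R(2)]
  have 1: "\<Phi>1 (\<lambda>q. X q + X' q) (\<lambda>q. \<alpha> q + \<alpha>' q) = (\<lambda>q. \<Phi>1 X \<alpha> q + \<Phi>1 X' \<alpha>' q)"
    unfolding \<Phi>1_def
    by (rule ext) (simp only: endo_add[OF A vf_tangent[OF S(1)] vf_tangent[OF R(1)]]
        sharp_add[OF w of_cotangent[OF S(2)] of_cotangent[OF R(2)]] add_ac)
  have 2: "\<Phi>2 (\<lambda>q. \<alpha> q + \<alpha>' q) = (\<lambda>q. \<Phi>2 \<alpha> q + \<Phi>2 \<alpha>' q)"
    by (simp add: \<Phi>2_def fun_eq_iff)
  note c = courant_add[OF S(1) R(1) T(1) S(2) R(2) T(2)] courant_add[OF S(1) R(1) T'(1) S(2) R(2) T'(2)]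
    courant_add[OF S'(1) R'(1) T(1) S'(2) R'(2) T(2)] courant_add[OF S'(1) R'(1) T'(1) S'(2) R'(2) T'(2)]
  note b = courant_big[OF S T] courant_big[OF S T'] courant_big[OF S' T] courant_big[OF S' T']
  note d = courant_big[OF R T] courant_big[OF R T'] courant_big[OF R' T] courant_big[OF R' T']
  show ?thesis
    unfolding torsion_def 1 2 c \<Phi>_add[OF b(1) d(1)] \<Phi>_add[OF b(2) d(2)] \<Phi>_add[OF b(3) d(3)]
      \<Phi>_add[OF \<Phi>_big[OF b(1)] \<Phi>_big[OF d(1)]]
    by (simp only: algebra_simps)
qed

text \<open>Each section is the sum of its vector part and its form part. Additivity and
  skew-symmetry reduce the four resulting pairs to three types, as the two mixed ones differ by a
  sign.\<close>

lemma torsion_zeroI: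
  assumes "\<And>X Y. X \<in> vector_fields M \<Longrightarrow> Y \<in> vector_fields M \<Longrightarrow> torsion X (\<lambda>q. 0) Y (\<lambda>q. 0) p = 0"
    and "\<And>X \<beta>. X \<in> vector_fields M \<Longrightarrow> \<beta> \<in> one_forms M \<Longrightarrow> torsion X (\<lambda>q. 0) (\<lambda>q. 0) \<beta> p = 0"
    and "\<And>\<alpha> \<beta>. \<alpha> \<in> one_forms M \<Longrightarrow> \<beta> \<in> one_forms M \<Longrightarrow> torsion (\<lambda>q. 0) \<alpha> (\<lambda>q. 0) \<beta> p = 0"
    and S: "X \<in> vector_fields M" "\<alpha> \<in> one_forms M" and T: "Y \<in> vector_fields M" "\<beta> \<in> one_forms M"
  shows "torsion X \<alpha> Y \<beta> p = 0"
proof -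
  have split: "torsion X \<alpha> Y \<beta> p = torsion X (\<lambda>q. 0) Y \<beta> p + torsion (\<lambda>q. 0) \<alpha> Y \<beta> p"
    if "X \<in> vector_fields M" "\<alpha> \<in> one_forms M" "Y \<in> vector_fields M" "\<beta> \<in> one_forms M" for X \<alpha> Y \<beta>
    using torsion_add[OF that(1) of_zero vf_zero that(2-4), of p] by simp
  have "torsion X (\<lambda>q. 0) Y \<beta> p = - (torsion Y (\<lambda>q. 0) X (\<lambda>q. 0) p + torsion (\<lambda>q. 0) \<beta> X (\<lambda>q. 0) p)"
    using torsion_skew[OF T S(1) of_zero, of p] split[OF T S(1) of_zero] by simp
  moreover have "torsion (\<lambda>q. 0) \<beta> X (\<lambda>q. 0) p = 0"
    using torsion_skew[OF S(1) of_zero vf_zero T(2), of p] assms(2)[OF S(1) T(2)] by simp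
  moreover have "torsion (\<lambda>q. 0) \<alpha> Y \<beta> p = - (torsion Y (\<lambda>q. 0) (\<lambda>q. 0) \<alpha> p + torsion (\<lambda>q. 0) \<beta> (\<lambda>q. 0) \<alpha> p)"
    using torsion_skew[OF T vf_zero S(2), of p] split[OF T vf_zero S(2)] by simp
  ultimately show ?thesis
    using split[OF S T] assms(1)[OF T(1) S(1)] assms(2)[OF T(1) S(2)] assms(3)[OF T(2) S(2)] by simp
qed

lemma courant_form_zero:
  assumes "X \<in> vector_fields M" "Y \<in> vector_fields M"
  shows "courant_form M X (\<lambda>q. 0) Y (\<lambda>q. 0) p = 0"
proof (rule covector_eqI[OF courant_form_cot[OF assms of_zero of_zero] cotangent_zero])
  fix Z assume Z: "Z \<in> vector_fields M"
  show "courant_form M X (\<lambda>q. 0) Y (\<lambda>q. 0) p (Z p) = 0 (Z p)"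
    by (simp add: courant_form_apply[OF assms of_zero of_zero Z] tangent_const[OF vf_tangent[OF Z]]
        tangent_const[OF vf_tangent[OF assms(1)]] tangent_const[OF vf_tangent[OF assms(2)]])
qed

lemma courant_form_zero':
  assumes "\<alpha> \<in> one_forms M" "\<beta> \<in> one_forms M"
  shows "courant_form M (\<lambda>q. 0) \<alpha> (\<lambda>q. 0) \<beta> p = 0"
proof (rule covector_eqI[OF courant_form_cot[OF vf_zero vf_zero assms] cotangent_zero])
  fix Z assume Z: "Z \<in> vector_fields M"
  show "courant_form M (\<lambda>q. 0) \<alpha> (\<lambda>q. 0) \<beta> p (Z p) = 0 (Z p)"
    by (simp add: courant_form_apply[OF vf_zero vf_zero assms Z] tangent_const[OF vf_tangent[OF Z]]
        lb_zero'[OF Z] cot_zero[OF of_cotangent[OF assms(1)]] cot_zero[OF of_cotangent[OF assms(2)]])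
qed

lemma \<Phi>1_left: "\<Phi>1 X (\<lambda>q. 0) = (\<lambda>q. A q (X q))"
  by (simp add: \<Phi>1_def sharp_zero[OF w])

lemma \<Phi>1_right: "\<Phi>1 (\<lambda>q. 0) \<alpha> = (\<lambda>q. sharp M w q (\<alpha> q))"
  by (simp add: \<Phi>1_def endo_zero[OF A])

lemma \<Phi>2_zero: "\<Phi>2 (\<lambda>q. 0) = (\<lambda>q. 0)"
  by (simp add: \<Phi>2_def fun_eq_iff)

lemma \<Phi>_left: "v \<in> tangent M p \<Longrightarrow> \<Phi> p (v, 0) = (A p v, 0)"
proof -
  have "- ((0 :: 'a covec) \<circ> A p) = 0" by (rule ext) simp
  then show "v \<in> tangent M p \<Longrightarrow> ?thesis"
    by (simp add: \<Phi>_apply[OF _ cotangent_zero] sharp_zero[OF w])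
qed

lemma \<Phi>_right: "\<alpha> \<in> cotangent M p \<Longrightarrow> \<Phi> p (0, \<alpha>) = (sharp M w p \<alpha>, - (\<alpha> \<circ> A p))"
  by (simp add: \<Phi>_apply[OF tangent_zero] endo_zero[OF A])

section \<open>The torsion on pure pairs\<close>

text \<open>Without 2-form, \<Phi> maps vector fields to vector fields and acts on them as
  \<open>A\<close>, and their Courant bracket is the Lie bracket.\<close>

lemma torsion_vf_vf:
  assumes X: "X \<in> vector_fields M" and Y: "Y \<in> vector_fields M"
  shows "torsion X (\<lambda>q. 0) Y (\<lambda>q. 0) p = (nijenhuis A X Y p, 0)"
proof -
  note AX = endo_vf[OF A X] and AY = endo_vf[OF A Y]
  show ?thesis
    unfolding torsion_def \<Phi>1_left \<Phi>2_zero courant_sec courant_form_zero[OF X Y]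
      courant_form_zero[OF AX Y] courant_form_zero[OF X AY] courant_form_zero[OF AX AY]
      \<Phi>_left[OF lb_tangent[OF X Y]] \<Phi>_left[OF lb_tangent[OF AX Y]] \<Phi>_left[OF lb_tangent[OF X AY]]
      \<Phi>_left[OF endo_tangent[OF A lb_tangent[OF X Y]]]
    by (simp add: nijenhuis_def Let_def)
qed

lemma concomitant_apply:
  assumes \<alpha>: "\<alpha> \<in> one_forms M" and \<beta>: "\<beta> \<in> one_forms M" and Z: "Z \<in> vector_fields M"
  defines "X \<equiv> \<lambda>q. sharp M w q (\<alpha> q)" and "Y \<equiv> \<lambda>q. sharp M w q (\<beta> q)" and "B \<equiv> \<lambda>q. A q (Z q)"
  shows "concomitant M w A \<alpha> \<beta> p (Z p) =
    \<beta> p (lie_bracket X B p) - \<beta> p (A p (lie_bracket X Z p))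
    - \<alpha> p (lie_bracket Y B p) + \<alpha> p (A p (lie_bracket Y Z p))
    + B p (\<lambda>q. w q (\<alpha> q) (\<beta> q)) - Z p (\<lambda>q. w q (\<alpha> q \<circ> A q) (\<beta> q))"
proof -
  have X: "X \<in> vector_fields M" and Y: "Y \<in> vector_fields M" and B: "B \<in> vector_fields M"
    unfolding X_def Y_def B_def using \<alpha> \<beta> Z sharp_vf[OF w] endo_vf[OF A] by blast+
  note XZ = lie_endo_apply[OF X A Z, of p] and YZ = lie_endo_apply[OF Y A Z, of p]
  show ?thesis
    unfolding concomitant_def X_def[symmetric] Y_def[symmetric]
    by (simp add: XZ YZ cot_diff[OF of_cotangent[OF \<alpha>] lb_tangent[OF Y endo_vf[OF A Z]] endo_tangent[OF A lb_tangent[OF Y Z]]]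
        cot_diff[OF of_cotangent[OF \<beta>] lb_tangent[OF X endo_vf[OF A Z]] endo_tangent[OF A lb_tangent[OF X Z]]]
        dif_apply[OF vf_tangent[OF Z]] dif_apply[OF endo_tangent[OF A vf_tangent[OF Z]]] B_def)
qed

text \<open>The vanishing of the concomitant is an equation between functions on all of the type, so
  the default value 0 off the tangent space has to be confirmed.\<close>

lemma concomitant_outside:
  assumes \<alpha>: "\<alpha> \<in> one_forms M" and \<beta>: "\<beta> \<in> one_forms M" and v: "v \<notin> tangent M p"
  shows "concomitant M w A \<alpha> \<beta> p v = 0"
  using v by (simp add: concomitant_def lie_endo_def endo_outside[OF A] dif_def
      cot_zero[OF of_cotangent[OF \<alpha>]] cot_zero[OF of_cotangent[OF \<beta>]])

lemma sharp_pair: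
  assumes "\<alpha> \<in> one_forms M" "\<beta> \<in> one_forms M"
  shows "\<beta> q (sharp M w q (\<alpha> q)) = w q (\<alpha> q) (\<beta> q)" "\<alpha> q (sharp M w q (\<beta> q)) = - w q (\<alpha> q) (\<beta> q)"
  using sharp_apply[OF w of_cotangent[OF assms(1)] of_cotangent[OF assms(2)]]
    sharp_apply[OF w of_cotangent[OF assms(2)] of_cotangent[OF assms(1)]]
    bivector_skew[OF w of_cotangent[OF assms(1)] of_cotangent[OF assms(2)]] by simp_all

text \<open>The bracket of two 1-forms is 0, which removes the term with \<Phi>^2. The brackets of
  \<alpha> with \<Phi> \<beta> and of \<Phi> \<alpha> with \<beta> have no vector part; their
  covectors are \<open>g1\<close> and \<open>g2\<close>. Sharp of these enters the vector part,
  composition with \<open>A\<close> the covector part.\<close>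

lemma torsion_of_of:
  assumes \<alpha>: "\<alpha> \<in> one_forms M" and \<beta>: "\<beta> \<in> one_forms M"
  defines "X \<equiv> \<lambda>q. sharp M w q (\<alpha> q)" and "Y \<equiv> \<lambda>q. sharp M w q (\<beta> q)"
  shows torsion_of_of_fst: "h \<in> smooth_funs M \<Longrightarrow> Z = (\<lambda>q. sharp M w q (dif M h q)) \<Longrightarrow>
      fst (torsion (\<lambda>q. 0) \<alpha> (\<lambda>q. 0) \<beta> p) h
      = \<alpha> p (lie_bracket Y Z p) - \<beta> p (lie_bracket X Z p) - Z p (\<lambda>q. w q (\<alpha> q) (\<beta> q))"
    and torsion_of_of_snd: "V \<in> vector_fields M \<Longrightarrow>
      snd (torsion (\<lambda>q. 0) \<alpha> (\<lambda>q. 0) \<beta> p) (V p) = - concomitant M w A \<alpha> \<beta> p (V p)"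
proof -
  define g1 where "g1 = courant_form M (\<lambda>q. 0) \<alpha> Y (\<Phi>2 \<beta>) p"
  define g2 where "g2 = courant_form M X (\<Phi>2 \<alpha>) (\<lambda>q. 0) \<beta> p"
  define W where "W = (\<lambda>q. w q (\<alpha> q) (\<beta> q))"
  have X: "X \<in> vector_fields M" and Y: "Y \<in> vector_fields M"
    unfolding X_def Y_def using \<alpha> \<beta> sharp_vf[OF w] by blast+
  note a = \<Phi>2_of[OF \<alpha>] and b = \<Phi>2_of[OF \<beta>]
  have W: "W \<in> smooth_funs M" unfolding W_def by (rule bivector_smooth[OF w \<alpha> \<beta>])
  have XY: "\<beta> q (X q) = W q" "\<alpha> q (Y q) = - W q" for q
    unfolding X_def Y_def W_def by (rule sharp_pair[OF \<alpha> \<beta>])+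
  have g: "g1 \<in> cotangent M p" "g2 \<in> cotangent M p"
    unfolding g1_def g2_def by (intro courant_form_cot X Y \<alpha> \<beta> a b vf_zero)+
  have tors: "torsion (\<lambda>q. 0) \<alpha> (\<lambda>q. 0) \<beta> p
      = (lie_bracket X Y p - sharp M w p g1 - sharp M w p g2,
         courant_form M X (\<Phi>2 \<alpha>) Y (\<Phi>2 \<beta>) p + (g1 \<circ> A p) + (g2 \<circ> A p))"
  proof -
    have "\<Phi> p (0, 0) = 0"
      using \<Phi>_left[OF tangent_zero] endo_zero[OF A] by (simp add: zero_prod_def)
    then show ?thesis
      unfolding torsion_def \<Phi>1_right X_def[symmetric] Y_def[symmetric] courant_sec
        lb_zero[OF X] lb_zero'[OF Y] lb_zero[OF vf_zero] courant_form_zero'[OF \<alpha> \<beta>]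
        g1_def[symmetric] g2_def[symmetric] \<Phi>_right[OF g(1)] \<Phi>_right[OF g(2)]
      by (simp add: zero_prod_def[symmetric])
  qed
  have g1: "g1 (V p) = - Y p (\<lambda>q. \<alpha> q (V q)) + \<alpha> p (lie_bracket Y V p) - 1/2 * V p W"
    if V: "V \<in> vector_fields M" for V
    unfolding g1_def courant_form_apply[OF vf_zero Y \<alpha> b V] lb_zero'[OF V] XY
    by (simp add: cot_zero[OF of_cotangent[OF b]] tangent_uminus[OF vf_tangent[OF V] W]
        tangent_const[OF vf_tangent[OF V]])
  have g2: "g2 (V p) = X p (\<lambda>q. \<beta> q (V q)) - \<beta> p (lie_bracket X V p) - 1/2 * V p W"
    if V: "V \<in> vector_fields M" for V
    unfolding g2_def courant_form_apply[OF X vf_zero a \<beta> V] lb_zero'[OF V] XY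
    by (simp add: cot_zero[OF of_cotangent[OF a]] tangent_const[OF vf_tangent[OF V]])
  show "fst (torsion (\<lambda>q. 0) \<alpha> (\<lambda>q. 0) \<beta> p) h
      = \<alpha> p (lie_bracket Y Z p) - \<beta> p (lie_bracket X Z p) - Z p (\<lambda>q. w q (\<alpha> q) (\<beta> q))"
    if h: "h \<in> smooth_funs M" and Z_def: "Z = (\<lambda>q. sharp M w q (dif M h q))"
  proof -
    note dh = of_dif[OF h]
    have Z: "Z \<in> vector_fields M" unfolding Z_def by (rule sharp_vf[OF w dh])
    \<comment> \<open>Written with \<open>Z\<close>, the bracket of \<open>X\<close> and
      \<open>Y\<close> on h consists of derivatives along \<open>X\<close> and \<open>Y\<close> that
      cancel those in \<open>g1 (Z p)\<close> and \<open>g2 (Z p)\<close>.\<close>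
    have Xh: "X q h = - \<alpha> q (Z q)" and Yh: "Y q h = - \<beta> q (Z q)" for q
      unfolding X_def Y_def Z_def
      using sharp_fun[OF w of_cotangent[OF \<alpha>], of q h] sharp_fun[OF w of_cotangent[OF \<beta>], of q h]
        sharp_pair(2)[OF \<alpha> dh, of q] sharp_pair(2)[OF \<beta> dh, of q]
        sharp_pair(1)[OF dh \<alpha>, of q] sharp_pair(1)[OF dh \<beta>, of q]
        bivector_skew[OF w of_cotangent[OF \<alpha>] of_cotangent[OF dh], of q]
        bivector_skew[OF w of_cotangent[OF \<beta>] of_cotangent[OF dh], of q] by simp_all
    have gh: "sharp M w p g h = - g (Z p)" if "g \<in> cotangent M p" for g
      using sharp_fun[OF w that, of h] sharp_apply[OF w of_cotangent[OF dh] that]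
        bivector_skew[OF w that of_cotangent[OF dh]] by (simp add: Z_def)
    have "fst (torsion (\<lambda>q. 0) \<alpha> (\<lambda>q. 0) \<beta> p) h = lie_bracket X Y p h + g1 (Z p) + g2 (Z p)"
      unfolding tors by (simp add: gh[OF g(1)] gh[OF g(2)])
    also have "lie_bracket X Y p h = - X p (\<lambda>q. \<beta> q (Z q)) + Y p (\<lambda>q. \<alpha> q (Z q))"
      unfolding lb_apply Xh Yh
      by (simp add: tangent_uminus[OF vf_tangent[OF X] of_smooth[OF \<beta> Z]]
          tangent_uminus[OF vf_tangent[OF Y] of_smooth[OF \<alpha> Z]])
    finally show ?thesis unfolding g1[OF Z] g2[OF Z] unfolding W_def by linarith
  qed
  show "snd (torsion (\<lambda>q. 0) \<alpha> (\<lambda>q. 0) \<beta> p) (V p) = - concomitant M w A \<alpha> \<beta> p (V p)"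
    if V: "V \<in> vector_fields M"
  proof -
    define B where "B = (\<lambda>q. A q (V q))"
    define W' where "W' = (\<lambda>q. w q (\<alpha> q \<circ> A q) (\<beta> q))"
    have B: "B \<in> vector_fields M" unfolding B_def by (rule endo_vf[OF A V])
    have W': "W' \<in> smooth_funs M" unfolding W'_def by (rule bivector_smooth[OF w of_endo[OF A \<alpha>] \<beta>])
    have aV: "\<Phi>2 \<alpha> q (V q) = - \<alpha> q (B q)" and bV: "\<Phi>2 \<beta> q (V q) = - \<beta> q (B q)" for q
      by (simp_all add: \<Phi>2_def B_def)
    \<comment> \<open>By compatibility the two pairings are opposite, so the factor 1/2 of the exact
      term adds up to one full derivative of \<open>W'\<close>.\<close>
    have aY: "\<Phi>2 \<alpha> q (Y q) = W' q" and bX: "\<Phi>2 \<beta> q (X q) = - W' q" for q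
      using sharp_pair(2)[OF of_endo[OF A \<alpha>] \<beta>, of q] sharp_pair(1)[OF \<alpha> of_endo[OF A \<beta>], of q]
        compatible[OF of_cotangent[OF \<alpha>] of_cotangent[OF \<beta>], of q]
      by (simp_all add: \<Phi>2_def X_def Y_def W'_def)
    have "courant_form M X (\<Phi>2 \<alpha>) Y (\<Phi>2 \<beta>) p (V p) = - X p (\<lambda>q. \<beta> q (B q))
        + \<beta> p (A p (lie_bracket X V p)) + Y p (\<lambda>q. \<alpha> q (B q)) - \<alpha> p (A p (lie_bracket Y V p)) + V p W'"
      unfolding courant_form_apply[OF X Y a b V] aV bV aY bX
      by (simp add: tangent_uminus[OF vf_tangent[OF X] of_smooth[OF \<beta> B]]
          tangent_uminus[OF vf_tangent[OF Y] of_smooth[OF \<alpha> B]] tangent_uminus[OF vf_tangent[OF V] W'])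
         (simp add: \<Phi>2_def)
    then show ?thesis
      unfolding tors
      by (simp add: B_def[THEN fun_cong, symmetric] g1[OF B] g2[OF B]
          concomitant_apply[OF \<alpha> \<beta> V, folded X_def Y_def B_def W_def W'_def])
  qed
qed

text \<open>Brackets with \<open>X\<close> and \<open>A X\<close> in the vector part are, up to
  order, the Lie derivatives of \<open>A\<close> along the two sharp fields, evaluated on
  \<open>X\<close>; tested on h they give the concomitant of \<beta> and dh. In the covector part
  the terms with \<open>w\<close> disappear and \<open>A\<close> alone is left.\<close>

lemma torsion_vf_of:
  assumes X: "X \<in> vector_fields M" and \<beta>: "\<beta> \<in> one_forms M"
  shows torsion_vf_of_fst: "h \<in> smooth_funs M \<Longrightarrow>
      fst (torsion X (\<lambda>q. 0) (\<lambda>q. 0) \<beta> p) h = - concomitant M w A \<beta> (dif M h) p (X p)"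
    and torsion_vf_of_snd: "V \<in> vector_fields M \<Longrightarrow>
      snd (torsion X (\<lambda>q. 0) (\<lambda>q. 0) \<beta> p) (V p) = - \<beta> p (nijenhuis A X V p)"
proof -
  define B where "B = (\<lambda>q. A q (X q))"
  define Y where "Y = (\<lambda>q. sharp M w q (\<beta> q))"
  have Y: "Y \<in> vector_fields M" unfolding Y_def by (rule sharp_vf[OF w \<beta>])
  have B: "B \<in> vector_fields M" unfolding B_def by (rule endo_vf[OF A X])
  note b = \<Phi>2_of[OF \<beta>]
  define g1 where "g1 = courant_form M X (\<lambda>q. 0) Y (\<Phi>2 \<beta>) p"
  define g2 where "g2 = courant_form M B (\<lambda>q. 0) (\<lambda>q. 0) \<beta> p"
  have g: "g1 \<in> cotangent M p" "g2 \<in> cotangent M p"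
    unfolding g1_def g2_def by (intro courant_form_cot X Y B \<beta> b vf_zero of_zero)+
  have g3: "courant_form M X (\<lambda>q. 0) (\<lambda>q. 0) \<beta> p \<in> cotangent M p"
    by (intro courant_form_cot X \<beta> vf_zero of_zero)
  have tors: "torsion X (\<lambda>q. 0) (\<lambda>q. 0) \<beta> p
      = (lie_bracket B Y p - A p (lie_bracket X Y p) - sharp M w p g1 - sharp M w p g2,
         courant_form M B (\<lambda>q. 0) Y (\<Phi>2 \<beta>) p + (g1 \<circ> A p) + (g2 \<circ> A p)
           + \<epsilon> *\<^sub>R courant_form M X (\<lambda>q. 0) (\<lambda>q. 0) \<beta> p)"
  proof -
    \<comment> \<open>The last term of the torsion is not expanded: \<Phi>^2 = \<epsilon> Id applies
      to it. The matching step for the Nijenhuis tensor below is A^2 = \<epsilon> Id.\<close>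
    have "(0, courant_form M X (\<lambda>q. 0) (\<lambda>q. 0) \<beta> p) \<in> big_tangent M p"
      using g3 tangent_zero by (simp add: big_tangent_def)
    note sq = \<Phi>_square[OF this]
    show ?thesis
      unfolding torsion_def \<Phi>1_left \<Phi>1_right \<Phi>2_zero B_def[symmetric] Y_def[symmetric] courant_sec
        lb_zero[OF X] lb_zero[OF B] g1_def[symmetric] g2_def[symmetric] sq
        \<Phi>_right[OF g(2)] \<Phi>_apply[OF lb_tangent[OF X Y] g(1)]
      by (simp add: algebra_simps)
  qed
  have bV: "\<Phi>2 \<beta> q v = - \<beta> q (A q v)" for q v by (simp add: \<Phi>2_def)
  have g1: "g1 (V p) = - X p (\<lambda>q. \<beta> q (A q (V q))) + \<beta> p (A p (lie_bracket X V p))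
      + 1/2 * V p (\<lambda>q. \<beta> q (B q))" if V: "V \<in> vector_fields M" for V
    unfolding g1_def courant_form_apply[OF X Y of_zero b V] bV
    by (simp add: B_def[THEN fun_cong, symmetric] tangent_const[OF vf_tangent[OF V]]
        tangent_const[OF vf_tangent[OF Y]] tangent_uminus[OF vf_tangent[OF V] of_smooth[OF \<beta> B]]
        tangent_uminus[OF vf_tangent[OF X] of_smooth[OF \<beta> endo_vf[OF A V]]])
  have g2: "g2 (V p) = B p (\<lambda>q. \<beta> q (V q)) - \<beta> p (lie_bracket B V p) - 1/2 * V p (\<lambda>q. \<beta> q (B q))"
    if V: "V \<in> vector_fields M" for V
    unfolding g2_def courant_form_apply[OF B vf_zero of_zero \<beta> V]
    by (simp add: tangent_const[OF vf_tangent[OF V]])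
  show "fst (torsion X (\<lambda>q. 0) (\<lambda>q. 0) \<beta> p) h = - concomitant M w A \<beta> (dif M h) p (X p)"
    if h: "h \<in> smooth_funs M"
  proof -
    note dh = of_dif[OF h]
    define Z where "Z = (\<lambda>q. sharp M w q (dif M h q))"
    have Z: "Z \<in> vector_fields M" unfolding Z_def by (rule sharp_vf[OF w dh])
    have gh: "sharp M w p g h = - g (Z p)" if "g \<in> cotangent M p" for g
      using sharp_fun[OF w that, of h] sharp_apply[OF w of_cotangent[OF dh] that]
        bivector_skew[OF w that of_cotangent[OF dh]] by (simp add: Z_def)
    define W where "W = (\<lambda>q. w q (\<beta> q) (dif M h q))"
    define W' where "W' = (\<lambda>q. w q (\<beta> q \<circ> A q) (dif M h q))"
    have W: "W \<in> smooth_funs M" unfolding W_def by (rule bivector_smooth[OF w \<beta> dh])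
    have W': "W' \<in> smooth_funs M" unfolding W'_def by (rule bivector_smooth[OF w of_endo[OF A \<beta>] dh])
    have Yh: "Y q h = W q" for q
      unfolding Y_def W_def by (rule sharp_fun[OF w of_cotangent[OF \<beta>]])
    have bZ: "\<beta> q (Z q) = - W q" and bAZ: "\<beta> q (A q (Z q)) = - W' q" for q
      using sharp_pair(2)[OF \<beta> dh, of q] sharp_pair(2)[OF of_endo[OF A \<beta>] dh, of q]
      by (simp_all add: Z_def W_def W'_def)
    have "fst (torsion X (\<lambda>q. 0) (\<lambda>q. 0) \<beta> p) h
        = lie_bracket B Y p h - A p (lie_bracket X Y p) h + (g1 (Z p) + g2 (Z p))"
      unfolding tors by (simp add: gh[OF g(1)] gh[OF g(2)])
    also have "g1 (Z p) + g2 (Z p) = X p W' + \<beta> p (A p (lie_bracket X Z p)) - B p W - \<beta> p (lie_bracket B Z p)"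
      unfolding g1[OF Z] g2[OF Z] bZ bAZ
      by (simp add: tangent_uminus[OF vf_tangent[OF X] W'] tangent_uminus[OF vf_tangent[OF B] W])
    finally have tors_h: "fst (torsion X (\<lambda>q. 0) (\<lambda>q. 0) \<beta> p) h
        = lie_bracket B Y p h - A p (lie_bracket X Y p) h
          + (X p W' + \<beta> p (A p (lie_bracket X Z p)) - B p W - \<beta> p (lie_bracket B Z p))" .
    have "concomitant M w A \<beta> (dif M h) p (X p)
        = - lie_bracket B Y p h + A p (lie_bracket X Y p) h + \<beta> p (lie_bracket B Z p)
          - \<beta> p (A p (lie_bracket X Z p)) + B p W - X p W'"
      unfolding concomitant_apply[OF \<beta> dh X, folded Y_def Z_def B_def W_def W'_def]
        lb_skew[of Y B p] lb_skew[of Y X p] lb_skew[of Z B p] lb_skew[of Z X p]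
        endo_minus[OF A lb_tangent[OF X Y]] endo_minus[OF A lb_tangent[OF X Z]]
        cot_minus[OF of_cotangent[OF \<beta>] lb_tangent[OF B Z]]
        cot_minus[OF of_cotangent[OF \<beta>] endo_tangent[OF A lb_tangent[OF X Z]]]
        dif_apply[OF tangent_minus[OF lb_tangent[OF B Y]]]
        dif_apply[OF tangent_minus[OF endo_tangent[OF A lb_tangent[OF X Y]]]]
      by (simp add: B_def)
    then show ?thesis unfolding tors_h by linarith
  qed
  show "snd (torsion X (\<lambda>q. 0) (\<lambda>q. 0) \<beta> p) (V p) = - \<beta> p (nijenhuis A X V p)"
    if V: "V \<in> vector_fields M"
  proof -
    define C where "C = (\<lambda>q. A q (V q))"
    have C: "C \<in> vector_fields M" unfolding C_def by (rule endo_vf[OF A V])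
    have sq: "\<beta> q (A q (B q)) = \<epsilon> * \<beta> q (X q)" "\<beta> q (A q (C q)) = \<epsilon> * \<beta> q (V q)" for q
      using vf_tangent[OF X] vf_tangent[OF V]
      by (simp_all add: B_def C_def A_square cot_scaleR[OF of_cotangent[OF \<beta>]])
    have 1: "courant_form M B (\<lambda>q. 0) Y (\<Phi>2 \<beta>) p (V p)
        = - B p (\<lambda>q. \<beta> q (C q)) + \<beta> p (A p (lie_bracket B V p)) + 1/2 * (\<epsilon> * V p (\<lambda>q. \<beta> q (X q)))"
      unfolding courant_form_apply[OF B Y of_zero b V] bV sq
      by (simp add: C_def[THEN fun_cong, symmetric] tangent_const[OF vf_tangent[OF V]]
          tangent_const[OF vf_tangent[OF Y]] tangent_uminus[OF vf_tangent[OF B] of_smooth[OF \<beta> C]]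
          tangent_uminus[OF vf_tangent[OF V] smooth_funs_mult[OF smooth_funs_const of_smooth[OF \<beta> X]]]
          tangent_cmult[OF vf_tangent[OF V] of_smooth[OF \<beta> X]])
    have 2: "g1 (C p) = - (\<epsilon> * X p (\<lambda>q. \<beta> q (V q))) + \<beta> p (A p (lie_bracket X C p))
        + 1/2 * C p (\<lambda>q. \<beta> q (B q))"
      unfolding g1[OF C] sq by (simp add: tangent_cmult[OF vf_tangent[OF X] of_smooth[OF \<beta> V]])
    have 3: "courant_form M X (\<lambda>q. 0) (\<lambda>q. 0) \<beta> p (V p)
        = X p (\<lambda>q. \<beta> q (V q)) - \<beta> p (lie_bracket X V p) - 1/2 * V p (\<lambda>q. \<beta> q (X q))"
      unfolding courant_form_apply[OF X vf_zero of_zero \<beta> V]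
      by (simp add: tangent_const[OF vf_tangent[OF V]])
    note t = lb_tangent[OF B C, of p] endo_tangent[OF A lb_tangent[OF X C], of p]
      endo_tangent[OF A lb_tangent[OF B V], of p] lb_tangent[OF X V, of p]
    have "\<beta> p (nijenhuis A X V p) = \<beta> p (lie_bracket B C p) - \<beta> p (A p (lie_bracket X C p))
        - \<beta> p (A p (lie_bracket B V p)) + \<epsilon> * \<beta> p (lie_bracket X V p)"
      unfolding nijenhuis_def Let_def B_def[symmetric] C_def[symmetric] A_square[OF t(4)]
      by (simp only: cot_add[OF of_cotangent[OF \<beta>] tangent_subtract[OF tangent_subtract[OF t(1,2)] t(3)] tangent_scaleR[OF t(4)]]
          cot_diff[OF of_cotangent[OF \<beta>] tangent_subtract[OF t(1,2)] t(3)]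
          cot_diff[OF of_cotangent[OF \<beta>] t(1,2)] cot_scaleR[OF of_cotangent[OF \<beta>] t(4)])
    then show ?thesis
      unfolding tors by (simp add: C_def[THEN fun_cong, symmetric] 1 2 3 g2[OF C] algebra_simps)
  qed
qed

end

section \<open>Poisson-Nijenhuis structures\<close>


context cps_pair begin

section \<open>The Jacobiator and the characterisation of integrability\<close>

text \<open>If \<alpha> is multiplied by f, the bracket of f X with Z and the derivative of f
  w(\<alpha>, \<beta>) along Z each contribute (Z f) w(\<alpha>, \<beta>), with opposite
  signs.\<close>

lemma poisson_defect_tensorial:
  assumes \<alpha>: "\<alpha> \<in> one_forms M" and \<alpha>': "\<alpha>' \<in> one_forms M" and \<beta>: "\<beta> \<in> one_forms M"
    and h: "h \<in> smooth_funs M" and eq: "\<alpha> p = \<alpha>' p"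
  shows "fst (torsion (\<lambda>q. 0) \<alpha> (\<lambda>q. 0) \<beta> p) h = fst (torsion (\<lambda>q. 0) \<alpha>' (\<lambda>q. 0) \<beta> p) h"
proof -
  define Y where "Y = (\<lambda>q. sharp M w q (\<beta> q))"
  define Z where "Z = (\<lambda>q. sharp M w q (dif M h q))"
  have Y: "Y \<in> vector_fields M" unfolding Y_def by (rule sharp_vf[OF w \<beta>])
  have Z: "Z \<in> vector_fields M" unfolding Z_def by (rule sharp_vf[OF w of_dif[OF h]])
  define F where "F = (\<lambda>\<alpha>. \<alpha> p (lie_bracket Y Z p) - \<beta> p (lie_bracket (\<lambda>q. sharp M w q (\<alpha> q)) Z p)
      - Z p (\<lambda>q. w q (\<alpha> q) (\<beta> q)))"
  have F: "fst (torsion (\<lambda>q. 0) \<alpha> (\<lambda>q. 0) \<beta> p) h = F \<alpha>" if "\<alpha> \<in> one_forms M" for \<alpha>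
    unfolding F_def Y_def by (rule torsion_of_of_fst[OF that \<beta> h Z_def])
  note cb = of_cotangent[OF \<beta>, of p]
  have "F \<alpha> = F \<alpha>'"
  proof (rule of_tensorial[where F=F and p=p, OF _ _ \<alpha> \<alpha>' eq])
    fix \<alpha> \<gamma> assume a: "\<alpha> \<in> one_forms M" and c: "\<gamma> \<in> one_forms M"
    note X = sharp_vf[OF w a] and V = sharp_vf[OF w c]
    show "F (\<lambda>q. \<alpha> q + \<gamma> q) = F \<alpha> + F \<gamma>"
      unfolding F_def sharp_add[OF w of_cotangent[OF a] of_cotangent[OF c]] lb_add_left[OF Z X V]
        cot_add[OF cb lb_tangent[OF X Z] lb_tangent[OF V Z]]
        bivector_add_left[OF w of_cotangent[OF a] of_cotangent[OF c]]
        tangent_add[OF vf_tangent[OF Z] bivector_smooth[OF w a \<beta>] bivector_smooth[OF w c \<beta>]]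
      by simp
  next
    fix f \<alpha> assume f: "f \<in> smooth_funs M" and a: "\<alpha> \<in> one_forms M"
    note X = sharp_vf[OF w a]
    show "F (\<lambda>q. f q *\<^sub>R \<alpha> q) = f p * F \<alpha>"
      unfolding F_def sharp_scaleR[OF w of_cotangent[OF a]] lb_mult_left[OF Z X f]
        cot_add[OF cb tangent_scaleR[OF vf_tangent[OF X]] tangent_scaleR[OF lb_tangent[OF X Z]]]
        cot_scaleR[OF cb vf_tangent[OF X]] cot_scaleR[OF cb lb_tangent[OF X Z]]
        bivector_scaleR_left[OF w of_cotangent[OF a]]
        tangent_mult[OF vf_tangent[OF Z] f bivector_smooth[OF w a \<beta>]] sharp_pair(1)[OF a \<beta>]
      by (simp add: algebra_simps)
  qed
  then show ?thesis by (simp only: F[OF \<alpha>] F[OF \<alpha>'])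
qed

text \<open>Sharp of df is the derivation {f, -}, so every term becomes an iterated Poisson bracket
  and the sum is minus the Jacobiator. The factor 2 appears because \<open>schouten\<close> of
  \<open>w\<close> with itself counts the Jacobiator twice.\<close>

lemma torsion_dif_dif:
  assumes f: "f \<in> smooth_funs M" and g: "g \<in> smooth_funs M" and h: "h \<in> smooth_funs M"
  shows "2 * fst (torsion (\<lambda>q. 0) (dif M f) (\<lambda>q. 0) (dif M g) p) h = - schouten M w w f g h p"
proof -
  let ?b = "bivector_bracket M w"
  have b_smooth: "?b f g \<in> smooth_funs M" if "f \<in> smooth_funs M" "g \<in> smooth_funs M" for f g
    unfolding bivector_bracket_def by (rule bivector_smooth[OF w of_dif[OF that(1)] of_dif[OF that(2)]])
  have b_eq: "sharp M w q (dif M f q) g = ?b f g q" for f g q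
    unfolding bivector_bracket_def by (rule sharp_fun[OF w dif_cotangent])
  have b_skew: "?b g f = (\<lambda>q. - ?b f g q)" for f g
    unfolding bivector_bracket_def using bivector_skew[OF w dif_cotangent dif_cotangent] by blast
  have b_minus: "?b f (\<lambda>q. - k q) q = - ?b f k q" if "f \<in> smooth_funs M" "k \<in> smooth_funs M" for f k q
    unfolding b_eq[symmetric] by (rule tangent_uminus[OF sharp_tangent[OF w dif_cotangent] that(2)])
  define X where "X = (\<lambda>f q. sharp M w q (dif M f q))"
  have X: "X f \<in> vector_fields M" if "f \<in> smooth_funs M" for f
    unfolding X_def by (rule sharp_vf[OF w of_dif[OF that]])
  have Xb: "X f q g = ?b f g q" for f q g by (simp add: X_def b_eq)
  have "fst (torsion (\<lambda>q. 0) (dif M f) (\<lambda>q. 0) (dif M g) p) h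
      = dif M f p (lie_bracket (X g) (X h) p) - dif M g p (lie_bracket (X f) (X h) p) - X h p (?b f g)"
    unfolding X_def bivector_bracket_def by (rule torsion_of_of_fst[OF of_dif[OF f] of_dif[OF g] h refl])
  also have "\<dots> = (?b g (?b h f) p - ?b h (?b g f) p) - (?b f (?b h g) p - ?b h (?b f g) p) - ?b h (?b f g) p"
    unfolding dif_apply[OF lb_tangent[OF X[OF g] X[OF h]]] dif_apply[OF lb_tangent[OF X[OF f] X[OF h]]] lb_apply Xb
    by simp
  finally have "fst (torsion (\<lambda>q. 0) (dif M f) (\<lambda>q. 0) (dif M g) p) h
      = (?b g (?b h f) p - ?b h (?b g f) p) - (?b f (?b h g) p - ?b h (?b f g) p) - ?b h (?b f g) p" .
  moreover have "?b (?b f g) h p = - ?b h (?b f g) p" "?b (?b g h) f p = - ?b f (?b g h) p"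
    "?b (?b h f) g p = - ?b g (?b h f) p"
    using b_skew[of h "?b f g"] b_skew[of f "?b g h"] b_skew[of g "?b h f"] by simp_all
  moreover have "?b h (?b g f) p = - ?b h (?b f g) p"
    by (subst b_skew[of g f]) (rule b_minus[OF h b_smooth[OF f g]])
  moreover have "?b f (?b h g) p = - ?b f (?b g h) p"
    by (subst b_skew[of h g]) (rule b_minus[OF f b_smooth[OF g h]])
  ultimately show ?thesis
    unfolding schouten_def Let_def by simp
qed

lemma integrable_char:
  "integrable_big_endo M \<Phi> \<longleftrightarrow>
     (\<forall>f\<in>smooth_funs M. \<forall>g\<in>smooth_funs M. \<forall>h\<in>smooth_funs M. schouten M w w f g h = 0)
     \<and> (\<forall>X\<in>vector_fields M. \<forall>Y\<in>vector_fields M. nijenhuis A X Y = 0)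
     \<and> (\<forall>\<alpha>\<in>one_forms M. \<forall>\<beta>\<in>one_forms M. concomitant M w A \<alpha> \<beta> = 0)"
  (is "?I \<longleftrightarrow> ?S \<and> ?N \<and> ?C")
proof
  assume I: ?I
  then have t: "torsion X \<alpha> Y \<beta> p = 0" if "X \<in> vector_fields M" "\<alpha> \<in> one_forms M"
      "Y \<in> vector_fields M" "\<beta> \<in> one_forms M" for X \<alpha> Y \<beta> p
    using that unfolding integrable_iff by blast
  have ?S
  proof (intro ballI ext)
    fix f g h p assume fgh: "f \<in> smooth_funs M" "g \<in> smooth_funs M" "h \<in> smooth_funs M"
    show "schouten M w w f g h p = 0 p"
      using torsion_dif_dif[OF fgh, of p] t[OF vf_zero of_dif[OF fgh(1)] vf_zero of_dif[OF fgh(2)], of p]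
      by simp
  qed
  moreover have ?N
  proof (intro ballI ext)
    fix X Y p assume XY: "X \<in> vector_fields M" "Y \<in> vector_fields M"
    have "nijenhuis A X Y p = 0"
      using torsion_vf_vf[OF XY, of p] t[OF XY(1) of_zero XY(2) of_zero, of p] by (simp add: zero_prod_def)
    then show "nijenhuis A X Y p f = 0 p f" for f by simp
  qed
  moreover have ?C
  proof (intro ballI ext)
    fix \<alpha> \<beta> p v assume ab: "\<alpha> \<in> one_forms M" "\<beta> \<in> one_forms M"
    show "concomitant M w A \<alpha> \<beta> p v = 0 p v"
    proof (cases "v \<in> tangent M p")
      case True
      then obtain V where V: "V \<in> vector_fields M" "V p = v" using vf_extend by blast
      then show ?thesis
        using torsion_of_of_snd[OF ab V(1), of p] t[OF vf_zero ab(1) vf_zero ab(2), of p] by simp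
    qed (simp add: concomitant_outside[OF ab])
  qed
  ultimately show "?S \<and> ?N \<and> ?C" by blast
next
  assume "?S \<and> ?N \<and> ?C"
  then have S: "\<And>f g h. f \<in> smooth_funs M \<Longrightarrow> g \<in> smooth_funs M \<Longrightarrow> h \<in> smooth_funs M \<Longrightarrow> schouten M w w f g h = 0"
    and N: "\<And>X Y. X \<in> vector_fields M \<Longrightarrow> Y \<in> vector_fields M \<Longrightarrow> nijenhuis A X Y = 0"
    and C: "\<And>\<alpha> \<beta>. \<alpha> \<in> one_forms M \<Longrightarrow> \<beta> \<in> one_forms M \<Longrightarrow> concomitant M w A \<alpha> \<beta> = 0" by blast+
  \<comment> \<open>Membership in the big tangent space allows the two components to be tested on
    smooth functions and on vector fields.\<close>
  have big: "torsion X \<alpha> Y \<beta> p \<in> big_tangent M p" if "X \<in> vector_fields M" "\<alpha> \<in> one_forms M"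
      "Y \<in> vector_fields M" "\<beta> \<in> one_forms M" for X \<alpha> Y \<beta> p
  proof -
    have sub: "x + y \<in> big_tangent M p" "x - y \<in> big_tangent M p"
      if "x \<in> big_tangent M p" "y \<in> big_tangent M p" for x y
      using that by (auto simp: big_tangent_def tangent_plus tangent_subtract cotangent_plus cotangent_diff)
    show ?thesis
      unfolding torsion_def by (intro sub \<Phi>_big courant_big \<Phi>1_vf \<Phi>2_of that)
  qed
  have zeroI: "torsion X \<alpha> Y \<beta> p = 0" if T: "X \<in> vector_fields M" "\<alpha> \<in> one_forms M"
      "Y \<in> vector_fields M" "\<beta> \<in> one_forms M"
    and 1: "\<And>h. h \<in> smooth_funs M \<Longrightarrow> fst (torsion X \<alpha> Y \<beta> p) h = 0"
    and 2: "\<And>V. V \<in> vector_fields M \<Longrightarrow> snd (torsion X \<alpha> Y \<beta> p) (V p) = 0" for X \<alpha> Y \<beta> p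
  proof (rule prod_eqI)
    have b: "fst (torsion X \<alpha> Y \<beta> p) \<in> tangent M p" "snd (torsion X \<alpha> Y \<beta> p) \<in> cotangent M p"
      using big[OF T, of p] by (auto simp: big_tangent_def)
    show "fst (torsion X \<alpha> Y \<beta> p) = fst 0"
      by (rule tangent_eqI[OF b(1), of "fst 0"]) (simp_all add: tangent_zero 1)
    show "snd (torsion X \<alpha> Y \<beta> p) = snd 0"
      by (rule covector_eqI[OF b(2), of "snd 0"]) (simp_all add: cotangent_zero 2)
  qed
  have poisson: "fst (torsion (\<lambda>q. 0) \<alpha> (\<lambda>q. 0) \<beta> p) h = 0"
    if \<alpha>: "\<alpha> \<in> one_forms M" and \<beta>: "\<beta> \<in> one_forms M" and h: "h \<in> smooth_funs M" for \<alpha> \<beta> p h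
  proof -
    \<comment> \<open>The exact forms agree with \<alpha> and \<beta> at \<open>p\<close> only, so
      this is where tensoriality is needed. It was shown for the first slot; the second is reached
      by skew-symmetry.\<close>
    obtain f where f: "f \<in> smooth_funs M" "dif M f p = \<alpha> p" using cot_exact[OF of_cotangent[OF \<alpha>]] by blast
    obtain g where g: "g \<in> smooth_funs M" "dif M g p = \<beta> p" using cot_exact[OF of_cotangent[OF \<beta>]] by blast
    note df = of_dif[OF f(1)] and dg = of_dif[OF g(1)]
    have "fst (torsion (\<lambda>q. 0) \<alpha> (\<lambda>q. 0) \<beta> p) h = fst (torsion (\<lambda>q. 0) (dif M f) (\<lambda>q. 0) \<beta> p) h"
      by (rule poisson_defect_tensorial[OF \<alpha> df \<beta> h f(2)[symmetric]])
    also have "\<dots> = - fst (torsion (\<lambda>q. 0) \<beta> (\<lambda>q. 0) (dif M f) p) h"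
      unfolding torsion_skew[OF vf_zero \<beta> vf_zero df] by simp
    also have "\<dots> = - fst (torsion (\<lambda>q. 0) (dif M g) (\<lambda>q. 0) (dif M f) p) h"
      using poisson_defect_tensorial[OF \<beta> dg df h g(2)[symmetric]] by simp
    also have "\<dots> = 0"
      using torsion_dif_dif[OF g(1) f(1) h, of p] S[OF g(1) f(1) h] by simp
    finally show ?thesis .
  qed
  show ?I
    unfolding integrable_iff
  proof (intro ballI allI, rule torsion_zeroI)
    fix p
    show "torsion X (\<lambda>q. 0) Y (\<lambda>q. 0) p = 0" if "X \<in> vector_fields M" "Y \<in> vector_fields M" for X Y
      using torsion_vf_vf[OF that, of p] N[OF that] by (simp add: zero_prod_def)
    show "torsion X (\<lambda>q. 0) (\<lambda>q. 0) \<beta> p = 0" if X: "X \<in> vector_fields M" and \<beta>: "\<beta> \<in> one_forms M" for X \<beta>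
    proof (rule zeroI[OF X of_zero vf_zero \<beta>])
      show "fst (torsion X (\<lambda>q. 0) (\<lambda>q. 0) \<beta> p) h = 0" if "h \<in> smooth_funs M" for h
        unfolding torsion_vf_of_fst[OF X \<beta> that] C[OF \<beta> of_dif[OF that]] by simp
      show "snd (torsion X (\<lambda>q. 0) (\<lambda>q. 0) \<beta> p) (V p) = 0" if "V \<in> vector_fields M" for V
        unfolding torsion_vf_of_snd[OF X \<beta> that] N[OF X that]
        using cot_zero[OF of_cotangent[OF \<beta>], of p] by simp
    qed
    show "torsion (\<lambda>q. 0) \<alpha> (\<lambda>q. 0) \<beta> p = 0" if \<alpha>: "\<alpha> \<in> one_forms M" and \<beta>: "\<beta> \<in> one_forms M" for \<alpha> \<beta>
    proof (rule zeroI[OF vf_zero \<alpha> vf_zero \<beta>])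
      show "snd (torsion (\<lambda>q. 0) \<alpha> (\<lambda>q. 0) \<beta> p) (V p) = 0" if "V \<in> vector_fields M" for V
        unfolding torsion_of_of_snd[OF \<alpha> \<beta> that] C[OF \<alpha> \<beta>] by simp
    qed (rule poisson[OF \<alpha> \<beta>])
  qed
qed

section \<open>Passage between \<Phi> and its classical tensor fields\<close>

lemma \<Phi>_outside: "x \<notin> big_tangent M p \<Longrightarrow> \<Phi> p x = 0"
  by (auto simp: \<Phi>_def big_endo_def split: prod.split)

lemma \<Phi>_almost_cps:
  assumes "\<epsilon> \<in> {-1, 0, 1}" shows "generalized_almost_cps M \<epsilon> \<Phi>"
  unfolding generalized_almost_cps_def
proof (intro conjI allI ballI)
  show "\<epsilon> \<in> {-1, 0, 1}" by (rule assms)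
  show "\<Phi> \<in> big_endo_fields M"
    unfolding big_endo_fields_def
  proof (intro CollectI conjI allI ballI)
    show "\<Phi> p \<in> lin_maps (big_tangent M p) (big_tangent M p)" for p
      using \<Phi>_big \<Phi>_add \<Phi>_scaleR \<Phi>_outside by (auto simp: lin_maps_def simp del: split_paired_All split_paired_Ex)
    fix S assume "S \<in> big_sections M"
    then obtain X \<alpha> where S: "X \<in> vector_fields M" "\<alpha> \<in> one_forms M" "S = sec X \<alpha>" by (rule big_sectionsE)
    show "(\<lambda>p. \<Phi> p (S p)) \<in> big_sections M"
      unfolding S(3) \<Phi>_sec[OF S(1,2)] by (intro sec_big_sections \<Phi>1_vf \<Phi>2_of S)
  qed
  fix p x y assume "x \<in> big_tangent M p" "y \<in> big_tangent M p"
  then obtain v \<alpha> u \<beta> where x: "x = (v, \<alpha>)" "v \<in> tangent M p" "\<alpha> \<in> cotangent M p"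
    and y: "y = (u, \<beta>)" "u \<in> tangent M p" "\<beta> \<in> cotangent M p"
    by (auto simp: big_tangent_def)
  show "big_metric x (\<Phi> p y) + big_metric (\<Phi> p x) y = 0"
    using bivector_skew[OF w x(3) y(3)]
    by (simp add: x y \<Phi>_apply big_metric_def cot_add[OF x(3) endo_tangent[OF A y(2)] sharp_tangent[OF w y(3)]]
        cot_add[OF y(3) endo_tangent[OF A x(2)] sharp_tangent[OF w x(3)]]
        sharp_apply[OF w x(3) y(3)] sharp_apply[OF w y(3) x(3)] field_simps)
qed (rule \<Phi>_square)

lemma tensor_A_\<Phi>: "tensor_A \<Phi> = A"
proof (intro ext)
  show "tensor_A \<Phi> p v f = A p v f" for p v f
  proof (cases "v \<in> tangent M p")
    case True
    then show ?thesis by (simp add: tensor_A_def \<Phi>_left)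
  next
    case False
    then show ?thesis
      using \<Phi>_outside[of "(v, 0)" p] by (simp add: tensor_A_def big_tangent_def endo_outside[OF A])
  qed
qed

lemma tensor_\<pi>_\<Phi>: "\<alpha> \<in> cotangent M p \<Longrightarrow> \<beta> \<in> cotangent M p \<Longrightarrow> tensor_\<pi> \<Phi> p \<alpha> \<beta> = w p \<alpha> \<beta>"
  by (simp add: tensor_\<pi>_def \<Phi>_right sharp_apply[OF w])

lemma snd_\<Phi>_left: "snd (\<Phi> p (v, 0)) = 0"
  using \<Phi>_left[of v p] \<Phi>_outside[of "(v, 0)" p] by (cases "v \<in> tangent M p") (auto simp: big_tangent_def)

end

context smooth_mfd begin

text \<open>The metric condition yields the lower right corner and the skewness of \<open>w\<close>;
  the square yields A^2 = \<epsilon> Id and the compatibility. Smoothness of \<open>A\<close> and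
  \<open>w\<close> comes from applying \<Psi> to sections with one part 0.\<close>

lemma almost_cps_decompose:
  assumes G: "generalized_almost_cps M \<epsilon> \<Psi>"
    and \<sigma>: "\<And>p v u. v \<in> tangent M p \<Longrightarrow> u \<in> tangent M p \<Longrightarrow> tensor_\<sigma> \<Psi> p v u = 0"
  shows "\<exists>A w. cps_pair M A w \<epsilon> \<and> \<Psi> = big_endo M A w 0"
proof -
  define A where "A = tensor_A \<Psi>"
  \<comment> \<open>\<open>tensor_\<pi>\<close> is meaningful on covectors only, while a bivector
    field has to be 0 elsewhere; hence the truncation.\<close>
  define w where "w = (\<lambda>p \<alpha> \<beta>. if \<alpha> \<in> cotangent M p \<and> \<beta> \<in> cotangent M p then tensor_\<pi> \<Psi> p \<alpha> \<beta> else 0)"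
  have lin: "\<Psi> p \<in> lin_maps (big_tangent M p) (big_tangent M p)" for p
    using G unfolding generalized_almost_cps_def big_endo_fields_def by blast
  have big: "\<Psi> p x \<in> big_tangent M p" if "x \<in> big_tangent M p" for p x
    using lin[of p] that unfolding lin_maps_def by blast
  have add: "\<Psi> p (x + y) = \<Psi> p x + \<Psi> p y" if "x \<in> big_tangent M p" "y \<in> big_tangent M p" for p x y
    using lin[of p] that unfolding lin_maps_def by blast
  have scale: "\<Psi> p (c *\<^sub>R x) = c *\<^sub>R \<Psi> p x" if "x \<in> big_tangent M p" for p x c
    using lin[of p] that unfolding lin_maps_def by blast
  have outside: "\<Psi> p x = 0" if "x \<notin> big_tangent M p" for p x
    using lin[of p] that unfolding lin_maps_def by blast
  have metric: "big_metric x (\<Psi> p y) + big_metric (\<Psi> p x) y = 0"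
    if "x \<in> big_tangent M p" "y \<in> big_tangent M p" for p x y
    using G that unfolding generalized_almost_cps_def by blast
  have square: "\<Psi> p (\<Psi> p x) = \<epsilon> *\<^sub>R x" if "x \<in> big_tangent M p" for p x
    using G that unfolding generalized_almost_cps_def by blast
  have sec: "(\<lambda>p. \<Psi> p (S p)) \<in> big_sections M" if "S \<in> big_sections M" for S
    using G that unfolding generalized_almost_cps_def big_endo_fields_def by blast
  have bl: "(v, 0) \<in> big_tangent M p" if "v \<in> tangent M p" for v p
    using that cotangent_zero by (simp add: big_tangent_def)
  have br: "(0, \<alpha>) \<in> big_tangent M p" if "\<alpha> \<in> cotangent M p" for \<alpha> p
    using that tangent_zero by (simp add: big_tangent_def)
  have snd_left: "snd (\<Psi> p (v, 0)) = 0" if v: "v \<in> tangent M p" for p v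
  proof (rule cot_eqI[OF _ cotangent_zero])
    show "snd (\<Psi> p (v, 0)) \<in> cotangent M p"
      using big[OF bl[OF v]] by (auto simp: big_tangent_def)
    show "snd (\<Psi> p (v, 0)) u = 0 u" if "u \<in> tangent M p" for u
      using \<sigma>[OF v that] by (simp add: tensor_\<sigma>_def)
  qed
  have left: "\<Psi> p (v, 0) = (A p v, 0)" if "v \<in> tangent M p" for p v
    using snd_left[OF that] by (simp add: A_def tensor_A_def prod_eq_iff)
  have A_tan: "A p v \<in> tangent M p" if "v \<in> tangent M p" for p v
    using big[OF bl[OF that]] by (simp add: left[OF that] big_tangent_def)
  define s where "s = (\<lambda>p \<alpha>. fst (\<Psi> p (0, \<alpha>)))"
  have s_tan: "s p \<alpha> \<in> tangent M p" if "\<alpha> \<in> cotangent M p" for p \<alpha>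
    using big[OF br[OF that]] by (auto simp: s_def big_tangent_def)
  have A: "A \<in> endo_fields M"
    unfolding endo_fields_def
  proof (intro CollectI conjI allI ballI)
    show "A p \<in> lin_maps (tangent M p) (tangent M p)" for p
      unfolding lin_maps_def
    proof (intro CollectI conjI allI ballI impI)
      show "A p ` tangent M p \<subseteq> tangent M p" using A_tan by blast
      show "A p (u + v) = A p u + A p v" if "u \<in> tangent M p" "v \<in> tangent M p" for u v
        using add[OF bl[OF that(1)] bl[OF that(2)]] by (simp add: A_def tensor_A_def)
      show "A p (c *\<^sub>R v) = c *\<^sub>R A p v" if "v \<in> tangent M p" for c v
        using scale[OF bl[OF that], of c] by (simp add: A_def tensor_A_def)
      show "A p v = 0" if "v \<notin> tangent M p" for v
        using outside[of "(v, 0)" p] that by (simp add: A_def tensor_A_def big_tangent_def)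
    qed
    fix X assume X: "X \<in> vector_fields M"
    have "fst \<circ> (\<lambda>p. \<Psi> p (sec X (\<lambda>q. 0) p)) \<in> vector_fields M"
      using sec[OF sec_big_sections[OF X of_zero]] unfolding big_sections_def by blast
    then show "(\<lambda>p. A p (X p)) \<in> vector_fields M"
      by (simp add: o_def sec_def left[OF vf_tangent[OF X]])
  qed
  \<comment> \<open>The metric condition for (v, 0) and (0, \<alpha>) expresses the form part
    through \<open>A\<close>.\<close>
  have snd_right: "snd (\<Psi> p (0, \<alpha>)) = - (\<alpha> \<circ> A p)" if \<alpha>: "\<alpha> \<in> cotangent M p" for p \<alpha>
  proof (rule cot_eqI)
    show "snd (\<Psi> p (0, \<alpha>)) \<in> cotangent M p" using big[OF br[OF \<alpha>]] by (auto simp: big_tangent_def)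
    show "- (\<alpha> \<circ> A p) \<in> cotangent M p" by (intro cotangent_minus cot_endo[OF A] \<alpha>)
    show "snd (\<Psi> p (0, \<alpha>)) v = (- (\<alpha> \<circ> A p)) v" if v: "v \<in> tangent M p" for v
      using metric[OF bl[OF v] br[OF \<alpha>]] by (simp add: big_metric_def left[OF v] split: prod.splits)
  qed
  have right: "\<Psi> p (0, \<alpha>) = (s p \<alpha>, - (\<alpha> \<circ> A p))" if "\<alpha> \<in> cotangent M p" for p \<alpha>
    using snd_right[OF that] by (simp add: s_def prod_eq_iff)
  have w_eq: "w p \<alpha> \<beta> = \<beta> (s p \<alpha>)" if "\<alpha> \<in> cotangent M p" "\<beta> \<in> cotangent M p" for p \<alpha> \<beta>
    using that by (simp add: w_def s_def tensor_\<pi>_def)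
  have w_skew: "\<beta> (s p \<alpha>) = - \<alpha> (s p \<beta>)" if "\<alpha> \<in> cotangent M p" "\<beta> \<in> cotangent M p" for p \<alpha> \<beta>
    using metric[OF br[OF that(1)] br[OF that(2)]]
    by (simp add: big_metric_def right[OF that(1)] right[OF that(2)] endo_zero[OF A] cot_zero[OF that(1)] cot_zero[OF that(2)])
  have w: "w \<in> bivector_fields M"
    unfolding bivector_fields_def
  proof (intro CollectI conjI allI ballI)
    fix p
    have cotw: "w p \<alpha> \<in> lin_maps (cotangent M p) UNIV" if \<alpha>: "\<alpha> \<in> cotangent M p" for \<alpha>
      unfolding lin_maps_def
    proof (intro CollectI conjI allI ballI impI)
      show "w p \<alpha> \<beta> = 0" if "\<beta> \<notin> cotangent M p" for \<beta> using that by (simp add: w_def)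
    qed (simp_all add: w_eq[OF \<alpha>] cotangent_plus cotangent_scaleR)
    have sadd: "s p (\<alpha> + \<beta>) = s p \<alpha> + s p \<beta>" if "\<alpha> \<in> cotangent M p" "\<beta> \<in> cotangent M p" for \<alpha> \<beta>
      using add[OF br[OF that(1)] br[OF that(2)]] by (simp add: s_def)
    have sscale: "s p (c *\<^sub>R \<alpha>) = c *\<^sub>R s p \<alpha>" if "\<alpha> \<in> cotangent M p" for \<alpha> c
      using scale[OF br[OF that], of c] by (simp add: s_def)
    have "w p \<in> lin_maps (cotangent M p) (lin_maps (cotangent M p) UNIV)"
      unfolding lin_maps_def[of _ "lin_maps _ _"]
    proof (intro CollectI conjI allI ballI impI)
      show "w p ` cotangent M p \<subseteq> lin_maps (cotangent M p) UNIV" using cotw by blast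
      show "w p (\<alpha> + \<alpha>') = w p \<alpha> + w p \<alpha>'" if "\<alpha> \<in> cotangent M p" "\<alpha>' \<in> cotangent M p" for \<alpha> \<alpha>'
      proof
        show "w p (\<alpha> + \<alpha>') \<beta> = (w p \<alpha> + w p \<alpha>') \<beta>" for \<beta>
          using that by (cases "\<beta> \<in> cotangent M p")
            (simp_all add: w_eq cotangent_plus sadd cot_add s_tan, simp_all add: w_def)
      qed
      show "w p (c *\<^sub>R \<alpha>) = c *\<^sub>R w p \<alpha>" if "\<alpha> \<in> cotangent M p" for c \<alpha>
      proof
        show "w p (c *\<^sub>R \<alpha>) \<beta> = (c *\<^sub>R w p \<alpha>) \<beta>" for \<beta>
          using that by (cases "\<beta> \<in> cotangent M p")
            (simp_all add: w_eq cotangent_scaleR sscale cot_scaleR s_tan, simp_all add: w_def)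
      qed
      show "w p \<alpha> = 0" if "\<alpha> \<notin> cotangent M p" for \<alpha>
        using that by (simp add: w_def fun_eq_iff)
    qed
    then show "w p \<in> skew_forms (cotangent M p)"
      unfolding skew_forms_def using w_skew by (auto simp: w_eq)
  next
    fix \<alpha> \<beta> assume \<alpha>: "\<alpha> \<in> one_forms M" and \<beta>: "\<beta> \<in> one_forms M"
    have "fst \<circ> (\<lambda>p. \<Psi> p (sec (\<lambda>q. 0) \<alpha> p)) \<in> vector_fields M"
      using sec[OF sec_big_sections[OF vf_zero \<alpha>]] unfolding big_sections_def by blast
    then have "(\<lambda>p. s p (\<alpha> p)) \<in> vector_fields M"
      by (simp add: o_def sec_def s_def)
    from of_smooth[OF \<beta> this] show "(\<lambda>p. w p (\<alpha> p) (\<beta> p)) \<in> smooth_funs M"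
      by (simp add: w_eq of_cotangent[OF \<alpha>] of_cotangent[OF \<beta>])
  qed
  have sharp_s: "sharp M w p \<alpha> = s p \<alpha>" if "\<alpha> \<in> cotangent M p" for p \<alpha>
    by (rule sharp_eqI[OF w s_tan[OF that]]) (simp add: w_eq[OF that])
  have sum: "\<Psi> p (v, \<alpha>) = (A p v + s p \<alpha>, - (\<alpha> \<circ> A p))" if "v \<in> tangent M p" "\<alpha> \<in> cotangent M p" for p v \<alpha>
    using add[OF bl[OF that(1)] br[OF that(2)]] by (simp add: left[OF that(1)] right[OF that(2)])
  have "cps_pair M A w \<epsilon>"
  proof unfold_locales
    show "A p (A p v) = \<epsilon> *\<^sub>R v" if v: "v \<in> tangent M p" for p v
      using square[OF bl[OF v]] by (simp add: left[OF v] left[OF A_tan[OF v]])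
    fix \<alpha> \<beta> p assume \<alpha>: "\<alpha> \<in> cotangent M p" and \<beta>: "\<beta> \<in> cotangent M p"
    note aA = cot_endo[OF A \<alpha>]
    \<comment> \<open>The vector part of \<Psi>^2(0, \<alpha>) = \<epsilon>(0, \<alpha>) is
      \<open>s\<close> commuting with \<open>A\<close>; paired with \<beta> this is
      compatibility.\<close>
    have "fst (\<Psi> p (\<Psi> p (0, \<alpha>))) = 0" using square[OF br[OF \<alpha>]] by simp
    then have "A p (s p \<alpha>) + s p (- (\<alpha> \<circ> A p)) = 0"
      by (simp add: right[OF \<alpha>] sum[OF s_tan[OF \<alpha>] cotangent_minus[OF aA]])
    moreover have "s p (- (\<alpha> \<circ> A p)) = - s p (\<alpha> \<circ> A p)"
      using scale[OF br[OF aA], of "-1"] by (simp add: s_def)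
    ultimately have "A p (s p \<alpha>) = s p (\<alpha> \<circ> A p)" by simp
    then show "w p (\<alpha> \<circ> A p) \<beta> = w p \<alpha> (\<beta> \<circ> A p)"
      by (simp add: w_eq[OF aA \<beta>] w_eq[OF \<alpha> cot_endo[OF A \<beta>]])
  qed (rule A, rule w)
  moreover have "\<Psi> = big_endo M A w 0"
  proof (rule ext, rule ext)
    fix p :: 'a and x :: "'a bigvec"
    obtain v \<alpha> where x: "x = (v, \<alpha>)" by (cases x)
    show "\<Psi> p x = big_endo M A w 0 p x"
      using outside[of x p] by (auto simp: x big_endo_def big_tangent_def sum sharp_s)
  qed
  ultimately show ?thesis by blast
qed

end

section \<open>Products and Lie groups\<close>


lemma is_chart_prod:
  assumes "is_chart (U, \<phi>)" "is_chart (V, \<psi>)"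
  shows "is_chart (U \<times> V, map_prod \<phi> \<psi>)"
proof -
  obtain \<phi>' \<psi>' where h: "homeomorphism U (\<phi> ` U) \<phi> \<phi>'" "homeomorphism V (\<psi> ` V) \<psi> \<psi>'"
    using assms by (auto simp: is_chart_def)
  have im: "map_prod f g ` (S \<times> T) = f ` S \<times> g ` T" for f g S T
    by auto
  have cont: "continuous_on (S \<times> T) (map_prod f g)" if "continuous_on S f" "continuous_on T g"
    for f :: "'x::topological_space \<Rightarrow> 'y::topological_space" and g :: "'z::topological_space \<Rightarrow> 'w::topological_space"
      and S T
    unfolding map_prod_def case_prod_beta
    by (intro continuous_on_Pair continuous_on_compose2[OF that(1)] continuous_on_compose2[OF that(2)]
        continuous_on_fst continuous_on_snd continuous_on_id) auto
  have "homeomorphism (U \<times> V) (map_prod \<phi> \<psi> ` (U \<times> V)) (map_prod \<phi> \<psi>) (map_prod \<phi>' \<psi>')"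
    using h unfolding homeomorphism_def im by (auto simp: im cont)
  moreover have "open (U \<times> V)" "open (map_prod \<phi> \<psi> ` (U \<times> V))"
    using is_chartD[OF assms(1)] is_chartD[OF assms(2)] by (simp_all only: im open_Times)
  ultimately show ?thesis unfolding is_chart_def by blast
qed

text \<open>\<open>inv_into\<close> involves a choice, so that it respects products has to be
  derived from injectivity.\<close>

lemma inv_into_map_prod:
  assumes "inj_on f S" "inj_on g T" "y \<in> f ` S" "z \<in> g ` T"
  shows "inv_into (S \<times> T) (map_prod f g) (y, z) = (inv_into S f y, inv_into T g z)"
  using assms by (intro inv_into_f_eq map_prod_inj_on) (auto simp: f_inv_into_f inv_into_into)

lemma push_add: "push N f (u + v) = push N f u + push N f v"
  by (simp add: push_def fun_eq_iff)

lemma push_scaleR: "push N f (c *\<^sub>R v) = c *\<^sub>R push N f v"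
  by (simp add: push_def fun_eq_iff)

lemma push_zero: "push N f 0 = 0"
  by (simp add: push_def fun_eq_iff)

lemma pull_zero: "pull M N f p 0 = 0"
  by (simp add: pull_def fun_eq_iff)

text \<open>The hypothesis is stated through composition with smooth functions; in this form it
  applies alike to slices, translations and the multiplication.\<close>

lemma push_tangent:
  assumes "charted M" "charted N"
    and f: "\<And>h. h \<in> smooth_funs N \<Longrightarrow> (\<lambda>x. h (f x)) \<in> smooth_funs M" and v: "v \<in> tangent M p"
  shows "push N f v \<in> tangent N (f p)"
proof -
  interpret M: charted M by fact
  interpret N: charted N by fact
  show ?thesis
  proof (rule N.tangentI)
    show "push N f v h = 0" if "h \<notin> smooth_funs N" for h
      using that by (simp add: push_def)
    show "push N f v (\<lambda>x. h x + k x) = push N f v h + push N f v k"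
      if "h \<in> smooth_funs N" "k \<in> smooth_funs N" for h k
      using M.tangent_add[OF v f[OF that(1)] f[OF that(2)]] that N.smooth_funs_add[OF that]
      by (simp add: push_def o_def)
    show "push N f v (\<lambda>x. c * h x) = c * push N f v h" if "h \<in> smooth_funs N" for h c
      using M.tangent_cmult[OF v f[OF that], of c] that N.smooth_funs_mult[OF N.smooth_funs_const that, of c]
      by (simp add: push_def o_def)
    show "push N f v (\<lambda>x. h x * k x) = push N f v h * k (f p) + h (f p) * push N f v k"
      if "h \<in> smooth_funs N" "k \<in> smooth_funs N" for h k
      using M.tangent_mult[OF v f[OF that(1)] f[OF that(2)]] that N.smooth_funs_mult[OF that]
      by (simp add: push_def o_def)
  qed
qed

lemma pull_cotangent:
  assumes "charted M" "charted N"
    and f: "\<And>h. h \<in> smooth_funs N \<Longrightarrow> (\<lambda>x. h (f x)) \<in> smooth_funs M" and \<beta>: "\<beta> \<in> cotangent N (f p)"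
  shows "pull M N f p \<beta> \<in> cotangent M p"
proof -
  interpret M: charted M by fact
  interpret N: charted N by fact
  have t: "push N f v \<in> tangent N (f p)" if "v \<in> tangent M p" for v
    by (rule push_tangent[where f=f, OF assms(1,2) f that])
  show ?thesis
    by (rule M.cotI) (simp_all add: pull_def M.tangent_plus M.tangent_scaleR push_add push_scaleR
        N.cot_add[OF \<beta> t t] N.cot_scaleR[OF \<beta> t])
qed

section \<open>The square of a manifold and the vanishing of the 2-form\<close>

context smooth_mfd begin

abbreviation "MM \<equiv> prod_atlas M M"

lemma charted: "charted M"
  by unfold_locales

lemma charted_prod: "charted MM"
  by unfold_locales (auto simp: prod_atlas_def intro!: is_chart_prod is_chart)

interpretation P: charted MM
  by (rule charted_prod)

text \<open>In a product chart the slice is \<open>h\<close> composed with an affine embedding,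
  whose second coordinate comes from a chart around \<open>b\<close>.\<close>

lemma smooth_funs_slice:
  assumes h: "h \<in> smooth_funs MM"
  shows smooth_funs_slice_left: "(\<lambda>x. h (x, b)) \<in> smooth_funs M"
    and smooth_funs_slice_right: "(\<lambda>y. h (b, y)) \<in> smooth_funs M"
proof -
  obtain V \<psi> where V: "(V, \<psi>) \<in> M" "b \<in> V" using ex_chart by blast
  note cV = is_chartD[OF is_chart[OF V(1)]]
  have hs: "smooth_on (\<phi>\<^sub>1 ` U\<^sub>1 \<times> \<phi>\<^sub>2 ` U\<^sub>2) (h \<circ> inv_into (U\<^sub>1 \<times> U\<^sub>2) (map_prod \<phi>\<^sub>1 \<phi>\<^sub>2))"
    if "(U\<^sub>1, \<phi>\<^sub>1) \<in> M" "(U\<^sub>2, \<phi>\<^sub>2) \<in> M" for U\<^sub>1 \<phi>\<^sub>1 U\<^sub>2 \<phi>\<^sub>2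
  proof -
    have "(U\<^sub>1 \<times> U\<^sub>2, map_prod \<phi>\<^sub>1 \<phi>\<^sub>2) \<in> MM" using that by (force simp: prod_atlas_def)
    moreover have "map_prod \<phi>\<^sub>1 \<phi>\<^sub>2 ` (U\<^sub>1 \<times> U\<^sub>2) = \<phi>\<^sub>1 ` U\<^sub>1 \<times> \<phi>\<^sub>2 ` U\<^sub>2" by auto
    ultimately show ?thesis using h by (force simp: smooth_funs_def)
  qed
  have "smooth_on (\<phi> ` U) ((\<lambda>x. h (x, b)) \<circ> inv_into U \<phi>)"
    "smooth_on (\<phi> ` U) ((\<lambda>y. h (b, y)) \<circ> inv_into U \<phi>)" if U: "(U, \<phi>) \<in> M" for U \<phi>
  proof -
    note cU = is_chartD[OF is_chart[OF U]]
    \<comment> \<open>A bounded linear map plus a constant, so smoothness follows from the two basic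
      cases.\<close>
    have l: "smooth_on (\<phi> ` U) (\<lambda>y. (y, 0) + (0, \<psi> b))" "smooth_on (\<phi> ` U) (\<lambda>y. (0, y) + (\<psi> b, 0))"
      by (intro smooth_on_add smooth_on_const smooth_on_bounded_linear cU bounded_linear_Pair
          bounded_linear_ident bounded_linear_zero)+
    have b: "inv_into V \<psi> (\<psi> b) = b" using V(2) cV(3) by simp
    have "smooth_on (\<phi> ` U) (\<lambda>y. (h \<circ> inv_into (U \<times> V) (map_prod \<phi> \<psi>)) ((y, 0) + (0, \<psi> b)))"
      by (rule smooth_on_compose[OF cU(2) open_Times[OF cU(2) cV(2)] hs[OF U V(1)] l(1)]) (use V(2) in auto)
    then show "smooth_on (\<phi> ` U) ((\<lambda>x. h (x, b)) \<circ> inv_into U \<phi>)"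
      by (rule smooth_on_cong[OF cU(2)]) (use V(2) b in \<open>simp add: inv_into_map_prod[OF cU(3) cV(3)]\<close>)
    have "smooth_on (\<phi> ` U) (\<lambda>y. (h \<circ> inv_into (V \<times> U) (map_prod \<psi> \<phi>)) ((0, y) + (\<psi> b, 0)))"
      by (rule smooth_on_compose[OF cU(2) open_Times[OF cV(2) cU(2)] hs[OF V(1) U] l(2)]) (use V(2) in auto)
    then show "smooth_on (\<phi> ` U) ((\<lambda>y. h (b, y)) \<circ> inv_into U \<phi>)"
      by (rule smooth_on_cong[OF cU(2)]) (use V(2) b in \<open>simp add: inv_into_map_prod[OF cV(3) cU(3)]\<close>)
  qed
  then show "(\<lambda>x. h (x, b)) \<in> smooth_funs M" "(\<lambda>y. h (b, y)) \<in> smooth_funs M"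
    by (auto simp: smooth_funs_def)
qed

lemma push_left_tangent: "v \<in> tangent M a \<Longrightarrow> push MM (\<lambda>x. (x, b)) v \<in> tangent MM (a, b)"
  by (rule push_tangent[where f="\<lambda>x. (x, b)", OF charted charted_prod smooth_funs_slice_left])

lemma push_right_tangent: "v \<in> tangent M b \<Longrightarrow> push MM (\<lambda>y. (a, y)) v \<in> tangent MM (a, b)"
  by (rule push_tangent[where f="\<lambda>y. (a, y)", OF charted charted_prod smooth_funs_slice_right])

lemma pull_left_cotangent: "\<beta> \<in> cotangent MM (a, b) \<Longrightarrow> pull M MM (\<lambda>x. (x, b)) a \<beta> \<in> cotangent M a"
  by (rule pull_cotangent[where f="\<lambda>x. (x, b)", OF charted charted_prod smooth_funs_slice_left])

lemma pull_right_cotangent: "\<beta> \<in> cotangent MM (a, b) \<Longrightarrow> pull M MM (\<lambda>y. (a, y)) b \<beta> \<in> cotangent M b"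
  by (rule pull_cotangent[where f="\<lambda>y. (a, y)", OF charted charted_prod smooth_funs_slice_right])

lemma tensor_A_sum:
  assumes "v \<in> tangent MM p"
  shows "tensor_A (big_endo_sum M M \<Psi> \<Psi>') p v = endo_sum M M (tensor_A \<Psi>) (tensor_A \<Psi>') p v"
  using assms P.cotangent_zero
  by (cases p) (simp add: tensor_A_def big_endo_sum_def endo_sum_def big_tangent_def pull_zero split: prod.split)

lemma tensor_\<sigma>_sum:
  assumes "v \<in> tangent MM (a, b)"
  shows "tensor_\<sigma> (big_endo_sum M M \<Psi> \<Psi>') (a, b) v =
    pull MM M fst (a, b) (snd (\<Psi> a (push M fst v, 0))) + pull MM M snd (a, b) (snd (\<Psi>' b (push M snd v, 0)))"
  using assms P.cotangent_zero
  by (simp add: tensor_\<sigma>_def fun_eq_iff big_endo_sum_def big_tangent_def pull_zero split: prod.split)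

text \<open>The sum of the 2-forms vanishes on (u, 0) and (0, v') for two reasons: the covector of
  the first factor meets the zero component of (0, v'), and in the second factor \<Psi> is applied
  to 0.\<close>

lemma tensor_\<sigma>_vanishes:
  assumes lin: "\<And>p. \<Psi> p \<in> lin_maps (big_tangent M p) (big_tangent M p)"
    and G: "group mul e ginv" and \<mu>: "\<And>h. h \<in> smooth_funs M \<Longrightarrow> (\<lambda>(x, y). h (mul x y)) \<in> smooth_funs MM"
    and rel: "two_form_related MM M (\<lambda>(x, y). mul x y) (tensor_\<sigma> (big_endo_sum M M \<Psi> \<Psi>)) (tensor_\<sigma> \<Psi>)"
    and u: "u \<in> tangent M g" and v: "v \<in> tangent M g"
  shows "tensor_\<sigma> \<Psi> g u v = 0"
proof -
  interpret G: group mul e ginv by fact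
  have left: "(\<lambda>y. h (mul a y)) \<in> smooth_funs M" if "h \<in> smooth_funs M" for h a
    using smooth_funs_slice_right[OF \<mu>[OF that], of a] by simp
  \<comment> \<open>The preimage of \<open>v\<close> at the unit under left translation by
    \<open>g\<close>. The multiplication thus sends the two chosen vectors at (g, e) to
    \<open>u\<close>, by the unit law, and to \<open>v\<close>, by associativity.\<close>
  let ?v = "push M (mul (ginv g)) v"
  have v': "?v \<in> tangent M e"
    using push_tangent[where f="mul (ginv g)", OF charted charted left v] by simp
  let ?i = "\<lambda>x. (x, e)" and ?j = "\<lambda>y. (g, y)"
  have U: "push MM ?i u \<in> tangent MM (g, e)" and V: "push MM ?j ?v \<in> tangent MM (g, e)"
    by (rule push_left_tangent[OF u], rule push_right_tangent[OF v'])
  have U2: "push M snd (push MM ?i u) = 0"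
    using tangent_const[OF u] by (auto simp: push_def fun_eq_iff o_def)
  have V1: "push M fst (push MM ?j ?v) = 0"
    using tangent_const[OF v'] by (auto simp: push_def[of M fst] push_def[of MM] fun_eq_iff o_def)
  have mU: "push M (\<lambda>(x, y). mul x y) (push MM ?i u) = u"
  proof (rule ext)
    show "push M (\<lambda>(x, y). mul x y) (push MM ?i u) h = u h" for h
      using \<mu>[of h] tangent_outside[OF u, of h]
      by (auto simp: push_def o_def split_beta')
  qed
  have mV: "push M (\<lambda>(x, y). mul x y) (push MM ?j ?v) = v"
  proof (rule ext)
    show "push M (\<lambda>(x, y). mul x y) (push MM ?j ?v) h = v h" for h
      using \<mu>[of h] left[of h g] tangent_outside[OF v, of h]
      by (auto simp: push_def o_def split_beta' G.assoc[symmetric])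
  qed
  \<comment> \<open>The default value 0 gives this for every \<open>x\<close>, so it applies at once
    to components obtained by pushing forward along the projections.\<close>
  have big: "\<Psi> p x \<in> big_tangent M p" for p x
  proof (cases "x \<in> big_tangent M p")
    case True
    then show ?thesis using lin[of p] unfolding lin_maps_def by blast
  next
    case False
    then have "\<Psi> p x = 0" using lin[of p] unfolding lin_maps_def by blast
    then show ?thesis by (simp add: big_tangent_def zero_prod_def tangent_zero cotangent_zero)
  qed
  have zero: "\<Psi> p (0, 0) = 0" for p
  proof -
    have "(0, 0) \<in> big_tangent M p" by (simp add: big_tangent_def tangent_zero cotangent_zero)
    then have "\<Psi> p (0 *\<^sub>R (0, 0)) = 0 *\<^sub>R \<Psi> p (0, 0)" using lin[of p] unfolding lin_maps_def by blast
    then show ?thesis by (simp add: zero_prod_def)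
  qed
  have c: "snd (\<Psi> g (push M fst (push MM ?i u), 0)) \<in> cotangent M g"
    using big[of g] by (auto simp: big_tangent_def mem_Times_iff)
  have "tensor_\<sigma> (big_endo_sum M M \<Psi> \<Psi>) (g, e) (push MM ?i u) (push MM ?j ?v) = 0"
    unfolding tensor_\<sigma>_sum[OF U] U2 zero
    using V V1 cot_zero[OF c] by (simp add: pull_zero pull_def)
  moreover have "tensor_\<sigma> (big_endo_sum M M \<Psi> \<Psi>) (g, e) (push MM ?i u) (push MM ?j ?v) = tensor_\<sigma> \<Psi> g u v"
    using rel U V mU mV unfolding two_form_related_def by fastforce
  ultimately show ?thesis by simp
qed

end

section \<open>The multiplication as a generalized mapping\<close>

context cps_pair begin

interpretation P: charted MM
  by (rule charted_prod)

text \<open>Evaluating a covector on an embedded vector is evaluating its pullback on the vector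
  itself; this turns the summands of the big endomorphism into those of the bivector.\<close>

lemma tensor_\<pi>_sum:
  assumes \<alpha>: "\<alpha> \<in> cotangent MM (a, b)" and \<beta>: "\<beta> \<in> cotangent MM (a, b)"
  shows "tensor_\<pi> (big_endo_sum M M \<Phi> \<Phi>) (a, b) \<alpha> \<beta> = bivector_sum M M w w (a, b) \<alpha> \<beta>"
proof -
  note al = pull_left_cotangent[OF \<alpha>] and ar = pull_right_cotangent[OF \<alpha>]
    and bl = pull_left_cotangent[OF \<beta>] and br = pull_right_cotangent[OF \<beta>]
  note sl = sharp_tangent[OF w al] and sr = sharp_tangent[OF w ar]
  have "tensor_\<pi> (big_endo_sum M M \<Phi> \<Phi>) (a, b) \<alpha> \<beta>
      = \<beta> (push MM (\<lambda>x. (x, b)) (sharp M w a (pull M MM (\<lambda>x. (x, b)) a \<alpha>))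
         + push MM (\<lambda>y. (a, y)) (sharp M w b (pull M MM (\<lambda>y. (a, y)) b \<alpha>)))"
    using \<alpha> P.tangent_zero
    by (simp add: tensor_\<pi>_def big_endo_sum_def big_tangent_def push_zero \<Phi>_right[OF al] \<Phi>_right[OF ar])
  also have "\<dots> = pull M MM (\<lambda>x. (x, b)) a \<beta> (sharp M w a (pull M MM (\<lambda>x. (x, b)) a \<alpha>))
      + pull M MM (\<lambda>y. (a, y)) b \<beta> (sharp M w b (pull M MM (\<lambda>y. (a, y)) b \<alpha>))"
    by (simp add: P.cot_add[OF \<beta> push_left_tangent[OF sl] push_right_tangent[OF sr]] pull_def[of _ _ _ _ \<beta>] sl sr)
  finally show ?thesis
    by (simp add: bivector_sum_def \<alpha> \<beta> sharp_apply[OF w al bl] sharp_apply[OF w ar br])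
qed

text \<open>The 2-form condition reads 0 = 0. For the bivectors it suffices to compare on pullbacks
  along the multiplication, which are covectors on the product.\<close>

lemma generalized_cps_map_iff:
  assumes \<mu>: "\<And>h. h \<in> smooth_funs M \<Longrightarrow> (\<lambda>(x, y). h (mul x y)) \<in> smooth_funs MM"
    and smooth: "smooth_map MM M (\<lambda>(x, y). mul x y)"
  shows "generalized_cps_map MM M (big_endo_sum M M \<Phi> \<Phi>) \<Phi> (\<lambda>(x, y). mul x y) \<longleftrightarrow>
    multiplicative_bivector M mul w \<and> endo_related MM M (\<lambda>(x, y). mul x y) (endo_sum M M A A) A"
proof -
  let ?\<mu> = "\<lambda>(x, y). mul x y"
  have \<mu>': "(\<lambda>z. h (?\<mu> z)) \<in> smooth_funs MM" if "h \<in> smooth_funs M" for h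
    using \<mu>[OF that] by (simp add: split_beta')
  have "two_form_related MM M ?\<mu> (tensor_\<sigma> (big_endo_sum M M \<Phi> \<Phi>)) (tensor_\<sigma> \<Phi>)"
  proof -
    have "tensor_\<sigma> (big_endo_sum M M \<Phi> \<Phi>) p v u = 0" if "v \<in> tangent MM p" for p v u
      using that by (cases p) (simp add: tensor_\<sigma>_sum snd_\<Phi>_left pull_zero)
    then show ?thesis
      unfolding two_form_related_def by (simp add: tensor_\<sigma>_def[of \<Phi>] snd_\<Phi>_left)
  qed
  moreover have "endo_related MM M ?\<mu> (tensor_A (big_endo_sum M M \<Phi> \<Phi>)) (tensor_A \<Phi>)
      \<longleftrightarrow> endo_related MM M ?\<mu> (endo_sum M M A A) A"
    unfolding endo_related_def by (simp add: tensor_A_sum tensor_A_\<Phi>)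
  moreover have "bivector_related MM M ?\<mu> (tensor_\<pi> (big_endo_sum M M \<Phi> \<Phi>)) (tensor_\<pi> \<Phi>)
      \<longleftrightarrow> bivector_related MM M ?\<mu> (bivector_sum M M w w) w"
  proof -
    have "tensor_\<pi> (big_endo_sum M M \<Phi> \<Phi>) p (pull MM M ?\<mu> p \<alpha>) (pull MM M ?\<mu> p \<beta>)
        = bivector_sum M M w w p (pull MM M ?\<mu> p \<alpha>) (pull MM M ?\<mu> p \<beta>)"
      if "\<alpha> \<in> cotangent M (?\<mu> p)" "\<beta> \<in> cotangent M (?\<mu> p)" for p \<alpha> \<beta>
      using tensor_\<pi>_sum[of _ "fst p" "snd p"]
        pull_cotangent[where f="?\<mu>" and p=p, OF charted_prod charted \<mu>' that(1)]
        pull_cotangent[where f="?\<mu>" and p=p, OF charted_prod charted \<mu>' that(2)] by simp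
    then show ?thesis
      unfolding bivector_related_def by (simp add: tensor_\<pi>_\<Phi>)
  qed
  ultimately show ?thesis
    unfolding generalized_cps_map_def multiplicative_bivector_def using smooth by blast
qed

end

text \<open>Both directions rest on one equivalence for a given \<open>cps_pair\<close>. From left
  to right such a pair is extracted once \<sigma> vanishes; from right to left its algebraic
  conditions are part of the classical data.\<close>

lemma generalized_cps_lie_group_iff:
  assumes lie: "lie_group M mul e ginv" and \<epsilon>: "\<epsilon> \<in> {-1, 0, 1}"
  shows "generalized_cps_lie_group M mul \<epsilon> \<Psi> \<longleftrightarrow>
    (\<exists>A w. classical_lie_group M mul \<epsilon> A \<and> poisson_bivector M w \<and> multiplicative_bivector M mul w
       \<and> poisson_nijenhuis M w A \<and> \<Psi> = big_endo M A w 0)"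
proof -
  interpret smooth_mfd M
    using lie by unfold_locales (simp add: lie_group_def)
  have G: "group mul e ginv" and smooth: "smooth_map MM M (\<lambda>(x, y). mul x y)"
    using lie by (auto simp: lie_group_def)
  have \<mu>: "(\<lambda>(x, y). h (mul x y)) \<in> smooth_funs MM" if "h \<in> smooth_funs M" for h
    using smooth_funs_compose[OF charted.is_chart[OF charted_prod] is_chart charts_cover smooth that]
    by (simp add: split_beta')
  \<comment> \<open>For a fixed pair the almost structure is automatic; integrability splits into
    the three differential conditions and the mapping property into the two multiplicativity
    conditions.\<close>
  have iff: "generalized_cps_lie_group M mul \<epsilon> (big_endo M A w 0) \<longleftrightarrow>
      classical_lie_group M mul \<epsilon> A \<and> poisson_bivector M w \<and> multiplicative_bivector M mul w
       \<and> poisson_nijenhuis M w A" if "cps_pair M A w \<epsilon>" for A w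
  proof -
    interpret cps_pair M A w \<epsilon> by fact
    have "generalized_cps_map MM M (big_endo_sum M M \<Phi> \<Phi>) \<Phi> (\<lambda>(x, y). mul x y) \<longleftrightarrow>
        multiplicative_bivector M mul w \<and> endo_related MM M (\<lambda>(x, y). mul x y) (endo_sum M M A A) A"
      by (rule generalized_cps_map_iff[OF \<mu> smooth])
    then show ?thesis
      unfolding generalized_cps_lie_group_def generalized_cps_def \<Phi>_def[symmetric]
        integrable_char classical_lie_group_def classical_structure_def
        poisson_nijenhuis_def poisson_bivector_def
      using \<Phi>_almost_cps[OF \<epsilon>] A w compatible A_square by blast
  qed
  show ?thesis
  proof
    assume L: "generalized_cps_lie_group M mul \<epsilon> \<Psi>"
    then have almost: "generalized_almost_cps M \<epsilon> \<Psi>"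
      and rel: "two_form_related MM M (\<lambda>(x, y). mul x y) (tensor_\<sigma> (big_endo_sum M M \<Psi> \<Psi>)) (tensor_\<sigma> \<Psi>)"
      by (simp_all add: generalized_cps_lie_group_def generalized_cps_def generalized_cps_map_def)
    have lin: "\<Psi> p \<in> lin_maps (big_tangent M p) (big_tangent M p)" for p
      using almost unfolding generalized_almost_cps_def big_endo_fields_def by blast
    obtain A w where "cps_pair M A w \<epsilon>" "\<Psi> = big_endo M A w 0"
      using almost_cps_decompose[OF almost tensor_\<sigma>_vanishes[OF lin G \<mu> rel]] by blast
    then show "\<exists>A w. classical_lie_group M mul \<epsilon> A \<and> poisson_bivector M w \<and> multiplicative_bivector M mul w
       \<and> poisson_nijenhuis M w A \<and> \<Psi> = big_endo M A w 0"
      using iff L by blast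
  next
    assume "\<exists>A w. classical_lie_group M mul \<epsilon> A \<and> poisson_bivector M w \<and> multiplicative_bivector M mul w
       \<and> poisson_nijenhuis M w A \<and> \<Psi> = big_endo M A w 0"
    then obtain A w where *: "classical_lie_group M mul \<epsilon> A" "poisson_bivector M w"
        "multiplicative_bivector M mul w" "poisson_nijenhuis M w A" and \<Psi>: "\<Psi> = big_endo M A w 0" by blast
    have "cps_pair M A w \<epsilon>"
      by unfold_locales
         (use * in \<open>simp_all add: classical_lie_group_def classical_structure_def poisson_nijenhuis_def
            poisson_bivector_def\<close>)
    then show "generalized_cps_lie_group M mul \<epsilon> \<Psi>" using iff * \<Psi> by blast
  qed
qed

theorem proposition1p6:
  fixes M :: "('a::{t2_space, second_countable_topology}, 'e::fin_dim_inner) atlas"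
    and mul :: "'a \<Rightarrow> 'a \<Rightarrow> 'a" and e :: 'a and ginv :: "'a \<Rightarrow> 'a"
  assumes "lie_group M mul e ginv"
  shows "(\<forall>\<Phi>. generalized_complex_lie_group M mul \<Phi> \<longleftrightarrow>
            (\<exists>A w. complex_lie_group M mul A
               \<and> poisson_bivector M w \<and> multiplicative_bivector M mul w
               \<and> poisson_nijenhuis M w A
               \<and> \<Phi> = big_endo M A w 0))
       \<and> (\<forall>\<Phi>. generalized_paracomplex_lie_group M mul \<Phi> \<longleftrightarrow>
            (\<exists>A w. paracomplex_lie_group M mul A
               \<and> poisson_bivector M w \<and> multiplicative_bivector M mul w
               \<and> poisson_nijenhuis M w A
               \<and> \<Phi> = big_endo M A w 0))"
  by (intro conjI allI generalized_cps_lie_group_iff[OF assms]) simp_all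

end
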